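(* Consider the regularized slab-geometry radiative transfer model with density $\phi$ and its Random Ordinates Method (ROM) approximation with random density $\phi^{\xi}$, as defined in the context. Assume that $\psi_L$ is Lipschitz continuous on $(0,1)$ and $\psi_R$ is Lipschitz continuous on $(-1,0)$, and that the rescaled weights $\alpha_\ell$ are bounded uniformly in $\ell$ and $n$. Then there exist $n_0>0$ and a constant $C>0$ independent of $n$ such that for all (even) $n>n_0$ the expected single-run error satisfies $$\mathbb{E}\,\|\phi^{\xi}-\phi\|\le C\,n^{-3/2}(\log n)^{1/2},$$ and the bias satisfies $$\|\mathbb{E}\phi^{\xi}-\phi\|\le C\,\lambda\, n^{-3}\log n .$$ Here $\|\cdot\|$ is the norm of $L^2(\Omega;\sigma_T)$.
   Context: **Data.** $\Omega=[x_L,x_R]$ is a bounded interval. The cross sections $\sigma_S,\sigma_T$ are strictly positive bounded functions on $\Omega$ (bounded above, and below by positive constants), $\sigma_S\le\sigma_T$, and $q$ is a nonnegative bounded function on $\Omega$. Set $\lambda=\|\sigma_S/\sigma_T\|_\infty$ and assume $\lambda\in(0,1)$; set $\sigma_r=\sigma_S/\lambda$, so $\sigma_r\le\sigma_T$. The space $L^2(\Omega;\sigma_T)$ has inner product $\langle f,g\rangle=\int_{x_L}^{x_R} f g\,\sigma_T\,dx$. The inflow data are functions $\psi_L(\mu)$ for $\mu>0$ and $\psi_R(\mu)$ for $\mu<0$. **Regularized model.** Fix $\delta\in(0,1)$ and let $S=[-1,-\delta)\cup(\delta,1]$, $|S|=2(1-\delta)$. The regularized model is: for $\mu\in S$, $$\mu\,\partial_x\psi(x,\mu)+\sigma_T(x)\psi(x,\mu)=\lambda\sigma_r(x)\phi(x)+q(x),\qquad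 \phi(x)=\frac1{|S|}\int_S\psi(x,\mu)\,d\mu,$$ with $\psi(x_L,\mu)=\psi_L(\mu)$ for $\mu>0$ and $\psi(x_R,\mu)=\psi_R(\mu)$ for $\mu<0$. **ROM.** Let $n=2m$ be even. For each $n$, $S$ is partitioned into $n$ subintervals $S_1,\dots,S_n$, symmetrically about $0$: $S_1,\dots,S_m$ partition $[-1,-\delta)$ and $S_{n+1-\ell}=-S_\ell$ for $1\le\ell\le m$. The weights are $\omega_\ell=|S_\ell|/|S|$ and the rescaled weights are $\alpha_\ell=n\,\omega_\ell$. The random ordinates $\mu^\xi_\ell$, $1\le\ell\le m$, are independent, with $\mu_\ell^\xi$ uniformly distributed in $S_\ell$, and $\mu^\xi_{n+1-\ell}=-\mu^\xi_\ell$. One run of ROM solves, for $\ell=1,\dots,n$, $$\mu_\ell^\xi\frac{d}{dx}\psi^\xi_\ell(x)+\sigma_T(x)\psi_\ell^\xi(x)=\lambda\sigma_r(x)\phi^\xi(x)+q(x),\qquad \phi^\xi(x)=\sum_{\ell=1}^n\omega_\ell\psi_\ell^\xi(x),$$ with $\psi^\xi_\ell(x_L)=\psi_L(\mu_\ell^\xi)$ if $\mu_\ell^\xi>0$ and $\psi^\xi_\ell(x_R)=\psi_R(\mu_\ell^\xi)$ if $\mu_\ell^\xi<0$. $\mathbb{E}$ is expectation over the random ordinates. *)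

theory Defs
  imports "HOL-Probability.Probability"
begin

definition absolutely_continuous_on_interval :: "real \<Rightarrow> real \<Rightarrow> (real \<Rightarrow> real) \<Rightarrow> bool" where
  "absolutely_continuous_on_interval a b f \<longleftrightarrow>
     (\<forall>e>0. \<exists>d>0. \<forall>\<D> t. \<D> division_of t \<and> t \<subseteq> {a..b} \<and> (\<Sum>k\<in>\<D>. measure lborel k) < d
        \<longrightarrow> (\<Sum>k\<in>\<D>. \<bar>f (Sup k) - f (Inf k)\<bar>) < e)"

definition L2_function :: "real \<Rightarrow> real \<Rightarrow> (real \<Rightarrow> real) \<Rightarrow> (real \<Rightarrow> real) \<Rightarrow> bool" where
  "L2_function xL xR w f \<longleftrightarrow> f \<in> borel_measurable (lebesgue_on {xL..xR}) \<and>
     integrable (lebesgue_on {xL..xR}) (\<lambda>x. f x * f x * w x)"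

definition L2_norm :: "real \<Rightarrow> real \<Rightarrow> (real \<Rightarrow> real) \<Rightarrow> (real \<Rightarrow> real) \<Rightarrow> real" where
  "L2_norm xL xR w f = sqrt (LINT x|lebesgue_on {xL..xR}. f x * f x * w x)"

definition Linf_norm :: "real \<Rightarrow> real \<Rightarrow> (real \<Rightarrow> real) \<Rightarrow> real" where
  "Linf_norm xL xR f = real_of_ereal (esssup (lebesgue_on {xL..xR}) (\<lambda>x. ereal \<bar>f x\<bar>))"

definition cross_section :: "real \<Rightarrow> real \<Rightarrow> (real \<Rightarrow> real) \<Rightarrow> bool" where
  "cross_section xL xR \<sigma> \<longleftrightarrow> \<sigma> \<in> borel_measurable (lebesgue_on {xL..xR}) \<and>
     (\<exists>c>0. \<exists>B. \<forall>x\<in>{xL..xR}. c \<le> \<sigma> x \<and> \<sigma> x \<le> B)"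

text \<open>The coefficients are only bounded and measurable, so a solution of
  \<open>\<mu> f' + \<sigma>\<^sub>T f = Q\<close> is understood in the sense of Caratheodory: \<open>f\<close> is absolutely
  continuous and satisfies the equation almost everywhere. The value of \<open>f\<close> is
  prescribed at the end through which direction \<open>\<mu>\<close> enters the slab.\<close>

definition transport_solution ::
  "real \<Rightarrow> real \<Rightarrow> (real \<Rightarrow> real) \<Rightarrow> (real \<Rightarrow> real) \<Rightarrow> (real \<Rightarrow> real) \<Rightarrow> real \<Rightarrow>
   (real \<Rightarrow> real) \<Rightarrow> (real \<Rightarrow> real) \<Rightarrow> bool" where
  "transport_solution xL xR \<sigma>T \<psi>L \<psi>R \<mu> Q f \<longleftrightarrow>
     absolutely_continuous_on_interval xL xR f \<and>
     (AE x in lebesgue_on {xL..xR}.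
        \<exists>f'. (f has_real_derivative f') (at x within {xL..xR}) \<and> \<mu> * f' + \<sigma>T x * f x = Q x) \<and>
     (\<mu> > 0 \<longrightarrow> f xL = \<psi>L \<mu>) \<and> (\<mu> < 0 \<longrightarrow> f xR = \<psi>R \<mu>)"

definition angles :: "real \<Rightarrow> real set" where
  "angles \<delta> = {-1..<-\<delta>} \<union> {\<delta><..1}"

definition density_of :: "real \<Rightarrow> (real \<Rightarrow> real \<Rightarrow> real) \<Rightarrow> real \<Rightarrow> real" where
  "density_of \<delta> \<psi> x = (LINT \<mu>:angles \<delta>|lebesgue. \<psi> x \<mu>) / measure lborel (angles \<delta>)"

definition regularized_solution ::
  "real \<Rightarrow> real \<Rightarrow> (real \<Rightarrow> real) \<Rightarrow> (real \<Rightarrow> real) \<Rightarrow> (real \<Rightarrow> real) \<Rightarrow> real \<Rightarrow> real \<Rightarrow>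
   (real \<Rightarrow> real) \<Rightarrow> (real \<Rightarrow> real) \<Rightarrow> (real \<Rightarrow> real \<Rightarrow> real) \<Rightarrow> bool" where
  "regularized_solution xL xR \<sigma>T \<sigma>r q lam \<delta> \<psi>L \<psi>R \<psi> \<longleftrightarrow>
     (\<forall>x\<in>{xL..xR}. set_integrable lebesgue (angles \<delta>) (\<psi> x)) \<and>
     (\<forall>\<mu>\<in>angles \<delta>. transport_solution xL xR \<sigma>T \<psi>L \<psi>R \<mu>
        (\<lambda>x. lam * \<sigma>r x * density_of \<delta> \<psi> x + q x) (\<lambda>x. \<psi> x \<mu>))"

definition angular_partition :: "real \<Rightarrow> nat \<Rightarrow> (nat \<Rightarrow> real set) \<Rightarrow> bool" where
  "angular_partition \<delta> n S \<longleftrightarrow>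
     (\<forall>l\<in>{1..n}. is_interval (S l)) \<and>
     disjoint_family_on S {1..n div 2} \<and>
     (\<Union>l\<in>{1..n div 2}. S l) = {-1..<-\<delta>} \<and>
     (\<forall>l\<in>{1..n div 2}. S (n + 1 - l) = uminus ` S l)"

definition angular_weight :: "real \<Rightarrow> real set \<Rightarrow> real" where
  "angular_weight \<delta> I = measure lborel I / measure lborel (angles \<delta>)"

text \<open>The condition on the distributions forces every cell to have positive length,
  since \<open>uniform_measure lborel I\<close> is the zero measure for a null set \<open>I\<close>.\<close>

definition random_ordinates ::
  "nat \<Rightarrow> (nat \<Rightarrow> real set) \<Rightarrow> 'w measure \<Rightarrow> (nat \<Rightarrow> 'w \<Rightarrow> real) \<Rightarrow> bool" where
  "random_ordinates n S M \<mu> \<longleftrightarrow>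
     prob_space M \<and>
     prob_space.indep_vars M (\<lambda>_. borel) \<mu> {1..n div 2} \<and>
     (\<forall>l\<in>{1..n div 2}. distr M borel (\<mu> l) = uniform_measure lborel (S l)) \<and>
     (\<forall>l\<in>{1..n div 2}. \<forall>\<xi>\<in>space M. \<mu> l \<xi> \<in> S l \<and> \<mu> (n + 1 - l) \<xi> = - \<mu> l \<xi>)"

definition rom_density ::
  "real \<Rightarrow> nat \<Rightarrow> (nat \<Rightarrow> real set) \<Rightarrow> (nat \<Rightarrow> real \<Rightarrow> real) \<Rightarrow> real \<Rightarrow> real" where
  "rom_density \<delta> n S \<psi> x = (\<Sum>l=1..n. angular_weight \<delta> (S l) * \<psi> l x)"

definition rom_solution ::
  "real \<Rightarrow> real \<Rightarrow> (real \<Rightarrow> real) \<Rightarrow> (real \<Rightarrow> real) \<Rightarrow> (real \<Rightarrow> real) \<Rightarrow> real \<Rightarrow> real \<Rightarrow>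
   (real \<Rightarrow> real) \<Rightarrow> (real \<Rightarrow> real) \<Rightarrow> nat \<Rightarrow> (nat \<Rightarrow> real set) \<Rightarrow> (nat \<Rightarrow> real) \<Rightarrow>
   (nat \<Rightarrow> real \<Rightarrow> real) \<Rightarrow> bool" where
  "rom_solution xL xR \<sigma>T \<sigma>r q lam \<delta> \<psi>L \<psi>R n S \<mu> \<psi> \<longleftrightarrow>
     (\<forall>l\<in>{1..n}. transport_solution xL xR \<sigma>T \<psi>L \<psi>R (\<mu> l)
        (\<lambda>x. lam * \<sigma>r x * rom_density \<delta> n S \<psi> x + q x) (\<psi> l))"

end

theory Submission
  imports Defs
begin

text \<open>
  Write \<open>\<tau>\<close> for the optical depth, the primitive of \<open>\<sigma>\<^sub>T\<close> that vanishes at \<open>x\<^sub>L\<close>. Solving the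
  transport equation by an integrating factor and adding the solutions for the two directions
  \<open>s\<close> and \<open>- s\<close> produces one symmetric kernel \<open>exp (- \<bar>\<tau> x - \<tau> y\<bar> / s) / s\<close>, because either direction
  sees one side of \<open>x\<close>. Both models then become fixed point equations for the density alone.
  With \<open>p\<^sub>l\<close> the share of the cell \<open>S\<^sub>l\<close> in the negative directions and \<open>X\<^sub>l\<close> the random ordinate in it,
  the random density solves \<open>\<phi>\<^sub>\<xi> = \<Sum>\<^sub>l p\<^sub>l (\<kappa>(X\<^sub>l) \<phi>\<^sub>\<xi> + g(X\<^sub>l))\<close> and the exact density solves
  \<open>\<phi> = \<Sum>\<^sub>l p\<^sub>l E (\<kappa>(X\<^sub>l) \<phi> + g(X\<^sub>l))\<close>, since averaging over the cells averages over all directions.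

  Two properties of \<open>\<kappa>\<close> and \<open>g\<close> carry everything. The mass \<open>\<integral> \<kappa>(t) x y dy\<close> is at most \<open>\<lambda> < 1\<close>
  (the kernel with \<open>\<sigma>\<^sub>T\<close> in place of \<open>\<sigma>\<^sub>S\<close> has mass at most one), so the averaged operators are
  contractions in the supremum norm, uniformly in \<open>n\<close> and in the ordinates. And \<open>\<kappa>\<close> and \<open>g\<close> are
  Lipschitz in the direction because \<open>\<delta>\<close> keeps it away from zero, so on the cell \<open>S\<^sub>l\<close> they oscillate
  by some \<open>\<eta>\<^sub>l\<close> of order \<open>1/n\<close>. Let \<open>V = \<Sum>\<^sub>l (p\<^sub>l \<eta>\<^sub>l)\<^sup>2\<close>, which is of order \<open>n\<^sup>-\<^sup>3\<close>.

  Mean square error. The error \<open>e = \<phi>\<^sub>\<xi> - \<phi>\<close> satisfies \<open>e = A\<^sub>\<xi> e + r\<close>, where \<open>A\<^sub>\<xi>\<close> is the averaged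
  operator and the residual \<open>r\<close> is a sum of independent centred terms of size \<open>p\<^sub>l \<eta>\<^sub>l\<close>; hence
  \<open>E r\<^sup>2\<close> is of order \<open>V\<close>. The contraction property and the boundedness of the kernel carry this bound
  over to \<open>e\<close> at every point (\<open>mean_square_error\<close>).

  Bias. Taking expectations leaves \<open>E e = (E A\<^sub>\<xi>) (E e)\<close> plus the covariance of kernel and density. Replacing the
  single ordinate \<open>X\<^sub>l\<close> by a fixed one changes the density by \<open>p\<^sub>l \<eta>\<^sub>l\<close> only and makes it independent
  of \<open>X\<^sub>l\<close>. The contribution of the cell to the covariance is therefore of order \<open>p\<^sub>l \<eta>\<^sub>l \<cdot> p\<^sub>l \<eta>\<^sub>l\<close>, and
  the bias is of order \<open>V\<close>, twice the exponent of the root mean square error (\<open>bias_bound\<close>).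

  Integrating the pointwise bounds against \<open>\<sigma>\<^sub>T\<close> gives the rates \<open>n\<^sup>-\<^sup>3\<^sup>/\<^sup>2\<close> and \<open>n\<^sup>-\<^sup>3\<close>; for \<open>n > 2\<close> the
  logarithms on the right-hand sides are at least one, and \<open>\<lambda>\<close> is a fixed positive number.
\<close>

section \<open>Absolutely continuous functions are integrals of their derivatives\<close>

lemma AC_on_intervalD:
  assumes "absolutely_continuous_on_interval a b f" "0 < e"
  shows "\<exists>d>0. \<forall>\<D> t. \<D> division_of t \<and> t \<subseteq> {a..b} \<and> (\<Sum>k\<in>\<D>. measure lborel k) < d
      \<longrightarrow> (\<Sum>k\<in>\<D>. \<bar>f (Sup k) - f (Inf k)\<bar>) < e"
  using assms(1)[unfolded absolutely_continuous_on_interval_def, THEN spec, THEN mp, OF assms(2)] .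

lemma AC_continuous_on:
  assumes "absolutely_continuous_on_interval a b f"
  shows "continuous_on {a..b} f"
  unfolding continuous_on_iff
proof (intro ballI allI impI)
  fix x e :: real assume x: "x \<in> {a..b}" and "0 < e"
  obtain d where "d > 0" and d: "\<forall>\<D> t. \<D> division_of t \<and> t \<subseteq> {a..b} \<and>
      (\<Sum>k\<in>\<D>. measure lborel k) < d \<longrightarrow> (\<Sum>k\<in>\<D>. \<bar>f (Sup k) - f (Inf k)\<bar>) < e"
    using AC_on_intervalD[OF assms \<open>0 < e\<close>] by (elim exE conjE) (rule that)
  have less: "\<bar>f v - f u\<bar> < e" if uv: "u \<in> {a..b}" "v \<in> {a..b}" "u \<le> v" "v - u < d" for u v
  proof -
    have "{{u..v}} division_of {u..v}"
      using division_of_self[of u v] uv by simp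
    moreover have "{u..v} \<subseteq> {a..b}" "(\<Sum>k\<in>{{u..v}}. measure lborel k) < d" using uv by auto
    ultimately have "(\<Sum>k\<in>{{u..v}}. \<bar>f (Sup k) - f (Inf k)\<bar>) < e"
      by (intro d[rule_format, OF conjI[OF _ conjI]])
    then show ?thesis using uv by simp
  qed
  show "\<exists>d>0. \<forall>x'\<in>{a..b}. dist x' x < d \<longrightarrow> dist (f x') (f x) < e"
  proof (intro exI[of _ d] conjI ballI impI)
    fix y assume "y \<in> {a..b}" "dist y x < d"
    then show "dist (f y) (f x) < e"
      using less[of x y] less[of y x] x by (cases "x \<le> y") (auto simp: dist_real_def abs_minus_commute)
  qed fact
qed

lemma AC_subinterval:
  assumes "absolutely_continuous_on_interval a b f" "{u..v} \<subseteq> {a..b}"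
  shows "absolutely_continuous_on_interval u v f"
  unfolding absolutely_continuous_on_interval_def
proof (intro allI impI)
  fix e :: real assume "e > 0"
  obtain d where "d > 0" and d: "\<forall>\<D> t. \<D> division_of t \<and> t \<subseteq> {a..b} \<and>
      (\<Sum>k\<in>\<D>. measure lborel k) < d \<longrightarrow> (\<Sum>k\<in>\<D>. \<bar>f (Sup k) - f (Inf k)\<bar>) < e"
    using AC_on_intervalD[OF assms(1) \<open>0 < e\<close>] by (elim exE conjE) (rule that)
  show "\<exists>d>0. \<forall>\<D> t. \<D> division_of t \<and> t \<subseteq> {u..v} \<and> (\<Sum>k\<in>\<D>. measure lborel k) < d
      \<longrightarrow> (\<Sum>k\<in>\<D>. \<bar>f (Sup k) - f (Inf k)\<bar>) < e"
  proof (intro exI[of _ d] conjI allI impI)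
    fix \<D> t assume "\<D> division_of t \<and> t \<subseteq> {u..v} \<and> (\<Sum>k\<in>\<D>. measure lborel k) < d"
    then show "(\<Sum>k\<in>\<D>. \<bar>f (Sup k) - f (Inf k)\<bar>) < e"
      by (elim conjE, intro d[rule_format, OF conjI[OF _ conjI]] order.trans[OF _ assms(2)])
  qed fact
qed

text \<open>
  The fundamental theorem with an exceptional null set \<open>N\<close>. In the gauge integral the tags can be
  told apart: at a tag outside \<open>N\<close> differentiability controls the increment of \<open>f\<close>, while all tags in \<open>N\<close>
  are confined to an open set of small measure, where absolute continuity makes the sum of the
  increments small.
\<close>

lemma AC_has_integral_derivative:
  assumes ac: "absolutely_continuous_on_interval a b f" and ab: "a \<le> b"
    and N: "negligible N"
    and der: "\<And>x. x \<in> {a..b} - N \<Longrightarrow> (f has_real_derivative h x) (at x within {a..b})"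
  shows "(h has_integral (f b - f a)) {a..b}"
proof -
  define h' where "h' = (\<lambda>x. if x \<in> N then 0 else h x)"
  have "(h' has_integral (f b - f a)) {a..b}"
    unfolding has_integral_real
  proof (intro allI impI)
    fix e :: real assume e: "e > 0"
    obtain d where "d > 0" and d: "\<forall>\<D> t. \<D> division_of t \<and> t \<subseteq> {a..b} \<and>
      (\<Sum>k\<in>\<D>. measure lborel k) < d \<longrightarrow> (\<Sum>k\<in>\<D>. \<bar>f (Sup k) - f (Inf k)\<bar>) < e/2"
      using AC_on_intervalD[OF ac half_gt_zero[OF e]] by (elim exE conjE) (rule that)
    obtain U where "open U" "N \<subseteq> U" "U - N \<in> lmeasurable" "emeasure lebesgue (U - N) < ennreal d"
      by (rule sets_lebesgue_outer_open[OF negligible_imp_sets[OF N] \<open>d > 0\<close>])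
    moreover have "U = (U - N) \<union> N" using \<open>N \<subseteq> U\<close> by auto
    ultimately have Um: "U \<in> lmeasurable" and Ud: "measure lebesgue U < d"
    proof -
      have Neg: "N \<in> null_sets lebesgue" using N negligible_iff_null_sets by blast
      have *: "emeasure lebesgue U = emeasure lebesgue (U - N)"
        using emeasure_Diff_null_set[OF Neg, of U] \<open>open U\<close> by simp
      then show "U \<in> lmeasurable"
        using \<open>U - N \<in> lmeasurable\<close> \<open>open U\<close> unfolding fmeasurable_def by auto
      then show "measure lebesgue U < d"
        using * \<open>emeasure lebesgue (U - N) < ennreal d\<close> \<open>d > 0\<close>
        by (metis emeasure_eq_measure2 ennreal_less_iff measure_nonneg)
    qed
    define e' where "e' = e / (2 * (b - a) + 2)"
    have e': "e' > 0" "e' * (b - a) < e/2"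
      using e ab unfolding e'_def by (auto simp: field_simps pos_divide_less_eq)
    have "\<forall>x. \<exists>r>0. x \<in> {a..b} - N \<longrightarrow>
         (\<forall>y\<in>{a..b}. norm (y-x) < r \<longrightarrow> norm (f y - f x - h x * (y-x)) \<le> e' * norm (y-x))"
    proof
      fix x
      show "\<exists>r>0. x \<in> {a..b} - N \<longrightarrow>
         (\<forall>y\<in>{a..b}. norm (y-x) < r \<longrightarrow> norm (f y - f x - h x * (y-x)) \<le> e' * norm (y-x))"
      proof (cases "x \<in> {a..b} - N")
        case True
        show ?thesis using der[OF True] e'(1) unfolding has_field_derivative_def has_derivative_within_alt by blast
      qed (auto intro: zero_less_one)
    qed
    then obtain r where r: "\<And>x. 0 < r x"
      "\<And>x y. \<lbrakk>x \<in> {a..b} - N; y \<in> {a..b}; norm (y-x) < r x\<rbrakk>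
          \<Longrightarrow> norm (f y - f x - h x * (y-x)) \<le> e' * norm (y-x)"
      by metis
    \<comment> \<open>tags in the null set are confined to the small open set\<close>
    define \<gamma> where "\<gamma> = (\<lambda>x. if x \<in> N then U else ball x (r x))"
    show "\<exists>\<gamma>. gauge \<gamma> \<and> (\<forall>\<D>. \<D> tagged_division_of {a..b} \<and> \<gamma> fine \<D> \<longrightarrow>
        norm ((\<Sum>(x, k)\<in>\<D>. measure lborel k *\<^sub>R h' x) - (f b - f a)) < e)"
    proof (intro exI[of _ \<gamma>] conjI allI impI)
      show "gauge \<gamma>"
        using \<open>open U\<close> \<open>N \<subseteq> U\<close> r(1) by (auto simp: gauge_def \<gamma>_def)
      fix p assume "p tagged_division_of {a..b} \<and> \<gamma> fine p"
      then have p: "p tagged_division_of {a..b}" and fine: "\<gamma> fine p" by auto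
      note pD = tagged_division_ofD[OF p]
      have tele: "f b - f a = (\<Sum>(x,K)\<in>p. f(Sup K) - f(Inf K))" "b - a = (\<Sum>(x,K)\<in>p. Sup K - Inf K)"
        using additive_tagged_division_1[OF ab p, of f] additive_tagged_division_1[OF ab p, of "\<lambda>x. x"] by auto
      define pN where "pN = {xk\<in>p. fst xk \<in> N}"
      define G where "G = (\<lambda>(x,k). measure lborel k *\<^sub>R h' x - (f(Sup k) - f(Inf k)))"
      have fin: "finite p" by fact
      have "(\<Sum>(x, k)\<in>p. measure lborel k *\<^sub>R h' x) - (f b - f a) = (\<Sum>xk\<in>p. G xk)"
        unfolding tele G_def by (simp add: sum_subtractf split_beta)
      also have "\<dots> = (\<Sum>xk\<in>pN. G xk) + (\<Sum>xk\<in>p - pN. G xk)"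
        using sum.subset_diff[of pN p G] fin unfolding pN_def by auto
      finally have split: "(\<Sum>(x, k)\<in>p. measure lborel k *\<^sub>R h' x) - (f b - f a) = (\<Sum>xk\<in>pN. G xk) + (\<Sum>xk\<in>p - pN. G xk)" .
      have pN_part: "pN tagged_partial_division_of {a..b}"
        using p tagged_partial_division_subset[of p "{a..b}" pN] unfolding tagged_division_of_def pN_def by auto
      have pN_div: "pN tagged_division_of (\<Union>(snd ` pN))"
        using pN_part unfolding tagged_division_of_def tagged_partial_division_of_def
        by (auto simp: image_iff) 
      have div: "(snd ` pN) division_of \<Union>(snd ` pN)"
        by (rule partial_division_of_tagged_division[OF pN_part])
      have sub: "\<Union>(snd ` pN) \<subseteq> {a..b}" using pD(3) unfolding pN_def by fastforce
      have subU: "\<Union>(snd ` pN) \<subseteq> U" using fine unfolding fine_def pN_def \<gamma>_def by fastforce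
      \<comment> \<open>the intervals with tags in the null set have total length below the modulus\<close>
      have "(\<Sum>k\<in>snd ` pN. measure lborel k) = (\<Sum>k\<in>snd ` pN. measure lebesgue k)"
        using division_ofD(4)[OF div] by (intro sum.cong refl) fastforce
      also have "\<dots> = measure lebesgue (\<Union>(snd ` pN))"
        by (rule content_division[OF div])
      also have "\<dots> \<le> measure lebesgue U"
        using lmeasurable_division[OF div] by (intro measure_mono_fmeasurable subU Um) auto
      finally have small: "(\<Sum>k\<in>snd ` pN. measure lborel k) < d" using Ud by simp
      have "norm (\<Sum>xk\<in>pN. G xk) \<le> (\<Sum>(x,k)\<in>pN. \<bar>f (Sup k) - f (Inf k)\<bar>)"
        unfolding G_def h'_def pN_def by (rule sum_norm_le) auto
      \<comment> \<open>the supremum of the empty set is unspecified, hence the case distinction\<close>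
      also have "\<dots> = (\<Sum>(x,k)\<in>pN. if k = {} then 0 else \<bar>f (Sup k) - f (Inf k)\<bar>)"
        using pD(2) unfolding pN_def by (intro sum.cong) fastforce+
      also have "\<dots> = (\<Sum>k\<in>snd ` pN. if k = {} then 0 else \<bar>f (Sup k) - f (Inf k)\<bar>)"
      proof (rule sum.over_tagged_division_lemma[OF pN_div])
        fix u v :: real assume "box u v = {}"
        then have "v \<le> u" by (auto simp: box_real)
        then show "(if cbox u v = {} then 0 else \<bar>f (Sup (cbox u v)) - f (Inf (cbox u v))\<bar>) = 0"
          by (cases "v = u") auto
      qed
      also have "\<dots> = (\<Sum>k\<in>snd ` pN. \<bar>f (Sup k) - f (Inf k)\<bar>)"
        using pD(2) unfolding pN_def by (intro sum.cong) fastforce+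
      also have "\<dots> < e/2" by (rule d[rule_format, OF conjI[OF div conjI[OF sub small]]])
      finally have 1: "norm (\<Sum>xk\<in>pN. G xk) < e/2" .
      have "norm (\<Sum>xk\<in>p - pN. G xk) \<le> (\<Sum>(x,k)\<in>p - pN. e' * (Sup k - Inf k))"
      proof (rule sum_norm_le, safe)
        fix x K assume xK: "(x, K) \<in> p" "(x, K) \<notin> pN"
        then have xN: "x \<notin> N" by (auto simp: pN_def)
        have xk: "x \<in> K" "K \<subseteq> {a..b}" using pD xK by auto
        obtain u v where K: "K = cbox u v" using pD(4) xK by blast
        have uv: "u \<le> x" "x \<le> v" using xk K by auto
        have ball: "K \<subseteq> ball x (r x)" using fine xK xN unfolding fine_def \<gamma>_def by fastforce
        have uvK: "u \<in> K" "v \<in> K" using uv K by auto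
        have "norm (f u - f x - h x * (u-x)) \<le> e' * norm (u-x)" "norm (f v - f x - h x * (v-x)) \<le> e' * norm (v-x)"
          using xk xN uvK ball r(2)[of x u] r(2)[of x v] by (auto simp: dist_real_def abs_minus_commute subset_iff)
        then have "\<bar>f u - f x - h x * (u-x)\<bar> \<le> e' * (x - u)" "\<bar>f v - f x - h x * (v-x)\<bar> \<le> e' * (v-x)"
          using uv by auto
        then have "\<bar>(v - u) * h x - (f v - f u)\<bar> \<le> e' * (v - u)"
          by (auto simp: abs_le_iff algebra_simps)
        then show "norm (G (x, K)) \<le> e' * (Sup K - Inf K)"
          using uv xN unfolding G_def h'_def K by (simp add: content_real)
      qed
      also have "\<dots> \<le> (\<Sum>(x,k)\<in>p. e' * (Sup k - Inf k))"
      proof (rule sum_mono2[OF fin])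
        fix xk assume "xk \<in> p - (p - pN)"
        then obtain x u v where "xk = (x, cbox u v)" "x \<in> cbox u v" using pD(2,4) by (cases xk) blast
        then show "0 \<le> (case xk of (x,k) \<Rightarrow> e' * (Sup k - Inf k))" using e' by (auto)
      qed auto
      also have "\<dots> = e' * (b - a)"
        unfolding tele(2) sum_distrib_left by (simp add: split_beta)
      finally have 2: "norm (\<Sum>xk\<in>p - pN. G xk) < e/2" using e' by linarith
      show "norm ((\<Sum>(x, k)\<in>p. measure lborel k *\<^sub>R h' x) - (f b - f a)) < e"
        unfolding split using 1 2 norm_triangle_ineq[of "\<Sum>xk\<in>pN. G xk" "\<Sum>xk\<in>p - pN. G xk"] by linarith
    qed
  qed
  then show ?thesis
    by (rule has_integral_spike[OF N, rotated]) (auto simp: h'_def)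
qed

text \<open>
  On an interval shorter than the modulus of absolute continuity the increments of \<open>f\<close> over any division
  add up to less than one, which is bounded variation of the integral; finitely many such
  intervals cover \<open>{a..b}\<close>.
\<close>

lemma AC_derivative_absolutely_integrable:
  assumes ac: "absolutely_continuous_on_interval a b f" and ab: "a \<le> b"
    and hI: "\<And>u v. a \<le> u \<Longrightarrow> u \<le> v \<Longrightarrow> v \<le> b \<Longrightarrow> (h has_integral (f v - f u)) {u..v}"
  shows "h absolutely_integrable_on {a..b}"
proof -
  obtain d where "d > 0" and d: "\<forall>\<D> t. \<D> division_of t \<and> t \<subseteq> {a..b} \<and>
      (\<Sum>k\<in>\<D>. measure lborel k) < d \<longrightarrow> (\<Sum>k\<in>\<D>. \<bar>f (Sup k) - f (Inf k)\<bar>) < 1"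
    using AC_on_intervalD[OF ac zero_less_one] by (elim exE conjE) (rule that)
  have short: "h absolutely_integrable_on {u..v}" if uv: "a \<le> u" "u \<le> v" "v \<le> b" "v - u < d" for u v
  proof -
    have "h absolutely_integrable_on cbox u v"
    proof (rule bounded_variation_absolutely_integrable_interval)
      show "h integrable_on cbox u v" using hI[OF uv(1-3)] by (auto simp: integrable_on_def)
      fix D assume D: "D division_of cbox u v"
      have "(\<Sum>k\<in>D. measure lborel k) = (\<Sum>k\<in>D. measure lebesgue k)"
        using division_ofD(4)[OF D] by (intro sum.cong refl) fastforce
      also have "\<dots> < d" using content_division[OF D] uv by simp
      finally have small: "(\<Sum>k\<in>D. measure lborel k) < d" .
      have "cbox u v \<subseteq> {a..b}" using uv by auto
      then have "(\<Sum>k\<in>D. \<bar>f (Sup k) - f (Inf k)\<bar>) < 1"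
        by (rule d[rule_format, OF conjI[OF D conjI[OF _ small]]])
      moreover have "norm (integral k h) = \<bar>f (Sup k) - f (Inf k)\<bar>" if kD: "k \<in> D" for k
      proof -
        obtain x y where k: "k = cbox x y" "k \<noteq> {}" "k \<subseteq> cbox u v"
          using division_ofD(2,3,4)[OF D kD] by blast
        then have "x \<le> y" "u \<le> x" "y \<le> v" by auto
        then show ?thesis using hI[of x y] uv k by (auto dest: integral_unique)
      qed
      ultimately show "(\<Sum>k\<in>D. norm (integral k h)) \<le> 1" by (auto intro!: less_imp_le)
    qed
    then show ?thesis by simp
  qed
  have step: "h absolutely_integrable_on {a..min b (a + real n * (d/2))}" for n
  proof (induction n)
    case 0
    have "h absolutely_integrable_on {a..a}" using short[of a a] ab \<open>d > 0\<close> by simp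
    then show ?case using ab by (simp add: min_def)
  next
    case (Suc n)
    let ?u = "min b (a + real n * (d/2))" and ?v = "min b (a + real (Suc n) * (d/2))"
    have *: "a \<le> ?u" "?u \<le> ?v" "?v \<le> b" "?v - ?u < d" using ab \<open>d > 0\<close> by (auto simp: field_simps min_def)
    have "{a..?v} = {a..?u} \<union> {?u..?v}" by (rule ivl_disj_un_two_touch(4)[symmetric, OF *(1,2)])
    then show ?case using absolutely_integrable_Un[OF Suc short[OF *]] by simp
  qed
  obtain n where "b - a < real n * (d/2)" using \<open>d > 0\<close> ex_less_of_nat_mult[of "d/2" "b - a"] by auto
  then show ?thesis using step[of n] by (simp add: min_def split: if_splits)
qed

section \<open>Integration by parts for indefinite Lebesgue integrals\<close>

lemma integrable_lebesgue_on_Icc_iff: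
  fixes f :: "real \<Rightarrow> real"
  shows "integrable (lebesgue_on {a..b}) f \<longleftrightarrow> f absolutely_integrable_on {a..b}"
  unfolding set_integrable_def by (subst integrable_restrict_space) auto

lemma absolutely_integrable_mult_continuous:
  fixes f g :: "real \<Rightarrow> real"
  assumes "f absolutely_integrable_on {a..b}" "continuous_on {a..b} g"
  shows "(\<lambda>x. g x * f x) absolutely_integrable_on {a..b}"
  using assms
  by (intro absolutely_integrable_bounded_measurable_product_real)
     (auto intro!: continuous_imp_measurable_on_sets_lebesgue compact_imp_bounded compact_continuous_image)

text \<open>
  Fubini on the square \<open>{a..b} \<times> {a..b}\<close>, cut along its diagonal. The factors \<open>u\<close> and \<open>v\<close> are
  arbitrary integrable functions, like the coefficients of the transport equation.
\<close>

lemma integral_by_parts_from_left: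
  fixes u v :: "real \<Rightarrow> real"
  assumes u: "u absolutely_integrable_on {a..b}" and v: "v absolutely_integrable_on {a..b}"
  shows "integral {a..b} u * integral {a..b} v =
         integral {a..b} (\<lambda>x. u x * integral {a..x} v + integral {a..x} u * v x)"
proof -
  let ?N = "lebesgue_on {a..b}"
  interpret N: finite_measure ?N by (intro finite_measure_lebesgue_on) simp
  interpret P: pair_sigma_finite ?N ?N ..
  have uN: "integrable ?N u" and vN: "integrable ?N v"
    using u v by (simp_all add: integrable_lebesgue_on_Icc_iff)
  have [measurable]: "u \<in> borel_measurable ?N" "v \<in> borel_measurable ?N" using uN vN by auto
  have [measurable]: "(\<lambda>x. x) \<in> borel_measurable ?N"
    by (intro continuous_imp_measurable_on_sets_lebesgue) auto
  have up_to: "(LINT y|?N. (if y \<le> x then w y else 0)) = integral {a..x} w"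
    and up_to_int: "integrable ?N (\<lambda>y. if y \<le> x then w y else 0)"
    if w: "integrable ?N w" and x: "x \<in> {a..b}" for w :: "real \<Rightarrow> real" and x
  proof -
    have [measurable]: "w \<in> borel_measurable ?N" using w by auto
    show *: "integrable ?N (\<lambda>y. if y \<le> x then w y else 0)"
      by (rule Bochner_Integration.integrable_bound[OF w]) auto
    have "(LINT y|?N. (if y \<le> x then w y else 0)) = integral {a..b} (\<lambda>y. if y \<le> x then w y else 0)"
      by (rule lebesgue_integral_eq_integral[OF *]) simp
    also have "\<dots> = integral {a..b} (\<lambda>y. if y \<in> {a..x} then w y else 0)"
      by (rule Henstock_Kurzweil_Integration.integral_cong) auto
    also have "\<dots> = integral {a..x} w"
      using x integral_restrict_Int[of "{a..b}" "{a..x}" w] by (simp add: min_absorb1)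
    finally show "(LINT y|?N. (if y \<le> x then w y else 0)) = integral {a..x} w" .
  qed
  have diag: "AE x in ?N. x \<noteq> y" for y
  proof -
    have "AE x in lebesgue. x \<noteq> y" using AE_lborel_singleton[of y] by (rule AE_completion)
    then show ?thesis by (subst AE_restrict_space_iff) auto
  qed
  \<comment> \<open>the part of the square above the diagonal\<close>
  define H where "H = (\<lambda>x y. if x < y then u x * v y else 0)"
  have Hm[measurable]: "(\<lambda>(x,y). H x y) \<in> borel_measurable (?N \<Otimes>\<^sub>M ?N)"
    unfolding H_def by measurable
  have H2: "integrable ?N (H x)" for x
    unfolding H_def by (rule Bochner_Integration.integrable_bound[OF integrable_mult_right[OF vN, of "u x"]]) auto
  have HI: "integrable (?N \<Otimes>\<^sub>M ?N) (\<lambda>(x,y). H x y)"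
  proof (rule P.Fubini_integrable)
    show "AE x in ?N. integrable ?N (\<lambda>y. case (x, y) of (x,y) \<Rightarrow> H x y)" using H2 by auto
    have m: "(\<lambda>x. LINT y|?N. norm (case (x, y) of (x,y) \<Rightarrow> H x y)) \<in> borel_measurable ?N"
      by measurable
    show "integrable ?N (\<lambda>x. LINT y|?N. norm (case (x, y) of (x,y) \<Rightarrow> H x y))"
    proof (rule Bochner_Integration.integrable_bound[OF integrable_mult_left[OF integrable_norm[OF uN], of "LINT y|?N. norm (v y)"] m], intro AE_I2)
      fix x
      have "(LINT y|?N. norm (H x y)) \<le> (LINT y|?N. norm (u x) * norm (v y))"
        using H2 vN by (intro integral_mono integrable_norm integrable_mult_right) (auto simp: H_def abs_mult)
      then show "norm (LINT y|?N. norm (case (x, y) of (x,y) \<Rightarrow> H x y)) \<le> norm (norm (u x) * (LINT y|?N. norm (v y)))"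
        by simp
    qed
  qed simp
  have inner_x: "(LINT y|?N. H x y) = u x * (integral {a..b} v - integral {a..x} v)" if x: "x \<in> {a..b}" for x
  proof -
    have "(LINT y|?N. H x y) = (LINT y|?N. u x * (v y - (if y \<le> x then v y else 0)))"
      by (intro Bochner_Integration.integral_cong) (auto simp: H_def)
    also have "\<dots> = u x * (integral {a..b} v - integral {a..x} v)"
      using up_to[OF vN x] up_to_int[OF vN x] vN lebesgue_integral_eq_integral[OF vN] by simp
    finally show ?thesis .
  qed
  have inner_y: "(LINT x|?N. H x y) = integral {a..y} u * v y" if y: "y \<in> {a..b}" for y
  proof -
    have "(LINT x|?N. H x y) = (LINT x|?N. (if x \<le> y then u x else 0) * v y)"
    proof (rule integral_cong_AE)
      show "AE x in ?N. H x y = (if x \<le> y then u x else 0) * v y"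
        using diag[of y] by (rule eventually_mono) (auto simp: H_def)
    qed (simp_all add: H_def)
    then show ?thesis using up_to[OF uN y] by simp
  qed
  have swap: "(LINT x|?N. (LINT y|?N. H x y)) = (LINT y|?N. (LINT x|?N. H x y))"
    using P.Fubini_integral[OF HI] by simp
  have I1: "integrable ?N (\<lambda>x. u x * (integral {a..b} v - integral {a..x} v))"
  proof (rule iffD1[OF Bochner_Integration.integrable_cong[OF refl]])
    show "integrable ?N (\<lambda>x. LINT y|?N. H x y)" using P.integrable_fst'[OF HI] by simp
  qed (simp add: inner_x)
  have I2: "integrable ?N (\<lambda>y. integral {a..y} u * v y)"
  proof (rule iffD1[OF Bochner_Integration.integrable_cong[OF refl]])
    show "integrable ?N (\<lambda>y. LINT x|?N. H x y)" using P.integrable_snd[OF HI] by simp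
  qed (simp add: inner_y)
  have "integrable ?N (\<lambda>x. integral {a..b} v * u x - u x * (integral {a..b} v - integral {a..x} v))"
    by (intro Bochner_Integration.integrable_diff I1 integrable_mult_right uN)
  then have I3: "integrable ?N (\<lambda>x. u x * integral {a..x} v)"
    by (simp add: algebra_simps)
  have "integral {a..b} u * integral {a..b} v - (LINT x|?N. u x * integral {a..x} v)
      = (LINT x|?N. integral {a..b} v * u x - u x * integral {a..x} v)"
    using uN I3 lebesgue_integral_eq_integral[OF uN] by (subst Bochner_Integration.integral_diff) auto
  also have "\<dots> = (LINT x|?N. u x * (integral {a..b} v - integral {a..x} v))"
    by (simp add: algebra_simps)
  also have "\<dots> = (LINT y|?N. integral {a..y} u * v y)"
  proof -
    have "(LINT x|?N. u x * (integral {a..b} v - integral {a..x} v)) = (LINT x|?N. (LINT y|?N. H x y))"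
      by (rule Bochner_Integration.integral_cong) (simp_all add: inner_x)
    also have "\<dots> = (LINT y|?N. integral {a..y} u * v y)"
      unfolding swap by (rule Bochner_Integration.integral_cong) (simp_all add: inner_y)
    finally show ?thesis .
  qed
  finally have "integral {a..b} u * integral {a..b} v = (LINT x|?N. u x * integral {a..x} v + integral {a..x} u * v x)"
    using I2 I3 by simp
  then show ?thesis
    using lebesgue_integral_eq_integral[OF Bochner_Integration.integrable_add[OF I3 I2]] by simp
qed

lemma indefinite_integral_product_rule:
  fixes f g F G :: "real \<Rightarrow> real"
  assumes ab: "a \<le> b"
    and f: "f absolutely_integrable_on {a..b}" and g: "g absolutely_integrable_on {a..b}"
    and F: "\<And>x. x \<in> {a..b} \<Longrightarrow> F x - F a = integral {a..x} f"
    and G: "\<And>x. x \<in> {a..b} \<Longrightarrow> G x - G a = integral {a..x} g"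
  shows "F b * G b - F a * G a = integral {a..b} (\<lambda>x. G x * f x + F x * g x)"
proof -
  have fi: "f integrable_on {a..b}" and gi: "g integrable_on {a..b}"
    using f g by (auto simp: absolutely_integrable_on_def)
  have cF: "continuous_on {a..b} (\<lambda>x. integral {a..x} f)" and cG: "continuous_on {a..b} (\<lambda>x. integral {a..x} g)"
    by (intro indefinite_integral_continuous_1 fi gi)+
  have i: "(\<lambda>x. integral {a..x} g * f x) integrable_on {a..b}" "(\<lambda>x. integral {a..x} f * g x) integrable_on {a..b}"
    using absolutely_integrable_mult_continuous[OF f cG] absolutely_integrable_mult_continuous[OF g cF]
    by (auto simp: absolutely_integrable_on_def)
  have "integral {a..b} (\<lambda>x. G x * f x + F x * g x) =
     integral {a..b} (\<lambda>x. (integral {a..x} g * f x + integral {a..x} f * g x) + (G a * f x + F a * g x))"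
  proof (rule Henstock_Kurzweil_Integration.integral_cong)
    fix x assume x: "x \<in> {a..b}"
    have *: "F x = F a + integral {a..x} f" "G x = G a + integral {a..x} g" using F[OF x] G[OF x] by linarith+
    show "G x * f x + F x * g x = (integral {a..x} g * f x + integral {a..x} f * g x) + (G a * f x + F a * g x)"
      unfolding * by (simp add: distrib_left distrib_right)
  qed
  also have "\<dots> = integral {a..b} (\<lambda>x. integral {a..x} g * f x + integral {a..x} f * g x)
       + (G a * integral {a..b} f + F a * integral {a..b} g)"
    using i fi gi by (simp add: Henstock_Kurzweil_Integration.integral_add integrable_add integrable_on_mult_right)
  also have "integral {a..b} (\<lambda>x. integral {a..x} g * f x + integral {a..x} f * g x) = integral {a..b} f * integral {a..b} g"
    using integral_by_parts_from_left[OF f g] by (simp add: mult.commute)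
  also have "integral {a..b} f = F b - F a" using F[of b] ab by simp
  also have "integral {a..b} g = G b - G a" using G[of b] ab by simp
  finally show ?thesis by (simp add: algebra_simps)
qed

lemma constant_if_quadratic_increments:
  fixes D :: "real \<Rightarrow> real"
  assumes "\<And>u v. a \<le> u \<Longrightarrow> u \<le> v \<Longrightarrow> v \<le> b \<Longrightarrow> \<bar>D v - D u\<bar> \<le> K * (v - u)^2"
    and x: "x \<in> {a..b}" and y: "y \<in> {a..b}"
  shows "D x = D y"
proof -
  have K: "\<bar>D v - D u\<bar> \<le> \<bar>K\<bar> * (v - u)^2" if "u \<in> {a..b}" "v \<in> {a..b}" for u v
  proof -
    have *: "K * (v-u)^2 \<le> \<bar>K\<bar> * (v - u)^2" by (intro mult_right_mono) simp_all
    have "\<bar>D v - D u\<bar> \<le> K * (v - u)^2"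
    proof (cases "u \<le> v")
      case False
      then show ?thesis
        using assms(1)[of v u] that unfolding abs_minus_commute[of "D u"] power2_commute[of u] by auto
    qed (use assms(1)[of u v] that in auto)
    then show ?thesis using * by linarith
  qed
  have "(D has_derivative (\<lambda>h. 0)) (at u within {a..b})" if u: "u \<in> {a..b}" for u
    unfolding has_derivative_within_alt
  proof (intro conjI allI impI)
    fix e :: real assume e: "e > 0"
    show "\<exists>d>0. \<forall>v\<in>{a..b}. norm (v - u) < d \<longrightarrow> norm (D v - D u - 0) \<le> e * norm (v - u)"
    proof (intro exI[of _ "e / (\<bar>K\<bar> + 1)"] conjI ballI impI)
      fix v assume v: "v \<in> {a..b}" "norm (v - u) < e / (\<bar>K\<bar> + 1)"
      have "\<bar>K\<bar> * \<bar>v - u\<bar> \<le> (\<bar>K\<bar> + 1) * \<bar>v - u\<bar>" by (simp add: algebra_simps)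
      also have "\<dots> \<le> e" using v(2) by (simp add: field_simps pos_less_divide_eq)
      finally have "\<bar>K\<bar> * \<bar>v - u\<bar> * \<bar>v - u\<bar> \<le> e * \<bar>v - u\<bar>" by (rule mult_right_mono) simp
      then show "norm (D v - D u - 0) \<le> e * norm (v - u)"
        using K[OF u v(1)] by (simp add: power2_eq_square mult.assoc abs_mult[symmetric])
    qed (use e in simp)
  qed simp
  then show ?thesis
    using has_derivative_zero_constant[of "{a..b}" D] x y by (metis convex_real_interval(5))
qed

text \<open>
  The chain rule for \<open>exp (c * \<tau>)\<close> when \<open>\<tau>\<close> is the indefinite integral of a bounded function that need not
  be continuous. Instead of differentiating \<open>\<tau>\<close>, it shows that the two sides have increments over
  \<open>{u..v}\<close> that differ by \<open>O((v - u)\<^sup>2)\<close>, which forces their difference to be constant.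
\<close>

lemma exp_indefinite_integral:
  fixes \<sigma> :: "real \<Rightarrow> real" and a c :: real
  defines "E \<equiv> \<lambda>x. exp (c * integral {a..x} \<sigma>)"
  assumes \<sigma>: "\<sigma> absolutely_integrable_on {a..b}" and bd: "\<And>x. x \<in> {a..b} \<Longrightarrow> 0 \<le> \<sigma> x \<and> \<sigma> x \<le> B"
    and x: "x \<in> {a..b}"
  shows "E x - E a = integral {a..x} (\<lambda>y. c * \<sigma> y * E y)"
proof -
  have ab: "a \<le> b" using x by simp
  have B: "0 \<le> B" using bd[of a] ab by auto
  have \<sigma>i: "\<sigma> integrable_on {a..b}" using \<sigma> by (auto simp: absolutely_integrable_on_def)
  have \<tau>: "integral {a..v} \<sigma> - integral {a..u} \<sigma> = integral {u..v} \<sigma>"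
    if "a \<le> u" "u \<le> v" "v \<le> b" for u v
    using Henstock_Kurzweil_Integration.integral_combine[of a u v \<sigma>] that integrable_on_subinterval[OF \<sigma>i] by auto
  have P: "0 \<le> integral {u..v} \<sigma>" "integral {u..v} \<sigma> \<le> B * (v - u)" if uv: "a \<le> u" "u \<le> v" "v \<le> b" for u v
  proof -
    have i: "\<sigma> integrable_on {u..v}" using integrable_on_subinterval[OF \<sigma>i] uv by auto
    show "0 \<le> integral {u..v} \<sigma>" using i bd uv by (intro integral_nonneg) auto
    have "integral {u..v} \<sigma> \<le> integral {u..v} (\<lambda>_. B)" using i bd uv by (intro integral_le) auto
    then show "integral {u..v} \<sigma> \<le> B * (v - u)" using uv by (simp add: mult.commute)
  qed
  define M where "M = exp (\<bar>c\<bar> * (B * (b - a)))"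
  have E: "0 < E x" "E x \<le> M" if "x \<in> {a..b}" for x
  proof -
    have "c * integral {a..x} \<sigma> \<le> \<bar>c\<bar> * integral {a..x} \<sigma>" using P[of a x] that by (intro mult_right_mono) auto
    also have "\<dots> \<le> \<bar>c\<bar> * (B * (b - a))"
    proof (intro mult_left_mono)
      have "integral {a..x} \<sigma> \<le> B * (x - a)" using P[of a x] that by auto
      also have "\<dots> \<le> B * (b - a)" using that B by (intro mult_left_mono) auto
      finally show "integral {a..x} \<sigma> \<le> B * (b - a)" .
    qed simp
    finally show "E x \<le> M" by (simp add: E_def M_def)
  qed (simp add: E_def)
  \<comment> \<open>convexity of the exponential function\<close>
  have E_le: "E p - E q \<le> E p * (c * (integral {a..p} \<sigma> - integral {a..q} \<sigma>))" for p q
  proof -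
    have "E p * (1 + (c * integral {a..q} \<sigma> - c * integral {a..p} \<sigma>)) \<le> E p * exp (c * integral {a..q} \<sigma> - c * integral {a..p} \<sigma>)"
      by (intro mult_left_mono exp_ge_add_one_self) (simp add: E_def)
    also have "\<dots> = E q" by (simp add: E_def exp_add[symmetric])
    finally show ?thesis by (simp add: algebra_simps)
  qed
  define L where "L = M * (\<bar>c\<bar> * B)"
  have L: "0 \<le> L" using B by (simp add: L_def M_def)
  have E_lip: "\<bar>E v - E u\<bar> \<le> L * (v - u)" and E_first: "\<bar>E v - E u - E u * (c * integral {u..v} \<sigma>)\<bar> \<le> L * (v - u) * (\<bar>c\<bar> * B * (v - u))"
    if uv: "a \<le> u" "u \<le> v" "v \<le> b" for u v
  proof -
    have cP: "\<bar>c * integral {u..v} \<sigma>\<bar> \<le> \<bar>c\<bar> * B * (v - u)"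
      unfolding abs_mult mult.assoc using P[OF uv] by (intro mult_left_mono) auto
    have 1: "E v - E u \<le> E v * (c * integral {u..v} \<sigma>)" using E_le[of v u] \<tau>[OF uv] by simp
    have 2: "E u * (c * integral {u..v} \<sigma>) \<le> E v - E u" using E_le[of u v] \<tau>[OF uv]
      by (simp add: algebra_simps)
    have "\<bar>E w * (c * integral {u..v} \<sigma>)\<bar> \<le> L * (v - u)" if w: "w = u \<or> w = v" for w
    proof -
      have "\<bar>E w * (c * integral {u..v} \<sigma>)\<bar> \<le> M * (\<bar>c\<bar> * B * (v - u))"
        using E[of w] w uv cP by (subst abs_mult, intro mult_mono) auto
      then show ?thesis by (simp add: L_def mult.assoc)
    qed
    from this[OF disjI1[OF refl]] this[OF disjI2[OF refl]] show lip: "\<bar>E v - E u\<bar> \<le> L * (v - u)" using 1 2 by linarith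
    have "(E v - E u) * (c * integral {u..v} \<sigma>) = E v * (c * integral {u..v} \<sigma>) - E u * (c * integral {u..v} \<sigma>)"
      by (rule left_diff_distrib)
    then have "\<bar>E v - E u - E u * (c * integral {u..v} \<sigma>)\<bar> \<le> \<bar>(E v - E u) * (c * integral {u..v} \<sigma>)\<bar>"
      using 1 2 by linarith
    also have "\<dots> \<le> L * (v - u) * (\<bar>c\<bar> * B * (v - u))"
      unfolding abs_mult[of "E v - E u"] using lip cP L uv by (intro mult_mono) auto
    finally show "\<bar>E v - E u - E u * (c * integral {u..v} \<sigma>)\<bar> \<le> L * (v - u) * (\<bar>c\<bar> * B * (v - u))" .
  qed
  have contE: "continuous_on {a..b} E"
    unfolding E_def by (intro continuous_intros indefinite_integral_continuous_1 \<sigma>i)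
  have "(\<lambda>y. E y * \<sigma> y) absolutely_integrable_on {a..b}"
    by (rule absolutely_integrable_mult_continuous[OF \<sigma> contE])
  then have "(\<lambda>y. c * (E y * \<sigma> y)) absolutely_integrable_on {a..b}"
    by (intro set_integrable_mult_right) 
  then have wi: "(\<lambda>y. c * \<sigma> y * E y) integrable_on {a..b}"
    by (auto simp: absolutely_integrable_on_def mult_ac)
  define D where "D = (\<lambda>x. E x - integral {a..x} (\<lambda>y. c * \<sigma> y * E y))"
  have "\<bar>D v - D u\<bar> \<le> (2 * L * (\<bar>c\<bar> * B)) * (v - u)^2" if uv: "a \<le> u" "u \<le> v" "v \<le> b" for u v
  proof -
    have sub: "f integrable_on {u..v}" if "f integrable_on {a..b}" for f :: "real \<Rightarrow> real"
      using integrable_on_subinterval[OF that] uv by auto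
    have "integral {a..v} (\<lambda>y. c * \<sigma> y * E y) - integral {a..u} (\<lambda>y. c * \<sigma> y * E y) = integral {u..v} (\<lambda>y. c * \<sigma> y * E y)"
      using Henstock_Kurzweil_Integration.integral_combine[of a u v "\<lambda>y. c * \<sigma> y * E y"] uv integrable_on_subinterval[OF wi] by auto
    then have "D v - D u = (E v - E u - E u * (c * integral {u..v} \<sigma>)) - integral {u..v} (\<lambda>y. c * \<sigma> y * E y - E u * c * \<sigma> y)"
      using sub[OF wi] sub[OF \<sigma>i]
      by (simp add: D_def Henstock_Kurzweil_Integration.integral_diff integrable_on_mult_right mult.assoc)
    moreover have "\<bar>integral {u..v} (\<lambda>y. c * \<sigma> y * E y - E u * c * \<sigma> y)\<bar> \<le> L * (v - u) * (\<bar>c\<bar> * B) * (v - u)"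
    proof -
      have "norm (integral {u..v} (\<lambda>y. c * \<sigma> y * E y - E u * c * \<sigma> y)) \<le> integral {u..v} (\<lambda>y. L * (v - u) * (\<bar>c\<bar> * B))"
      proof (rule integral_norm_bound_integral)
        fix y assume y: "y \<in> {u..v}"
        have "\<bar>E y - E u\<bar> \<le> L * (v - u)"
          using E_lip[of u y] mult_left_mono[of "y - u" "v - u" L] y uv L by auto
        moreover have "\<bar>c * \<sigma> y\<bar> \<le> \<bar>c\<bar> * B" using bd[of y] y uv by (auto simp: abs_mult intro!: mult_left_mono)
        moreover have "c * \<sigma> y * E y - E u * c * \<sigma> y = (E y - E u) * (c * \<sigma> y)" by (simp add: algebra_simps)
        ultimately show "norm (c * \<sigma> y * E y - E u * c * \<sigma> y) \<le> L * (v - u) * (\<bar>c\<bar> * B)"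
          using L uv by (simp add: abs_mult[of "E y - E u"] mult_mono)
      next
        show "(\<lambda>y. c * \<sigma> y * E y - E u * c * \<sigma> y) integrable_on {u..v}"
          using sub[OF wi] sub[OF \<sigma>i] by (intro integrable_diff integrable_on_mult_right)
      qed (rule integrable_const_ivl)
      then show ?thesis using uv by (simp add: mult_ac)
    qed
    moreover have "2 * L * (\<bar>c\<bar> * B) * (v - u)^2
        = L * (v - u) * (\<bar>c\<bar> * B * (v - u)) + L * (v - u) * (\<bar>c\<bar> * B) * (v - u)"
      by (simp add: power2_eq_square algebra_simps)
    ultimately show ?thesis using E_first[OF uv] by linarith
  qed
  from constant_if_quadratic_increments[OF this x, of a] have "D x = D a" using ab by simp
  then show ?thesis by (simp add: D_def)
qed

section \<open>Transport along one pair of opposite directions\<close>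

definition optical_depth :: "real \<Rightarrow> (real \<Rightarrow> real) \<Rightarrow> real \<Rightarrow> real" where
  "optical_depth a \<sigma> x = integral {a..x} \<sigma>"

lemma bounded_measurable_absolutely_integrable:
  fixes f :: "real \<Rightarrow> real"
  assumes "f \<in> borel_measurable (lebesgue_on {a..b})" "\<And>x. x \<in> {a..b} \<Longrightarrow> \<bar>f x\<bar> \<le> B"
  shows "f absolutely_integrable_on {a..b}"
proof -
  interpret finite_measure "lebesgue_on {a..b}" by (intro finite_measure_lebesgue_on) simp
  show ?thesis
    unfolding integrable_lebesgue_on_Icc_iff[symmetric]
    by (rule integrable_const_bound[of _ B]) (use assms in \<open>auto intro!: AE_I2\<close>)
qed

text \<open>
  The equation expresses \<open>Q\<close> almost everywhere by \<open>f\<close> and its derivative, so \<open>Q\<close> inherits their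
  integrability. Through its place in the source, the exact density is seen to be measurable in this way.
\<close>

lemma transport_solution_integrating_factor:
  fixes f Q \<sigma> :: "real \<Rightarrow> real" and a b :: real
  defines "\<tau> \<equiv> optical_depth a \<sigma>"
  assumes sol: "transport_solution a b \<sigma> \<psi>L \<psi>R \<mu> Q f" and \<mu>: "\<mu> \<noteq> 0" and ab: "a \<le> b"
    and m: "\<sigma> \<in> borel_measurable (lebesgue_on {a..b})"
    and bd: "\<And>x. x \<in> {a..b} \<Longrightarrow> 0 \<le> \<sigma> x \<and> \<sigma> x \<le> B"
  shows "Q absolutely_integrable_on {a..b}"
    and "x \<in> {a..b} \<Longrightarrow> f x * exp (\<tau> x / \<mu>) - f a = integral {a..x} (\<lambda>y. exp (\<tau> y / \<mu>) * Q y) / \<mu>"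
proof -
  have ac: "absolutely_continuous_on_interval a b f"
    and ode: "AE x in lebesgue_on {a..b}.
        \<exists>f'. (f has_real_derivative f') (at x within {a..b}) \<and> \<mu> * f' + \<sigma> x * f x = Q x"
    using sol by (auto simp: transport_solution_def)
  have \<sigma>i: "\<sigma> absolutely_integrable_on {a..b}"
    using bd by (intro bounded_measurable_absolutely_integrable[OF m, of B]) auto
  define h where "h = (\<lambda>x. (Q x - \<sigma> x * f x) / \<mu>)"
  obtain N where N: "negligible N" and der: "\<And>x. x \<in> {a..b} - N \<Longrightarrow> (f has_real_derivative h x) (at x within {a..b})"
  proof -
    have "AE x in lebesgue_on {a..b}. (f has_real_derivative h x) (at x within {a..b})"
      using ode by (rule eventually_mono) (use \<mu> in \<open>auto simp: h_def field_simps dest!: sym[where t="Q _"]\<close>)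
    then have "AE x in lebesgue. x \<in> {a..b} \<longrightarrow> (f has_real_derivative h x) (at x within {a..b})"
      by (subst (asm) AE_restrict_space_iff) auto
    then show thesis
      using that unfolding eventually_ae_filter negligible_iff_null_sets by auto
  qed
  have hI: "(h has_integral (f v - f u)) {u..v}" if uv: "a \<le> u" "u \<le> v" "v \<le> b" for u v
  proof (rule AC_has_integral_derivative[OF AC_subinterval[OF ac] uv(2) N])
    fix x assume "x \<in> {u..v} - N"
    then show "(f has_real_derivative h x) (at x within {u..v})"
      using der[of x] uv by (intro has_field_derivative_subset[of f _ x "{a..b}" "{u..v}"]) auto
  qed (use uv in auto)
  have hi: "h absolutely_integrable_on {a..b}"
    by (rule AC_derivative_absolutely_integrable[OF ac ab hI])
  have fc: "continuous_on {a..b} f" by (rule AC_continuous_on[OF ac])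
  have "(\<lambda>x. \<mu> * h x + f x * \<sigma> x) absolutely_integrable_on {a..b}"
    by (intro set_integral_add(1) set_integrable_mult_right hi absolutely_integrable_mult_continuous[OF \<sigma>i fc])
  moreover have "(\<lambda>x. \<mu> * h x + f x * \<sigma> x) = Q" using \<mu> by (auto simp: h_def)
  ultimately show "Q absolutely_integrable_on {a..b}" by simp
  define E where "E = (\<lambda>x. exp ((1/\<mu>) * integral {a..x} \<sigma>))"
  have E_eq: "E y = exp (\<tau> y / \<mu>)" for y by (simp add: E_def \<tau>_def optical_depth_def)
  have Ea: "E a = 1" by (simp add: E_def)
  have E: "E x - E a = integral {a..x} (\<lambda>y. (1/\<mu>) * \<sigma> y * E y)" if "x \<in> {a..b}" for x
    unfolding E_def by (rule exp_indefinite_integral[OF \<sigma>i bd that])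
  have Ec: "continuous_on {a..b} E"
    unfolding E_def using \<sigma>i
    by (intro continuous_intros indefinite_integral_continuous_1) (simp add: absolutely_integrable_on_def)
  have "(\<lambda>y. (1/\<mu>) * (E y * \<sigma> y)) absolutely_integrable_on {a..b}"
    by (intro set_integrable_mult_right absolutely_integrable_mult_continuous[OF \<sigma>i Ec])
  then have Ei: "(\<lambda>y. (1/\<mu>) * \<sigma> y * E y) absolutely_integrable_on {a..b}" by (simp add: mult_ac)
  show "f x * exp (\<tau> x / \<mu>) - f a = integral {a..x} (\<lambda>y. exp (\<tau> y / \<mu>) * Q y) / \<mu>" if x: "x \<in> {a..b}"
  proof -
    have sub: "{a..x} \<subseteq> {a..b}" using x by auto
    have "f x * E x - f a * E a = integral {a..x} (\<lambda>y. E y * h y + f y * ((1/\<mu>) * \<sigma> y * E y))"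
    proof (rule indefinite_integral_product_rule)
      show "f y - f a = integral {a..y} h" if "y \<in> {a..x}" for y
        using hI[of a y] that x by (auto dest: integral_unique)
    qed (use x E absolutely_integrable_on_subinterval[OF hi sub] absolutely_integrable_on_subinterval[OF Ei sub] in auto)
    also have "(\<lambda>y. E y * h y + f y * ((1/\<mu>) * \<sigma> y * E y)) = (\<lambda>y. (E y * Q y) / \<mu>)"
      using \<mu> by (auto simp: h_def field_simps)
    finally show ?thesis by (simp add: E_eq Ea[unfolded E_eq])
  qed
qed

lemma optical_depth_props:
  fixes \<sigma> :: "real \<Rightarrow> real" and a b :: real
  defines "\<tau> \<equiv> optical_depth a \<sigma>"
  assumes m: "\<sigma> \<in> borel_measurable (lebesgue_on {a..b})"
    and bd: "\<And>x. x \<in> {a..b} \<Longrightarrow> 0 \<le> \<sigma> x \<and> \<sigma> x \<le> B"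
  shows optical_depth_mono: "a \<le> x \<Longrightarrow> x \<le> y \<Longrightarrow> y \<le> b \<Longrightarrow> \<tau> x \<le> \<tau> y"
    and optical_depth_continuous: "continuous_on {a..b} \<tau>"
proof -
  have "\<sigma> absolutely_integrable_on {a..b}"
    using bd by (intro bounded_measurable_absolutely_integrable[OF m, of B]) auto
  then have i: "\<sigma> integrable_on {a..b}" by (simp add: absolutely_integrable_on_def)
  show "continuous_on {a..b} \<tau>"
    unfolding \<tau>_def optical_depth_def by (rule indefinite_integral_continuous_1[OF i])
  assume xy: "a \<le> x" "x \<le> y" "y \<le> b"
  have "integral {a..x} \<sigma> + integral {x..y} \<sigma> = integral {a..y} \<sigma>"
    using xy integrable_on_subinterval[OF i] by (intro Henstock_Kurzweil_Integration.integral_combine) auto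
  moreover have "0 \<le> integral {x..y} \<sigma>"
    using xy bd integrable_on_subinterval[OF i] by (intro integral_nonneg) auto
  ultimately show "\<tau> x \<le> \<tau> y" by (simp add: \<tau>_def optical_depth_def)
qed

text \<open>
  Each direction contributes the part of the kernel upstream of \<open>x\<close>: the left half \<open>{a..x}\<close> for \<open>s\<close> and the
  right half \<open>{x..b}\<close> for \<open>- s\<close>. Monotonicity of \<open>\<tau>\<close> turns both exponents into \<open>- \<bar>\<tau> x - \<tau> y\<bar> / s\<close>.
\<close>

lemma transport_solution_pair:
  fixes f g Q \<sigma> :: "real \<Rightarrow> real" and a b s :: real
  defines "\<tau> \<equiv> optical_depth a \<sigma>"
  assumes f: "transport_solution a b \<sigma> \<psi>L \<psi>R s Q f" and g: "transport_solution a b \<sigma> \<psi>L \<psi>R (-s) Q g"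
    and s: "s > 0" and ab: "a \<le> b"
    and m: "\<sigma> \<in> borel_measurable (lebesgue_on {a..b})"
    and bd: "\<And>x. x \<in> {a..b} \<Longrightarrow> 0 \<le> \<sigma> x \<and> \<sigma> x \<le> B"
    and x: "x \<in> {a..b}"
  shows "f x + g x = (LINT y|lebesgue_on {a..b}. exp (- \<bar>\<tau> x - \<tau> y\<bar> / s) / s * Q y)
      + \<psi>L s * exp (- \<tau> x / s) + \<psi>R (-s) * exp (- (\<tau> b - \<tau> x) / s)"
proof -
  note mono = optical_depth_mono[OF m bd, folded \<tau>_def] and cont = optical_depth_continuous[OF m bd, folded \<tau>_def]
  have Q: "Q absolutely_integrable_on {a..b}"
    by (rule transport_solution_integrating_factor(1)[OF f _ ab m bd]) (use s in auto)
  have fa: "f a = \<psi>L s" and gb: "g b = \<psi>R (-s)" using f g s by (auto simp: transport_solution_def)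
  note F = transport_solution_integrating_factor(2)[OF f _ ab m bd, folded \<tau>_def]
  note G = transport_solution_integrating_factor(2)[OF g _ ab m bd, folded \<tau>_def]
  have int_le: "(\<lambda>y. k y * Q y) integrable_on {u..v}"
    if "a \<le> u" "v \<le> b" "continuous_on {a..b} k" for u v k
    using absolutely_integrable_on_subinterval[OF absolutely_integrable_mult_continuous[OF Q that(3)], of u v] that
    by (auto simp: absolutely_integrable_on_def)
  let ?K = "\<lambda>y. exp (- \<bar>\<tau> x - \<tau> y\<bar> / s) / s * Q y"
  have Ki: "?K absolutely_integrable_on {a..b}"
    using s by (intro absolutely_integrable_mult_continuous[OF Q]) (intro continuous_intros cont ballI, simp_all)
  have left: "integral {a..x} ?K = exp (- \<tau> x / s) * (integral {a..x} (\<lambda>y. exp (\<tau> y / s) * Q y) / s)"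
  proof -
    have "integral {a..x} ?K = integral {a..x} (\<lambda>y. (exp (- \<tau> x / s) / s) * (exp (\<tau> y / s) * Q y))"
    proof (rule Henstock_Kurzweil_Integration.integral_cong)
      fix y assume y: "y \<in> {a..x}"
      have "exp (- \<bar>\<tau> x - \<tau> y\<bar> / s) = exp (- \<tau> x / s) * exp (\<tau> y / s)"
        using mono[of y x] y x by (simp add: exp_add[symmetric] diff_divide_distrib)
      then show "?K y = (exp (- \<tau> x / s) / s) * (exp (\<tau> y / s) * Q y)" by simp
    qed
    then show ?thesis by simp
  qed
  have right: "integral {x..b} ?K = exp (\<tau> x / s) * (integral {x..b} (\<lambda>y. exp (- \<tau> y / s) * Q y) / s)"
  proof -
    have "integral {x..b} ?K = integral {x..b} (\<lambda>y. (exp (\<tau> x / s) / s) * (exp (- \<tau> y / s) * Q y))"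
    proof (rule Henstock_Kurzweil_Integration.integral_cong)
      fix y assume y: "y \<in> {x..b}"
      have "exp (- \<bar>\<tau> x - \<tau> y\<bar> / s) = exp (\<tau> x / s) * exp (- \<tau> y / s)"
        using mono[of x y] y x by (simp add: exp_add[symmetric] diff_divide_distrib)
      then show "?K y = (exp (\<tau> x / s) / s) * (exp (- \<tau> y / s) * Q y)" by simp
    qed
    then show ?thesis by simp
  qed
  have "f x * exp (\<tau> x / s) = \<psi>L s + integral {a..x} (\<lambda>y. exp (\<tau> y / s) * Q y) / s"
    using F[of x] s x fa by simp
  then have "f x * exp (\<tau> x / s) * exp (- \<tau> x / s) = (\<psi>L s + integral {a..x} (\<lambda>y. exp (\<tau> y / s) * Q y) / s) * exp (- \<tau> x / s)"
    by simp
  then have fx: "f x = \<psi>L s * exp (- \<tau> x / s) + integral {a..x} ?K"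
    unfolding left by (simp add: mult.assoc exp_add[symmetric]) (simp add: algebra_simps)
  let ?I = "\<lambda>A. integral A (\<lambda>y. exp (- \<tau> y / s) * Q y)"
  have "?I {a..x} + ?I {x..b} = ?I {a..b}"
    using x s by (intro Henstock_Kurzweil_Integration.integral_combine int_le) (auto intro!: continuous_intros cont)
  then have "?I {a..x} / s + ?I {x..b} / s = ?I {a..b} / s"
    by (simp only: add_divide_distrib[symmetric])
  moreover have "g x * exp (- \<tau> x / s) - g a = - (?I {a..x} / s)"
    "g b * exp (- \<tau> b / s) - g a = - (?I {a..b} / s)"
    using G[of x] G[of b] s x ab by simp_all
  ultimately have "g x * exp (- \<tau> x / s) = g b * exp (- \<tau> b / s) + ?I {x..b} / s"
    by linarith
  then have "g x * exp (- \<tau> x / s) * exp (\<tau> x / s) = (\<psi>R (-s) * exp (- \<tau> b / s) + integral {x..b} (\<lambda>y. exp (- \<tau> y / s) * Q y) / s) * exp (\<tau> x / s)"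
    using gb by simp
  then have gx: "g x = \<psi>R (-s) * exp (- (\<tau> b - \<tau> x) / s) + integral {x..b} ?K"
    unfolding right by (simp add: mult.assoc exp_add[symmetric] distrib_right diff_divide_distrib)
  have "integral {a..x} ?K + integral {x..b} ?K = integral {a..b} ?K"
    using x Ki by (intro Henstock_Kurzweil_Integration.integral_combine) (auto simp: absolutely_integrable_on_def)
  also have "\<dots> = (LINT y|lebesgue_on {a..b}. ?K y)"
    using Ki by (intro lebesgue_integral_eq_integral[symmetric]) (simp_all add: integrable_lebesgue_on_Icc_iff)
  finally show ?thesis using fx gx by simp
qed

section \<open>Fixed points of families of contractive kernels\<close>

lemma abs_integral_le_AE:
  fixes f g :: "'a \<Rightarrow> real"
  assumes "integrable M f" "integrable M g" "AE x in M. \<bar>f x\<bar> \<le> g x"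
  shows "\<bar>\<integral>x. f x \<partial>M\<bar> \<le> (\<integral>x. g x \<partial>M)"
  by (rule order_trans[OF integral_abs_bound integral_mono_AE]) (use assms in auto)

text \<open>
  A maximum principle: at a point where \<open>\<bar>v\<bar>\<close> nearly attains its supremum \<open>V\<close> the hypothesis reads
  \<open>V \<le> \<rho> V + R\<close>. It gives uniqueness (\<open>R = 0\<close>), stability of the fixed point, and both error estimates.
\<close>

lemma (in finite_measure) subunit_kernel_fixed_point_bound:
  fixes v :: "'a \<Rightarrow> real"
  assumes k: "\<And>x. x \<in> space M \<Longrightarrow> integrable M (k x)"
    and k0: "\<And>x y. x \<in> space M \<Longrightarrow> y \<in> space M \<Longrightarrow> 0 \<le> k x y"
    and k\<rho>: "\<And>x. x \<in> space M \<Longrightarrow> (\<integral>y. k x y \<partial>M) \<le> \<rho>" and \<rho>: "0 \<le> \<rho>" "\<rho> < 1"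
    and v: "v \<in> borel_measurable M" "\<And>x. x \<in> space M \<Longrightarrow> \<bar>v x\<bar> \<le> B"
    and R: "\<And>x. x \<in> space M \<Longrightarrow> \<bar>v x - (\<integral>y. k x y * v y \<partial>M)\<bar> \<le> R"
    and x: "x \<in> space M"
  shows "\<bar>v x\<bar> \<le> R / (1 - \<rho>)"
proof -
  define V where "V = (SUP x\<in>space M. \<bar>v x\<bar>)"
  have bdd: "bdd_above ((\<lambda>x. \<bar>v x\<bar>) ` space M)" using v(2) by (auto intro!: bdd_aboveI[of _ B])
  have vV: "\<bar>v y\<bar> \<le> V" if "y \<in> space M" for y
    unfolding V_def by (rule cSUP_upper[OF that bdd])
  have V0: "0 \<le> V" using vV[OF x] by simp
  have "V \<le> \<rho> * V + R"
    unfolding V_def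
  proof (rule cSUP_least)
    fix z assume z: "z \<in> space M"
    have "\<bar>\<integral>y. k z y * v y \<partial>M\<bar> \<le> (\<integral>y. k z y * V \<partial>M)"
    proof (rule abs_integral_le_AE)
      show "integrable M (\<lambda>y. k z y * v y)"
      proof (rule Bochner_Integration.integrable_bound[OF integrable_mult_left[OF k[OF z], of V]])
        show "AE y in M. norm (k z y * v y) \<le> norm (k z y * V)"
          using vV k0[OF z] V0 by (intro AE_I2) (auto simp: abs_mult intro!: mult_left_mono)
      qed (use k[OF z] v in measurable)
      show "AE y in M. \<bar>k z y * v y\<bar> \<le> k z y * V"
        using vV k0[OF z] by (intro AE_I2) (auto simp: abs_mult intro!: mult_left_mono)
    qed (use k[OF z] in simp)
    also have "\<dots> \<le> \<rho> * V" using k\<rho>[OF z] V0 by (simp add: mult_right_mono)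
    finally show "\<bar>v z\<bar> \<le> \<rho> * (SUP x\<in>space M. \<bar>v x\<bar>) + R" using R[OF z] unfolding V_def by linarith
  qed (use x in auto)
  then have "V * (1 - \<rho>) \<le> R" by (simp add: algebra_simps)
  then have "V \<le> R / (1 - \<rho>)" using \<rho> by (simp add: pos_le_divide_eq)
  then show ?thesis using vV[OF x] by simp
qed

text \<open>
  Cauchy--Schwarz against the constant one, from the nonnegative integral of \<open>(m r - \<integral> r)\<^sup>2\<close>
  where \<open>m\<close> is the total mass.
\<close>

lemma (in finite_measure) square_integral_le:
  fixes r :: "'a \<Rightarrow> real"
  assumes r: "integrable M r" "integrable M (\<lambda>x. (r x)\<^sup>2)"
  shows "(\<integral>x. r x \<partial>M)\<^sup>2 \<le> measure M (space M) * (\<integral>x. (r x)\<^sup>2 \<partial>M)"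
proof (cases "measure M (space M) = 0")
  case True
  then have "emeasure M (space M) = 0" by (simp add: emeasure_eq_measure)
  then have "AE x in M. r x = 0" by (intro AE_I'[of "space M"]) (auto simp: null_sets_def)
  then have "(\<integral>x. r x \<partial>M) = 0" by (rule integral_eq_zero_AE)
  then show ?thesis by simp
next
  case False
  let ?m = "measure M (space M)" and ?a = "\<integral>x. r x \<partial>M" and ?b = "\<integral>x. (r x)\<^sup>2 \<partial>M"
  have m: "?m > 0" using False measure_nonneg[of M "space M"] by linarith
  have "0 \<le> (\<integral>x. (?m * r x - ?a)\<^sup>2 \<partial>M)" by simp
  also have "\<dots> = (\<integral>x. ?m\<^sup>2 * (r x)\<^sup>2 - 2 * ?m * ?a * r x + ?a\<^sup>2 \<partial>M)"
    by (simp add: power2_diff power_mult_distrib algebra_simps)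
  also have "\<dots> = ?m\<^sup>2 * ?b - 2 * ?m * ?a * ?a + ?a\<^sup>2 * ?m"
    using r by simp
  also have "\<dots> = ?m * (?m * ?b - ?a\<^sup>2)" by (simp add: power2_eq_square algebra_simps)
  finally show ?thesis using m by (simp add: zero_le_mult_iff)
qed

text \<open>
  The fixed point of \<open>v \<mapsto> k \<theta> v + s \<theta>\<close> must be measurable in the parameter \<open>\<theta>\<close> and the space variable
  jointly, so that it can be integrated over random parameters. Picard iterates are, and so is their
  limit. The bounds are imposed on individual parameters by \<open>admissible\<close>, because the
  parameter space is later a full product of real lines, most points of which are not
  directions.
\<close>

locale kernel_family = finite_measure N for N :: "'x measure" +
  fixes P :: "'p measure" and k :: "'p \<Rightarrow> 'x \<Rightarrow> 'x \<Rightarrow> real" and s :: "'p \<Rightarrow> 'x \<Rightarrow> real"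
    and \<rho> K G :: real
  assumes k_measurable: "(\<lambda>(\<theta>, x, y). k \<theta> x y) \<in> borel_measurable (P \<Otimes>\<^sub>M N \<Otimes>\<^sub>M N)"
    and s_measurable: "(\<lambda>(\<theta>, x). s \<theta> x) \<in> borel_measurable (P \<Otimes>\<^sub>M N)"
    and \<rho>: "0 \<le> \<rho>" "\<rho> < 1" and G: "0 \<le> G"
begin

definition admissible :: "'p \<Rightarrow> bool" where
  "admissible \<theta> \<longleftrightarrow> \<theta> \<in> space P \<and>
     (\<forall>x\<in>space N. (\<integral>y. k \<theta> x y \<partial>N) \<le> \<rho> \<and> \<bar>s \<theta> x\<bar> \<le> G \<and> (\<forall>y\<in>space N. 0 \<le> k \<theta> x y \<and> k \<theta> x y \<le> K))"

lemma k_measurable_raw[measurable (raw)]: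
  assumes "f \<in> measurable A P" "g \<in> measurable A N" "h \<in> measurable A N"
  shows "(\<lambda>z. k (f z) (g z) (h z)) \<in> borel_measurable A"
  using measurable_compose[OF measurable_Pair[OF assms(1) measurable_Pair[OF assms(2,3)]] k_measurable] by simp

lemma s_measurable_raw[measurable (raw)]:
  assumes "f \<in> measurable A P" "g \<in> measurable A N"
  shows "(\<lambda>z. s (f z) (g z)) \<in> borel_measurable A"
  using measurable_compose[OF measurable_Pair[OF assms] s_measurable] by simp

lemma kernel_integrable:
  assumes "admissible \<theta>" "x \<in> space N"
  shows "integrable N (k \<theta> x)"
proof -
  have [measurable]: "\<theta> \<in> space P" using assms by (simp add: admissible_def)
  note [measurable] = assms(2)
  show ?thesis
    by (rule integrable_const_bound[of _ K]) (use assms in \<open>auto simp: admissible_def intro!: AE_I2\<close>)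
qed

lemma kernel_mult_integrable:
  assumes \<theta>: "admissible \<theta>" "x \<in> space N" and v: "v \<in> borel_measurable N" "\<And>x. x \<in> space N \<Longrightarrow> \<bar>v x\<bar> \<le> B"
  shows "integrable N (\<lambda>y. k \<theta> x y * v y)"
proof -
  have [measurable]: "\<theta> \<in> space P" using \<theta> by (simp add: admissible_def)
  note [measurable] = \<theta>(2) v(1)
  have B: "0 \<le> B" using v(2)[OF \<theta>(2)] by linarith
  show ?thesis
    by (rule integrable_const_bound[of _ "K * B"])
       (use \<theta> v B in \<open>auto simp: admissible_def abs_mult intro!: AE_I2 mult_mono intro: order_trans\<close>)
qed

lemma kernel_integral_bound:
  assumes \<theta>: "admissible \<theta>" "x \<in> space N" and v: "v \<in> borel_measurable N" "\<And>x. x \<in> space N \<Longrightarrow> \<bar>v x\<bar> \<le> B"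
  shows "\<bar>\<integral>y. k \<theta> x y * v y \<partial>N\<bar> \<le> \<rho> * B"
proof -
  have B: "0 \<le> B" using v(2)[OF \<theta>(2)] by linarith
  have "\<bar>\<integral>y. k \<theta> x y * v y \<partial>N\<bar> \<le> (\<integral>y. k \<theta> x y * B \<partial>N)"
  proof (rule abs_integral_le_AE)
    show "integrable N (\<lambda>y. k \<theta> x y * v y)" using v by (rule kernel_mult_integrable[OF \<theta>])
    show "AE y in N. \<bar>k \<theta> x y * v y\<bar> \<le> k \<theta> x y * B"
      using \<theta> v by (intro AE_I2) (auto simp: abs_mult admissible_def intro!: mult_left_mono)
  qed (use kernel_integrable[OF \<theta>] in simp)
  also have "\<dots> \<le> \<rho> * B" using \<theta> B by (auto simp: admissible_def intro!: mult_right_mono)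
  finally show ?thesis .
qed

lemma fixed_point_bound:
  assumes \<theta>: "admissible \<theta>" and v: "v \<in> borel_measurable N" "\<And>x. x \<in> space N \<Longrightarrow> \<bar>v x\<bar> \<le> B"
    and R: "\<And>x. x \<in> space N \<Longrightarrow> \<bar>v x - (\<integral>y. k \<theta> x y * v y \<partial>N)\<bar> \<le> R" and x: "x \<in> space N"
  shows "\<bar>v x\<bar> \<le> R / (1 - \<rho>)"
  by (rule subunit_kernel_fixed_point_bound[OF kernel_integrable[OF \<theta>] _ _ \<rho> v R x])
     (use \<theta> in \<open>auto simp: admissible_def\<close>)

fun picard :: "nat \<Rightarrow> 'p \<Rightarrow> 'x \<Rightarrow> real" where
  "picard 0 \<theta> x = 0"
| "picard (Suc n) \<theta> x = (\<integral>y. k \<theta> x y * picard n \<theta> y \<partial>N) + s \<theta> x"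

lemma picard_jointly_measurable: "(\<lambda>(\<theta>, x). picard n \<theta> x) \<in> borel_measurable (P \<Otimes>\<^sub>M N)"
proof (induction n)
  case (Suc n)
  have "(\<lambda>z :: ('p \<times> 'x) \<times> 'x. (fst (fst z), snd z)) \<in> measurable ((P \<Otimes>\<^sub>M N) \<Otimes>\<^sub>M N) (P \<Otimes>\<^sub>M N)"
    by measurable
  from measurable_compose[OF this Suc]
  have [measurable]: "(\<lambda>z. picard n (fst (fst z)) (snd z)) \<in> borel_measurable ((P \<Otimes>\<^sub>M N) \<Otimes>\<^sub>M N)"
    by simp
  show ?case by (simp add: split_beta')
qed simp

lemma picard_measurable[measurable (raw)]:
  assumes "f \<in> measurable A P" "g \<in> measurable A N"
  shows "(\<lambda>z. picard n (f z) (g z)) \<in> borel_measurable A"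
  using measurable_compose[OF measurable_Pair[OF assms] picard_jointly_measurable] by simp

lemma picard_bound:
  assumes \<theta>: "admissible \<theta>" and x: "x \<in> space N"
  shows "\<bar>picard n \<theta> x\<bar> \<le> G / (1 - \<rho>)"
  using x
proof (induction n arbitrary: x)
  case (Suc n)
  note [measurable] = \<theta>[unfolded admissible_def, THEN conjunct1]
  have "\<bar>\<integral>y. k \<theta> x y * picard n \<theta> y \<partial>N\<bar> \<le> \<rho> * (G / (1 - \<rho>))"
    using Suc by (intro kernel_integral_bound[OF \<theta>]) auto
  moreover have "\<bar>s \<theta> x\<bar> \<le> G" using \<theta> Suc.prems by (auto simp: admissible_def)
  moreover have "\<rho> * (G / (1 - \<rho>)) + G = G / (1 - \<rho>)" using \<rho> by (simp add: field_simps)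
  ultimately show ?case by simp
qed (use \<rho> G in simp)

lemma picard_increment:
  assumes \<theta>: "admissible \<theta>" and x: "x \<in> space N"
  shows "\<bar>picard (Suc n) \<theta> x - picard n \<theta> x\<bar> \<le> \<rho> ^ n * G"
  using x
proof (induction n arbitrary: x)
  case 0
  then show ?case using \<theta> by (simp add: admissible_def)
next
  case (Suc n)
  note [measurable] = \<theta>[unfolded admissible_def, THEN conjunct1]
  have i: "integrable N (\<lambda>y. k \<theta> x y * picard n \<theta> y)" for n
    using Suc.prems picard_bound[OF \<theta>] by (intro kernel_mult_integrable[OF \<theta>]) auto
  have "picard (Suc (Suc n)) \<theta> x - picard (Suc n) \<theta> x
      = (\<integral>y. k \<theta> x y * (picard (Suc n) \<theta> y - picard n \<theta> y) \<partial>N)"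
    using i[of "Suc n"] i[of n] by (simp add: right_diff_distrib del: picard.simps(2)) simp
  also have "\<bar>\<dots>\<bar> \<le> \<rho> * (\<rho> ^ n * G)"
    using Suc by (intro kernel_integral_bound[OF \<theta>]) (auto simp del: picard.simps)
  finally show ?case by (simp add: mult.assoc)
qed

definition solution :: "'p \<Rightarrow> 'x \<Rightarrow> real" where
  "solution \<theta> x = lim (\<lambda>n. picard n \<theta> x)"

lemma picard_tendsto:
  assumes \<theta>: "admissible \<theta>" and x: "x \<in> space N"
  shows "(\<lambda>n. picard n \<theta> x) \<longlonglongrightarrow> solution \<theta> x"
proof -
  have "summable (\<lambda>n. picard (Suc n) \<theta> x - picard n \<theta> x)"
    by (rule summable_comparison_test[of _ "\<lambda>n. \<rho> ^ n * G"])
       (use picard_increment[OF assms] \<rho> in \<open>auto simp del: picard.simps intro!: summable_mult2 summable_geometric\<close>)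
  then have "convergent (\<lambda>n. picard n \<theta> x)"
    using sum_lessThan_telescope[of "\<lambda>n. picard n \<theta> x"]
    by (simp add: summable_iff_convergent del: picard.simps(2))
  then show ?thesis unfolding solution_def by (simp add: convergent_LIMSEQ_iff)
qed

lemma solution_measurable[measurable (raw)]:
  assumes [measurable]: "f \<in> measurable A P" "g \<in> measurable A N"
  shows "(\<lambda>z. solution (f z) (g z)) \<in> borel_measurable A"
  unfolding solution_def by measurable

lemma solution_bound:
  assumes \<theta>: "admissible \<theta>" and x: "x \<in> space N"
  shows "\<bar>solution \<theta> x\<bar> \<le> G / (1 - \<rho>)"
  by (rule LIMSEQ_le_const2[OF tendsto_rabs[OF picard_tendsto[OF assms]]]) (use picard_bound[OF assms] in auto)

lemma solution_fixed_point:
  assumes \<theta>: "admissible \<theta>" and x: "x \<in> space N"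
  shows "solution \<theta> x = (\<integral>y. k \<theta> x y * solution \<theta> y \<partial>N) + s \<theta> x"
proof -
  have [measurable]: "\<theta> \<in> space P" using \<theta> by (simp add: admissible_def)
  note [measurable] = x
  have "(\<lambda>n. \<integral>y. k \<theta> x y * picard n \<theta> y \<partial>N) \<longlonglongrightarrow> (\<integral>y. k \<theta> x y * solution \<theta> y \<partial>N)"
  proof (rule integral_dominated_convergence[where w="\<lambda>y. k \<theta> x y * (G / (1 - \<rho>))"])
    show "integrable N (\<lambda>y. k \<theta> x y * (G / (1 - \<rho>)))"
      by (intro integrable_mult_left kernel_integrable[OF \<theta> x])
    show "AE y in N. (\<lambda>n. k \<theta> x y * picard n \<theta> y) \<longlonglongrightarrow> k \<theta> x y * solution \<theta> y"
      by (intro AE_I2 tendsto_mult_left picard_tendsto[OF \<theta>])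
    show "AE y in N. norm (k \<theta> x y * picard n \<theta> y) \<le> k \<theta> x y * (G / (1 - \<rho>))" for n
      using \<theta> x mult_left_mono[OF picard_bound[OF \<theta>]] by (intro AE_I2) (auto simp: abs_mult admissible_def)
  qed simp_all
  then have "(\<lambda>n. picard (Suc n) \<theta> x) \<longlonglongrightarrow> (\<integral>y. k \<theta> x y * solution \<theta> y \<partial>N) + s \<theta> x"
    by (simp add: tendsto_add_const_iff) (intro tendsto_intros)
  moreover have "(\<lambda>n. picard (Suc n) \<theta> x) \<longlonglongrightarrow> solution \<theta> x"
    using picard_tendsto[OF assms] by (rule LIMSEQ_Suc)
  ultimately show ?thesis by (rule LIMSEQ_unique[rotated])
qed

lemma solution_unique:
  assumes \<theta>: "admissible \<theta>" and v: "v \<in> borel_measurable N" "\<And>x. x \<in> space N \<Longrightarrow> \<bar>v x\<bar> \<le> B"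
    and eq: "\<And>x. x \<in> space N \<Longrightarrow> v x = (\<integral>y. k \<theta> x y * v y \<partial>N) + s \<theta> x" and x: "x \<in> space N"
  shows "v x = solution \<theta> x"
proof -
  have [measurable]: "\<theta> \<in> space P" using \<theta> by (simp add: admissible_def)
  have "\<bar>v x - solution \<theta> x\<bar> \<le> 0 / (1 - \<rho>)"
  proof (rule fixed_point_bound[OF \<theta> _ _ _ x])
    show "(\<lambda>x. v x - solution \<theta> x) \<in> borel_measurable N" using v by simp
    show "\<bar>v x - solution \<theta> x\<bar> \<le> B + G / (1 - \<rho>)" if "x \<in> space N" for x
      using v(2)[OF that] solution_bound[OF \<theta> that] by linarith
    fix x assume x: "x \<in> space N"
    have "integrable N (\<lambda>y. k \<theta> x y * v y)" "integrable N (\<lambda>y. k \<theta> x y * solution \<theta> y)"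
      using kernel_mult_integrable[OF \<theta> x v] kernel_mult_integrable[OF \<theta> x _ solution_bound[OF \<theta>]] by simp_all
    then show "\<bar>v x - solution \<theta> x - (\<integral>y. k \<theta> x y * (v y - solution \<theta> y) \<partial>N)\<bar> \<le> 0"
      using eq[OF x] solution_fixed_point[OF \<theta> x] by (simp add: right_diff_distrib)
  qed
  then show ?thesis by simp
qed

end

section \<open>Stratified sampling of a kernel\<close>

text \<open>
  The independent factor is written as a function of the restricted family \<open>\<lambda>i\<in>I - {l}. X i \<xi>\<close>; in this
  form it applies both to another single \<open>X j\<close> and to a quantity that depends on all variables except
  \<open>X l\<close>.
\<close>

lemma (in prob_space) expectation_centered_mult_independent:
  fixes d :: "'b \<Rightarrow> real" and h :: "('i \<Rightarrow> 'b) \<Rightarrow> real"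
  assumes ind: "indep_vars (\<lambda>_. S) X I" and l: "l \<in> I"
    and d: "d \<in> borel_measurable S" and h: "h \<in> borel_measurable (PiM (I - {l}) (\<lambda>_. S))"
    and id: "integrable M (\<lambda>\<xi>. d (X l \<xi>))" and zero: "expectation (\<lambda>\<xi>. d (X l \<xi>)) = 0"
    and ih: "integrable M (\<lambda>\<xi>. h (\<lambda>i\<in>I - {l}. X i \<xi>))"
  shows "expectation (\<lambda>\<xi>. d (X l \<xi>) * h (\<lambda>i\<in>I - {l}. X i \<xi>)) = 0"
proof -
  have "indep_var borel ((\<lambda>f. d (f l)) \<circ> (\<lambda>\<xi>. \<lambda>i\<in>{l}. X i \<xi>)) borel (h \<circ> (\<lambda>\<xi>. \<lambda>i\<in>I - {l}. X i \<xi>))"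
  proof (rule indep_var_compose[OF indep_var_restrict[OF ind, of "{l}" "I - {l}"]])
    show "(\<lambda>f. d (f l)) \<in> borel_measurable (PiM {l} (\<lambda>_. S))"
      by (rule measurable_compose[OF _ d]) (rule measurable_component_singleton, simp)
  qed (use l h in auto)
  from indep_var_lebesgue_integral[OF this] show ?thesis
    using id ih zero by (simp add: comp_def)
qed

text \<open>
  One ordinate \<open>X l\<close> is drawn in every cell \<open>l\<close>. The point \<open>c l\<close> is a reference ordinate of the cell and
  \<open>\<eta> l\<close> bounds the oscillation of kernel and source around it. The oscillation bound holds only almost
  surely: the inflow data may jump at the extreme direction of the outermost cell.
\<close>

locale stratified_sampling = N: finite_measure N + M: prob_space M
  for N :: "'x measure" and M :: "'w measure" +
  fixes I :: "'i set" and X :: "'i \<Rightarrow> 'w \<Rightarrow> real" and p :: "'i \<Rightarrow> real"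
    and \<kappa> :: "real \<Rightarrow> 'x \<Rightarrow> 'x \<Rightarrow> real" and g :: "real \<Rightarrow> 'x \<Rightarrow> real" and T :: "real set"
    and \<rho> K G B :: real and c \<eta> :: "'i \<Rightarrow> real" and \<phi> :: "'x \<Rightarrow> real"
  assumes finite_I: "finite I" and p_nonneg: "\<And>l. l \<in> I \<Longrightarrow> 0 \<le> p l" and p_sum: "sum p I = 1"
    and \<kappa>_measurable: "(\<lambda>(t, x, y). \<kappa> t x y) \<in> borel_measurable (borel \<Otimes>\<^sub>M N \<Otimes>\<^sub>M N)"
    and g_measurable: "(\<lambda>(t, x). g t x) \<in> borel_measurable (borel \<Otimes>\<^sub>M N)"
    and \<rho>: "0 \<le> \<rho>" "\<rho> < 1" and G: "0 \<le> G" and B: "G / (1 - \<rho>) \<le> B"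
    and \<kappa>: "\<And>t x y. t \<in> T \<Longrightarrow> x \<in> space N \<Longrightarrow> y \<in> space N \<Longrightarrow> 0 \<le> \<kappa> t x y \<and> \<kappa> t x y \<le> K"
    and \<kappa>_mass: "\<And>t x. t \<in> T \<Longrightarrow> x \<in> space N \<Longrightarrow> (\<integral>y. \<kappa> t x y \<partial>N) \<le> \<rho>"
    and g: "\<And>t x. t \<in> T \<Longrightarrow> x \<in> space N \<Longrightarrow> \<bar>g t x\<bar> \<le> G"
    and indep: "M.indep_vars (\<lambda>_. borel) X I"
    and X_T: "\<And>l \<xi>. l \<in> I \<Longrightarrow> \<xi> \<in> space M \<Longrightarrow> X l \<xi> \<in> T"
    and c_T: "\<And>l. l \<in> I \<Longrightarrow> c l \<in> T" and \<eta>: "\<And>l. l \<in> I \<Longrightarrow> 0 \<le> \<eta> l"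
    and osc: "\<And>l. l \<in> I \<Longrightarrow> AE \<xi> in M. \<forall>x\<in>space N. \<bar>g (X l \<xi>) x - g (c l) x\<bar> \<le> \<eta> l \<and>
        (\<forall>y\<in>space N. \<bar>\<kappa> (X l \<xi>) x y - \<kappa> (c l) x y\<bar> \<le> \<eta> l)"
    and \<phi>_measurable[measurable]: "\<phi> \<in> borel_measurable N" and \<phi>_bound: "\<And>x. x \<in> space N \<Longrightarrow> \<bar>\<phi> x\<bar> \<le> B"
    and \<phi>_eq: "\<And>x. x \<in> space N \<Longrightarrow>
        \<phi> x = (\<Sum>l\<in>I. p l * (\<integral>\<xi>. (\<integral>y. \<kappa> (X l \<xi>) x y * \<phi> y \<partial>N) + g (X l \<xi>) x \<partial>M))"
begin

sublocale MN: pair_sigma_finite M N ..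

lemma \<kappa>_measurable_raw[measurable (raw)]:
  assumes "f \<in> measurable A borel" "h \<in> measurable A N" "j \<in> measurable A N"
  shows "(\<lambda>z. \<kappa> (f z) (h z) (j z)) \<in> borel_measurable A"
  using measurable_compose[OF measurable_Pair[OF assms(1) measurable_Pair[OF assms(2,3)]] \<kappa>_measurable] by simp

lemma g_measurable_raw[measurable (raw)]:
  assumes "f \<in> measurable A borel" "h \<in> measurable A N"
  shows "(\<lambda>z. g (f z) (h z)) \<in> borel_measurable A"
  using measurable_compose[OF measurable_Pair[OF assms] g_measurable] by simp

definition mixed_kernel :: "('i \<Rightarrow> real) \<Rightarrow> 'x \<Rightarrow> 'x \<Rightarrow> real" where
  "mixed_kernel \<theta> x y = (\<Sum>l\<in>I. p l * \<kappa> (\<theta> l) x y)"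

definition mixed_source :: "('i \<Rightarrow> real) \<Rightarrow> 'x \<Rightarrow> real" where
  "mixed_source \<theta> x = (\<Sum>l\<in>I. p l * g (\<theta> l) x)"

definition ordinates :: "'w \<Rightarrow> 'i \<Rightarrow> real" where
  "ordinates \<xi> = (\<lambda>l\<in>I. X l \<xi>)"

sublocale mix: kernel_family N "PiM I (\<lambda>_. borel)" mixed_kernel mixed_source \<rho> K G
proof
  show "(\<lambda>(\<theta>, x, y). mixed_kernel \<theta> x y) \<in> borel_measurable (PiM I (\<lambda>_. borel) \<Otimes>\<^sub>M N \<Otimes>\<^sub>M N)"
    unfolding mixed_kernel_def by measurable
  show "(\<lambda>(\<theta>, x). mixed_source \<theta> x) \<in> borel_measurable (PiM I (\<lambda>_. borel) \<Otimes>\<^sub>M N)"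
    unfolding mixed_source_def by measurable
qed (use \<rho> G in auto)

lemma \<kappa>_integrable:
  assumes "t \<in> T" "x \<in> space N" "v \<in> borel_measurable N" "\<And>y. y \<in> space N \<Longrightarrow> \<bar>v y\<bar> \<le> b"
  shows "integrable N (\<lambda>y. \<kappa> t x y * v y)"
proof -
  note [measurable] = assms(2,3)
  have "0 \<le> b" using assms(4)[OF assms(2)] by linarith
  show ?thesis
  proof (rule N.integrable_const_bound[of _ "K * b"])
    show "AE y in N. norm (\<kappa> t x y * v y) \<le> K * b"
      using \<kappa>[OF assms(1,2)] assms(4) \<open>0 \<le> b\<close> by (intro AE_I2) (auto simp: abs_mult intro!: mult_mono intro: order_trans)
  qed simp
qed

lemma mixed_admissible:
  assumes \<theta>: "\<theta> \<in> I \<rightarrow>\<^sub>E T"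
  shows "mix.admissible \<theta>"
  unfolding mix.admissible_def
proof (intro conjI ballI)
  have \<theta>T: "\<theta> l \<in> T" if "l \<in> I" for l using \<theta> that by auto
  show "\<theta> \<in> space (PiM I (\<lambda>_. borel))" using \<theta> by (auto simp: space_PiM)
  fix x assume x: "x \<in> space N"
  have "integrable N (\<lambda>y. \<kappa> (\<theta> l) x y * 1)" if "l \<in> I" for l
    by (rule \<kappa>_integrable[OF \<theta>T[OF that] x, of _ 1]) auto
  then have "(\<integral>y. mixed_kernel \<theta> x y \<partial>N) = (\<Sum>l\<in>I. p l * (\<integral>y. \<kappa> (\<theta> l) x y \<partial>N))"
    unfolding mixed_kernel_def by (subst Bochner_Integration.integral_sum) auto
  also have "\<dots> \<le> (\<Sum>l\<in>I. p l * \<rho>)"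
    using \<kappa>_mass[OF \<theta>T x] p_nonneg by (intro sum_mono mult_left_mono) auto
  finally show "(\<integral>y. mixed_kernel \<theta> x y \<partial>N) \<le> \<rho>" by (simp add: sum_distrib_right[symmetric] p_sum)
  have "\<bar>mixed_source \<theta> x\<bar> \<le> (\<Sum>l\<in>I. p l * G)"
    unfolding mixed_source_def using g[OF \<theta>T x] p_nonneg
    by (intro order_trans[OF sum_abs] sum_mono) (auto simp: abs_mult intro!: mult_left_mono)
  then show "\<bar>mixed_source \<theta> x\<bar> \<le> G" by (simp add: sum_distrib_right[symmetric] p_sum)
  fix y assume y: "y \<in> space N"
  show "0 \<le> mixed_kernel \<theta> x y"
    unfolding mixed_kernel_def using \<kappa>[OF \<theta>T x y] p_nonneg by (intro sum_nonneg) auto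
  have "mixed_kernel \<theta> x y \<le> (\<Sum>l\<in>I. p l * K)"
    unfolding mixed_kernel_def using \<kappa>[OF \<theta>T x y] p_nonneg by (intro sum_mono mult_left_mono) auto
  then show "mixed_kernel \<theta> x y \<le> K" by (simp add: sum_distrib_right[symmetric] p_sum)
qed

lemma X_measurable[measurable]: "l \<in> I \<Longrightarrow> X l \<in> borel_measurable M"
  using indep by (auto simp: M.indep_vars_def)

lemma ordinates_measurable[measurable]: "ordinates \<in> measurable M (PiM I (\<lambda>_. borel))"
  unfolding ordinates_def by measurable

lemma ordinates_in_T: "\<xi> \<in> space M \<Longrightarrow> ordinates \<xi> \<in> I \<rightarrow>\<^sub>E T"
  using X_T by (auto simp: ordinates_def)

text \<open>
  An oscillation of at most \<open>e\<close> in kernel and source changes the image of a function bounded by \<open>B\<close> by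
  at most \<open>e * H\<close>.
\<close>

definition H :: real where "H = measure N (space N) * B + 1"

lemma B_nonneg: "0 \<le> B"
  using B G \<rho> by (meson divide_nonneg_pos diff_gt_0_iff_gt order_trans)

lemma oscillation_integral_bound:
  assumes t: "t \<in> T" "t' \<in> T" and x: "x \<in> space N"
    and v: "v \<in> borel_measurable N" "\<And>y. y \<in> space N \<Longrightarrow> \<bar>v y\<bar> \<le> B" and e: "0 \<le> e"
    and gb: "\<bar>g t x - g t' x\<bar> \<le> e" and \<kappa>b: "\<And>y. y \<in> space N \<Longrightarrow> \<bar>\<kappa> t x y - \<kappa> t' x y\<bar> \<le> e"
  shows "\<bar>((\<integral>y. \<kappa> t x y * v y \<partial>N) + g t x) - ((\<integral>y. \<kappa> t' x y * v y \<partial>N) + g t' x)\<bar> \<le> e * H"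
proof -
  note i = \<kappa>_integrable[OF t(1) x v] \<kappa>_integrable[OF t(2) x v]
  have "\<bar>\<integral>y. (\<kappa> t x y - \<kappa> t' x y) * v y \<partial>N\<bar> \<le> (\<integral>y. e * B \<partial>N)"
  proof (rule abs_integral_le_AE)
    show "integrable N (\<lambda>y. (\<kappa> t x y - \<kappa> t' x y) * v y)" using i by (simp add: left_diff_distrib)
    show "AE y in N. \<bar>(\<kappa> t x y - \<kappa> t' x y) * v y\<bar> \<le> e * B"
      using \<kappa>b v(2) e by (intro AE_I2) (auto simp: abs_mult intro!: mult_mono)
  qed simp
  moreover have "(\<integral>y. (\<kappa> t x y - \<kappa> t' x y) * v y \<partial>N) = (\<integral>y. \<kappa> t x y * v y \<partial>N) - (\<integral>y. \<kappa> t' x y * v y \<partial>N)"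
    using i by (simp add: left_diff_distrib)
  ultimately show ?thesis using gb by (simp add: H_def algebra_simps)
qed

lemma solution_le_B: "\<theta> \<in> I \<rightarrow>\<^sub>E T \<Longrightarrow> x \<in> space N \<Longrightarrow> \<bar>mix.solution \<theta> x\<bar> \<le> B"
  using mix.solution_bound[OF mixed_admissible] B by (meson order_trans)

text \<open>
  Kernel and source depend on the ordinate of the cell \<open>l\<close> only through a term of weight \<open>p l\<close>. The difference of the
  two solutions therefore satisfies the equation of \<open>\<theta>\<close> up to a defect of size \<open>p l * e * H\<close>.
\<close>

lemma solution_replace_ordinate:
  assumes \<theta>: "\<theta> \<in> I \<rightarrow>\<^sub>E T" and l: "l \<in> I" and t: "t \<in> T" and e: "0 \<le> e"
    and osc_e: "\<And>x. x \<in> space N \<Longrightarrow> \<bar>g (\<theta> l) x - g t x\<bar> \<le> e"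
      "\<And>x y. x \<in> space N \<Longrightarrow> y \<in> space N \<Longrightarrow> \<bar>\<kappa> (\<theta> l) x y - \<kappa> t x y\<bar> \<le> e"
    and x: "x \<in> space N"
  shows "\<bar>mix.solution \<theta> x - mix.solution (\<theta>(l := t)) x\<bar> \<le> p l * e * H / (1 - \<rho>)"
proof -
  define \<theta>' where "\<theta>' = \<theta>(l := t)"
  have \<theta>': "\<theta>' \<in> I \<rightarrow>\<^sub>E T" using \<theta> l t by (auto simp: \<theta>'_def PiE_iff extensional_def)
  have \<theta>l: "\<theta> l \<in> T" using \<theta> l by auto
  note ad = mixed_admissible[OF \<theta>] mixed_admissible[OF \<theta>']
  have [measurable]: "\<theta> \<in> space (PiM I (\<lambda>_. borel))" "\<theta>' \<in> space (PiM I (\<lambda>_. borel))"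
    using ad by (auto simp: mix.admissible_def)
  show ?thesis
    unfolding \<theta>'_def[symmetric]
  proof (rule mix.fixed_point_bound[OF ad(1) _ _ _ x])
    show "\<bar>mix.solution \<theta> y - mix.solution \<theta>' y\<bar> \<le> B + B" if "y \<in> space N" for y
      using solution_le_B[OF \<theta> that] solution_le_B[OF \<theta>' that] by linarith
    fix z assume z: "z \<in> space N"
    let ?u = "mix.solution \<theta>" and ?v = "mix.solution \<theta>'"
    have iu: "integrable N (\<lambda>y. mixed_kernel \<theta> z y * ?u y)" and iv: "integrable N (\<lambda>y. mixed_kernel \<theta> z y * ?v y)"
      and iv': "integrable N (\<lambda>y. mixed_kernel \<theta>' z y * ?v y)"
      using mix.kernel_mult_integrable[OF ad(1) z _ solution_le_B[OF \<theta>]]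
        mix.kernel_mult_integrable[OF ad(1) z _ solution_le_B[OF \<theta>']]
        mix.kernel_mult_integrable[OF ad(2) z _ solution_le_B[OF \<theta>']] by simp_all
    have diffk: "mixed_kernel \<theta> z y - mixed_kernel \<theta>' z y = p l * (\<kappa> (\<theta> l) z y - \<kappa> t z y)" for y
      unfolding mixed_kernel_def \<theta>'_def sum.remove[OF finite_I l] by (simp add: algebra_simps)
    have diffs: "mixed_source \<theta> z - mixed_source \<theta>' z = p l * (g (\<theta> l) z - g t z)"
      unfolding mixed_source_def \<theta>'_def sum.remove[OF finite_I l] by (simp add: algebra_simps)
    have k1: "integrable N (\<lambda>y. \<kappa> (\<theta> l) z y * ?v y)" "integrable N (\<lambda>y. \<kappa> t z y * ?v y)"
      using \<kappa>_integrable[OF \<theta>l z _ solution_le_B[OF \<theta>']] \<kappa>_integrable[OF t z _ solution_le_B[OF \<theta>']] by simp_all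
    have "?u z - ?v z - (\<integral>y. mixed_kernel \<theta> z y * (?u y - ?v y) \<partial>N)
       = mixed_source \<theta> z - mixed_source \<theta>' z + (\<integral>y. (mixed_kernel \<theta> z y - mixed_kernel \<theta>' z y) * ?v y \<partial>N)"
      using mix.solution_fixed_point[OF ad(1) z] mix.solution_fixed_point[OF ad(2) z] iu iv iv'
      by (simp add: left_diff_distrib right_diff_distrib)
    also have "(\<integral>y. (mixed_kernel \<theta> z y - mixed_kernel \<theta>' z y) * ?v y \<partial>N)
       = p l * ((\<integral>y. \<kappa> (\<theta> l) z y * ?v y \<partial>N) - (\<integral>y. \<kappa> t z y * ?v y \<partial>N))"
      unfolding diffk using k1 by (simp add: mult.assoc left_diff_distrib)
    finally have eq: "?u z - ?v z - (\<integral>y. mixed_kernel \<theta> z y * (?u y - ?v y) \<partial>N)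
      = p l * (((\<integral>y. \<kappa> (\<theta> l) z y * ?v y \<partial>N) + g (\<theta> l) z) - ((\<integral>y. \<kappa> t z y * ?v y \<partial>N) + g t z))"
      unfolding diffs by (simp add: algebra_simps)
    have "\<bar>((\<integral>y. \<kappa> (\<theta> l) z y * ?v y \<partial>N) + g (\<theta> l) z) - ((\<integral>y. \<kappa> t z y * ?v y \<partial>N) + g t z)\<bar> \<le> e * H"
      using oscillation_integral_bound[OF \<theta>l t z _ solution_le_B[OF \<theta>'] e osc_e(1)[OF z] osc_e(2)[OF z]] by simp
    then show "\<bar>?u z - ?v z - (\<integral>y. mixed_kernel \<theta> z y * (?u y - ?v y) \<partial>N)\<bar> \<le> p l * e * H"
      unfolding eq abs_mult using p_nonneg[OF l] by (simp add: mult.assoc mult_left_mono)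
  qed simp
qed

lemma bounded_integrable_MN:
  fixes f :: "'w \<Rightarrow> 'x \<Rightarrow> real"
  assumes "(\<lambda>(\<xi>, x). f \<xi> x) \<in> borel_measurable (M \<Otimes>\<^sub>M N)"
    and "\<And>\<xi> x. \<xi> \<in> space M \<Longrightarrow> x \<in> space N \<Longrightarrow> \<bar>f \<xi> x\<bar> \<le> b"
  shows "integrable (M \<Otimes>\<^sub>M N) (\<lambda>(\<xi>, x). f \<xi> x)"
proof -
  interpret MN_fin: finite_measure "M \<Otimes>\<^sub>M N"
    by (rule finite_measure_pair_measure) unfold_locales
  show ?thesis
    by (rule MN_fin.integrable_const_bound[of _ b]) (use assms in \<open>auto simp: space_pair_measure intro!: AE_I2\<close>)
qed

text \<open>
  One application of the exact transport operator, for the direction \<open>t\<close>, to the exact density.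
\<close>

definition transported :: "real \<Rightarrow> 'x \<Rightarrow> real" where
  "transported t x = (\<integral>y. \<kappa> t x y * \<phi> y \<partial>N) + g t x"

text \<open>
  Up to a constant this bounds the variance of the residual, and also the bias.
\<close>

definition variance_proxy :: real where
  "variance_proxy = (\<Sum>l\<in>I. (p l * \<eta> l)\<^sup>2)"

text \<open>
  Centring at the mean instead of at the reference point \<open>c l\<close> at most doubles the oscillation.
\<close>

lemma centred_bound:
  fixes f :: "real \<Rightarrow> real"
  assumes l: "l \<in> I" and f: "f \<in> borel_measurable borel" "\<And>t. t \<in> T \<Longrightarrow> \<bar>f t\<bar> \<le> b"
    and dev: "AE \<xi> in M. \<bar>f (X l \<xi>) - f (c l)\<bar> \<le> e"
  shows "integrable M (\<lambda>\<xi>. f (X l \<xi>))"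
    and "M.expectation (\<lambda>\<xi>. f (X l \<xi>) - M.expectation (\<lambda>\<xi>. f (X l \<xi>))) = 0"
    and "AE \<xi> in M. \<bar>f (X l \<xi>) - M.expectation (\<lambda>\<xi>. f (X l \<xi>))\<bar> \<le> 2 * e"
proof -
  note [measurable] = f(1) X_measurable[OF l]
  show i: "integrable M (\<lambda>\<xi>. f (X l \<xi>))"
    by (rule M.integrable_const_bound[of _ b]) (use f(2) X_T[OF l] in \<open>auto intro!: AE_I2\<close>)
  then show "M.expectation (\<lambda>\<xi>. f (X l \<xi>) - M.expectation (\<lambda>\<xi>. f (X l \<xi>))) = 0"
    by (simp add: M.prob_space)
  have "\<bar>M.expectation (\<lambda>\<xi>. f (X l \<xi>) - f (c l))\<bar> \<le> M.expectation (\<lambda>\<xi>. e)"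
    by (rule abs_integral_le_AE) (use i dev in auto)
  then have "\<bar>M.expectation (\<lambda>\<xi>. f (X l \<xi>)) - f (c l)\<bar> \<le> e"
    using i by (simp add: M.prob_space)
  with dev show "AE \<xi> in M. \<bar>f (X l \<xi>) - M.expectation (\<lambda>\<xi>. f (X l \<xi>))\<bar> \<le> 2 * e"
    by (auto elim!: eventually_mono)
qed

lemma transported_measurable[measurable (raw)]:
  assumes [measurable]: "f \<in> measurable A borel" "h \<in> measurable A N"
  shows "(\<lambda>z. transported (f z) (h z)) \<in> borel_measurable A"
  unfolding transported_def by measurable

lemma transported_bound:
  assumes t: "t \<in> T" and x: "x \<in> space N"
  shows "\<bar>transported t x\<bar> \<le> \<rho> * B + G"
proof -
  note [measurable] = x
  have i: "integrable N (\<lambda>y. \<kappa> t x y)" using \<kappa>_integrable[OF t x, of "\<lambda>_. 1" 1] by simp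
  have "\<bar>\<integral>y. \<kappa> t x y * \<phi> y \<partial>N\<bar> \<le> (\<integral>y. \<kappa> t x y * B \<partial>N)"
  proof (rule abs_integral_le_AE)
    show "AE y in N. \<bar>\<kappa> t x y * \<phi> y\<bar> \<le> \<kappa> t x y * B"
      using \<kappa>[OF t x] \<phi>_bound by (intro AE_I2) (auto simp: abs_mult intro!: mult_left_mono)
  qed (use \<kappa>_integrable[OF t x \<phi>_measurable \<phi>_bound] i in auto)
  also have "\<dots> \<le> \<rho> * B" using \<kappa>_mass[OF t x] B_nonneg by (simp add: mult_right_mono)
  finally show ?thesis using g[OF t x] by (simp add: transported_def)
qed

definition centred :: "'i \<Rightarrow> real \<Rightarrow> 'x \<Rightarrow> real" where
  "centred l t x = transported t x - M.expectation (\<lambda>\<xi>. transported (X l \<xi>) x)"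

text \<open>
  The defect with which \<open>\<phi>\<close> satisfies the sampled equation. It is a sum of independent centred
  variables since \<open>\<phi>\<close> is the \<open>p\<close>-weighted sum of the means subtracted in \<open>centred\<close>.
\<close>

definition residual :: "'w \<Rightarrow> 'x \<Rightarrow> real" where
  "residual \<xi> x = (\<Sum>l\<in>I. p l * centred l (X l \<xi>) x)"

lemma centred_measurable[measurable (raw)]:
  assumes [measurable]: "f \<in> measurable A borel" "h \<in> measurable A N" and l: "l \<in> I"
  shows "(\<lambda>z. centred l (f z) (h z)) \<in> borel_measurable A"
proof -
  note [measurable] = X_measurable[OF l]
  show ?thesis unfolding centred_def by measurable
qed

lemma residual_measurable[measurable (raw)]:
  assumes [measurable]: "f \<in> measurable A M" "h \<in> measurable A N"
  shows "(\<lambda>z. residual (f z) (h z)) \<in> borel_measurable A"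
  unfolding residual_def by measurable

lemma centred_props:
  assumes l: "l \<in> I" and x: "x \<in> space N"
  shows centred_expectation: "M.expectation (\<lambda>\<xi>. centred l (X l \<xi>) x) = 0"
    and centred_oscillation: "AE \<xi> in M. \<bar>centred l (X l \<xi>) x\<bar> \<le> 2 * (\<eta> l * H)"
    and centred_abs_bound: "t \<in> T \<Longrightarrow> \<bar>centred l t x\<bar> \<le> 2 * (\<rho> * B + G)"
proof -
  note [measurable] = x X_measurable[OF l]
  have dev: "AE \<xi> in M. \<bar>transported (X l \<xi>) x - transported (c l) x\<bar> \<le> \<eta> l * H"
    using osc[OF l] AE_space
  proof eventually_elim
    case (elim \<xi>)
    then show ?case
      unfolding transported_def
      by (intro oscillation_integral_bound[OF X_T[OF l] c_T[OF l] x \<phi>_measurable \<phi>_bound \<eta>[OF l]]) (use x in auto)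
  qed
  have m: "(\<lambda>t. transported t x) \<in> borel_measurable borel" by measurable
  note cb = centred_bound[OF l m transported_bound[OF _ x] dev]
  show "M.expectation (\<lambda>\<xi>. centred l (X l \<xi>) x) = 0" "AE \<xi> in M. \<bar>centred l (X l \<xi>) x\<bar> \<le> 2 * (\<eta> l * H)"
    using cb(2,3) by (simp_all add: centred_def)
  have "\<bar>M.expectation (\<lambda>\<xi>. transported (X l \<xi>) x)\<bar> \<le> M.expectation (\<lambda>\<xi>. \<rho> * B + G)"
    by (rule abs_integral_le_AE) (use cb(1) X_T[OF l] transported_bound[OF _ x] in \<open>auto intro!: AE_I2\<close>)
  then show "\<bar>centred l t x\<bar> \<le> 2 * (\<rho> * B + G)" if "t \<in> T"
    using transported_bound[OF that x] by (simp add: centred_def M.prob_space)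
qed

lemma centred_product_integrable:
  assumes l: "l \<in> I" and j: "j \<in> I" and x: "x \<in> space N"
  shows "integrable M (\<lambda>\<xi>. centred l (X l \<xi>) x)"
    and "integrable M (\<lambda>\<xi>. centred l (X l \<xi>) x * centred j (X j \<xi>) x)"
proof -
  note [measurable] = x X_measurable[OF l] X_measurable[OF j] l j
  note b = centred_abs_bound[OF l x X_T[OF l]] centred_abs_bound[OF j x X_T[OF j]]
  have nn: "0 \<le> \<rho> * B + G" using \<rho> G B_nonneg by simp
  show "integrable M (\<lambda>\<xi>. centred l (X l \<xi>) x)"
    by (rule M.integrable_const_bound[of _ "2 * (\<rho> * B + G)"]) (use b in \<open>auto intro!: AE_I2\<close>)
  show "integrable M (\<lambda>\<xi>. centred l (X l \<xi>) x * centred j (X j \<xi>) x)"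
  proof (rule M.integrable_const_bound[of _ "(2 * (\<rho> * B + G)) * (2 * (\<rho> * B + G))"])
    show "AE \<xi> in M. norm (centred l (X l \<xi>) x * centred j (X j \<xi>) x) \<le> (2 * (\<rho> * B + G)) * (2 * (\<rho> * B + G))"
      unfolding real_norm_def abs_mult using b nn by (intro AE_I2 mult_mono) auto
  qed simp
qed

lemma centred_orthogonal:
  assumes l: "l \<in> I" and j: "j \<in> I" and lj: "j \<noteq> l" and x: "x \<in> space N"
  shows "M.expectation (\<lambda>\<xi>. centred l (X l \<xi>) x * centred j (X j \<xi>) x) = 0"
proof -
  note [measurable] = x l j
  have "M.expectation (\<lambda>\<xi>. centred l (X l \<xi>) x * (\<lambda>f. centred j (f j) x) (\<lambda>i\<in>I - {l}. X i \<xi>)) = 0"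
  proof (rule M.expectation_centered_mult_independent[OF indep l])
    have [measurable]: "(\<lambda>f. f j) \<in> measurable (PiM (I - {l}) (\<lambda>_. borel)) (borel :: real measure)"
      using j lj by (intro measurable_component_singleton) auto
    show "(\<lambda>f. centred j (f j) x) \<in> borel_measurable (PiM (I - {l}) (\<lambda>_. borel))" by measurable
    show "(\<lambda>t. centred l t x) \<in> borel_measurable borel" by measurable
  qed (use j lj centred_expectation[OF l x] centred_product_integrable(1)[OF l l x] centred_product_integrable(1)[OF j j x] in auto)
  then show ?thesis using j lj by simp
qed

text \<open>
  Variances of independent terms add up; the cross terms vanish by \<open>centred_orthogonal\<close>.
\<close>

lemma residual_second_moment:
  assumes x: "x \<in> space N"
  shows "M.expectation (\<lambda>\<xi>. (residual \<xi> x)\<^sup>2) \<le> 4 * H\<^sup>2 * variance_proxy"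
proof -
  let ?d = "\<lambda>l \<xi>. centred l (X l \<xi>) x"
  have sq: "M.expectation (\<lambda>\<xi>. ?d l \<xi> * ?d l \<xi>) \<le> 4 * H\<^sup>2 * (\<eta> l)\<^sup>2" if l: "l \<in> I" for l
  proof -
    have "AE \<xi> in M. ?d l \<xi> * ?d l \<xi> \<le> 4 * H\<^sup>2 * (\<eta> l)\<^sup>2"
      using centred_oscillation[OF l x]
    proof eventually_elim
      case (elim \<xi>)
      then have "\<bar>?d l \<xi>\<bar>\<^sup>2 \<le> (2 * (\<eta> l * H))\<^sup>2" by (intro power_mono) auto
      then show ?case by (simp add: power2_eq_square algebra_simps)
    qed
    then have "M.expectation (\<lambda>\<xi>. ?d l \<xi> * ?d l \<xi>) \<le> M.expectation (\<lambda>\<xi>. 4 * H\<^sup>2 * (\<eta> l)\<^sup>2)"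
      by (intro integral_mono_AE centred_product_integrable l x) auto
    then show ?thesis by (simp add: M.prob_space)
  qed
  have "(residual \<xi> x)\<^sup>2 = (\<Sum>l\<in>I. \<Sum>j\<in>I. (p l * p j) * (?d l \<xi> * ?d j \<xi>))" for \<xi>
    unfolding residual_def power2_eq_square sum_product by (intro sum.cong refl) (simp add: mult_ac)
  then have "M.expectation (\<lambda>\<xi>. (residual \<xi> x)\<^sup>2) = (\<Sum>l\<in>I. \<Sum>j\<in>I. (p l * p j) * M.expectation (\<lambda>\<xi>. ?d l \<xi> * ?d j \<xi>))"
    using centred_product_integrable(2)[OF _ _ x] by simp
  also have "\<dots> = (\<Sum>l\<in>I. \<Sum>j\<in>I. if j = l then (p l * p l) * M.expectation (\<lambda>\<xi>. ?d l \<xi> * ?d l \<xi>) else 0)"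
    using centred_orthogonal[OF _ _ _ x] by (intro sum.cong refl) auto
  also have "\<dots> = (\<Sum>l\<in>I. (p l * p l) * M.expectation (\<lambda>\<xi>. ?d l \<xi> * ?d l \<xi>))"
    using finite_I by simp
  also have "\<dots> \<le> (\<Sum>l\<in>I. (p l * p l) * (4 * H\<^sup>2 * (\<eta> l)\<^sup>2))"
    using sq by (intro sum_mono mult_left_mono) auto
  also have "\<dots> = 4 * H\<^sup>2 * variance_proxy"
    unfolding variance_proxy_def sum_distrib_left by (intro sum.cong refl) (simp add: power2_eq_square mult_ac)
  finally show ?thesis .
qed

end

section \<open>Mean square error and bias of the sampled fixed point\<close>

context stratified_sampling begin

definition sampled :: "'w \<Rightarrow> 'x \<Rightarrow> real" where
  "sampled \<xi> x = mix.solution (ordinates \<xi>) x"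

lemma sampled_measurable[measurable (raw)]:
  assumes [measurable]: "f \<in> measurable A M" "h \<in> measurable A N"
  shows "(\<lambda>z. sampled (f z) (h z)) \<in> borel_measurable A"
  unfolding sampled_def by measurable

lemma sampled_bound: "\<xi> \<in> space M \<Longrightarrow> x \<in> space N \<Longrightarrow> \<bar>sampled \<xi> x\<bar> \<le> B"
  unfolding sampled_def by (intro solution_le_B ordinates_in_T)

lemma error_equation:
  assumes \<xi>: "\<xi> \<in> space M" and x: "x \<in> space N"
  shows "sampled \<xi> x - \<phi> x =
    (\<integral>y. mixed_kernel (ordinates \<xi>) x y * (sampled \<xi> y - \<phi> y) \<partial>N) + residual \<xi> x"
proof -
  note ad = mixed_admissible[OF ordinates_in_T[OF \<xi>]]
  note [measurable] = \<xi>
  have o: "ordinates \<xi> l = X l \<xi>" if "l \<in> I" for l using that by (simp add: ordinates_def)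
  have i1: "integrable N (\<lambda>y. mixed_kernel (ordinates \<xi>) x y * sampled \<xi> y)"
    by (rule mix.kernel_mult_integrable[OF ad x _ sampled_bound[OF \<xi>]]) simp
  have i2: "integrable N (\<lambda>y. mixed_kernel (ordinates \<xi>) x y * \<phi> y)"
    by (rule mix.kernel_mult_integrable[OF ad x _ \<phi>_bound]) simp
  have "(\<integral>y. mixed_kernel (ordinates \<xi>) x y * \<phi> y \<partial>N) = (\<integral>y. (\<Sum>l\<in>I. p l * (\<kappa> (X l \<xi>) x y * \<phi> y)) \<partial>N)"
    unfolding mixed_kernel_def by (simp add: o sum_distrib_right mult.assoc)
  also have "\<dots> = (\<Sum>l\<in>I. p l * (\<integral>y. \<kappa> (X l \<xi>) x y * \<phi> y \<partial>N))"
    using \<kappa>_integrable[OF X_T[OF _ \<xi>] x \<phi>_measurable \<phi>_bound] by simp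
  finally have k: "(\<integral>y. mixed_kernel (ordinates \<xi>) x y * \<phi> y \<partial>N) = (\<Sum>l\<in>I. p l * (\<integral>y. \<kappa> (X l \<xi>) x y * \<phi> y \<partial>N))" .
  have "residual \<xi> x = (\<Sum>l\<in>I. p l * transported (X l \<xi>) x) - \<phi> x"
    unfolding residual_def centred_def using \<phi>_eq[OF x, folded transported_def]
    by (simp add: right_diff_distrib sum_subtractf)
  also have "(\<Sum>l\<in>I. p l * transported (X l \<xi>) x) = (\<integral>y. mixed_kernel (ordinates \<xi>) x y * \<phi> y \<partial>N) + mixed_source (ordinates \<xi>) x"
    unfolding k mixed_source_def transported_def by (simp add: o distrib_left sum.distrib)
  finally have r: "residual \<xi> x = (\<integral>y. mixed_kernel (ordinates \<xi>) x y * \<phi> y \<partial>N) + mixed_source (ordinates \<xi>) x - \<phi> x" .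
  have "(\<integral>y. mixed_kernel (ordinates \<xi>) x y * (sampled \<xi> y - \<phi> y) \<partial>N)
     = (\<integral>y. mixed_kernel (ordinates \<xi>) x y * sampled \<xi> y \<partial>N) - (\<integral>y. mixed_kernel (ordinates \<xi>) x y * \<phi> y \<partial>N)"
    using i1 i2 by (simp add: right_diff_distrib)
  then show ?thesis
    using mix.solution_fixed_point[OF ad x] r by (simp add: sampled_def)
qed

lemma residual_bound:
  assumes \<xi>: "\<xi> \<in> space M" and x: "x \<in> space N"
  shows "\<bar>residual \<xi> x\<bar> \<le> 2 * (\<rho> * B + G)"
proof -
  have "\<bar>residual \<xi> x\<bar> \<le> (\<Sum>l\<in>I. p l * (2 * (\<rho> * B + G)))"
    unfolding residual_def using centred_abs_bound[OF _ x X_T[OF _ \<xi>]] p_nonneg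
    by (intro order_trans[OF sum_abs] sum_mono) (auto simp: abs_mult intro!: mult_left_mono)
  then show ?thesis by (simp add: sum_distrib_right[symmetric] p_sum)
qed

text \<open>
  The contraction is in the supremum norm, whereas the residual is small only in mean square at each
  point, and its supremum over \<open>x\<close> is not controlled. Subtracting the residual first helps: \<open>u = e - r\<close>
  solves \<open>u = A u + A r\<close>, and the bounded kernel estimates \<open>A r\<close> uniformly by an integral of \<open>r\<close>.
\<close>

lemma error_pathwise_bound:
  assumes \<xi>: "\<xi> \<in> space M" and x: "x \<in> space N"
  shows "(sampled \<xi> x - \<phi> x)\<^sup>2 \<le> 2 * (residual \<xi> x)\<^sup>2
    + 2 * (K / (1 - \<rho>))\<^sup>2 * measure N (space N) * (\<integral>y. (residual \<xi> y)\<^sup>2 \<partial>N)"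
proof -
  note ad = mixed_admissible[OF ordinates_in_T[OF \<xi>]]
  note [measurable] = \<xi>
  let ?e = "\<lambda>x. sampled \<xi> x - \<phi> x" and ?r = "residual \<xi>" and ?k = "mixed_kernel (ordinates \<xi>)"
  have kK: "0 \<le> ?k z y" "?k z y \<le> K" if "z \<in> space N" "y \<in> space N" for z y
    using ad that by (auto simp: mix.admissible_def)
  have ir: "integrable N (\<lambda>y. \<bar>?r y\<bar>)" "integrable N (\<lambda>y. (?r y)\<^sup>2)"
  proof -
    show "integrable N (\<lambda>y. \<bar>?r y\<bar>)"
      by (rule N.integrable_const_bound[of _ "2 * (\<rho> * B + G)"]) (use residual_bound[OF \<xi>] in \<open>auto intro!: AE_I2\<close>)
    show "integrable N (\<lambda>y. (?r y)\<^sup>2)"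
      by (rule N.integrable_const_bound[of _ "(2 * (\<rho> * B + G))\<^sup>2"])
        (use power_mono[OF residual_bound[OF \<xi>], of _ 2] in \<open>auto intro!: AE_I2\<close>)
  qed
  have eb: "\<bar>?e y\<bar> \<le> B + B" if "y \<in> space N" for y
    using sampled_bound[OF \<xi> that] \<phi>_bound[OF that] by linarith
  have "\<bar>?e x - ?r x\<bar> \<le> (K * (\<integral>y. \<bar>?r y\<bar> \<partial>N)) / (1 - \<rho>)"
  proof (rule mix.fixed_point_bound[OF ad _ _ _ x])
    show "(\<lambda>x. ?e x - ?r x) \<in> borel_measurable N" by measurable
    show "\<bar>?e y - ?r y\<bar> \<le> (B + B) + 2 * (\<rho> * B + G)" if "y \<in> space N" for y
      using eb[OF that] residual_bound[OF \<xi> that] by linarith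
    fix z assume z: "z \<in> space N"
    have i1: "integrable N (\<lambda>y. ?k z y * ?e y)"
      by (rule mix.kernel_mult_integrable[OF ad z _ eb]) simp_all
    have i2: "integrable N (\<lambda>y. ?k z y * ?r y)"
      by (rule mix.kernel_mult_integrable[OF ad z _ residual_bound[OF \<xi>]]) simp_all
    have "?e z - ?r z - (\<integral>y. ?k z y * (?e y - ?r y) \<partial>N) = (\<integral>y. ?k z y * ?r y \<partial>N)"
      using error_equation[OF \<xi> z] Bochner_Integration.integral_diff[OF i1 i2] by (simp add: right_diff_distrib)
    moreover have "\<bar>\<integral>y. ?k z y * ?r y \<partial>N\<bar> \<le> (\<integral>y. K * \<bar>?r y\<bar> \<partial>N)"
    proof (rule abs_integral_le_AE[OF i2])
      show "AE y in N. \<bar>?k z y * ?r y\<bar> \<le> K * \<bar>?r y\<bar>"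
        using kK[OF z] by (intro AE_I2) (auto simp: abs_mult intro!: mult_right_mono)
    qed (use ir in simp)
    ultimately show "\<bar>?e z - ?r z - (\<integral>y. ?k z y * (?e y - ?r y) \<partial>N)\<bar> \<le> K * (\<integral>y. \<bar>?r y\<bar> \<partial>N)" by simp
  qed
  then have "\<bar>?e x - ?r x\<bar>\<^sup>2 \<le> ((K / (1 - \<rho>)) * (\<integral>y. \<bar>?r y\<bar> \<partial>N))\<^sup>2" by (intro power_mono) auto
  also have "\<dots> \<le> (K / (1 - \<rho>))\<^sup>2 * (measure N (space N) * (\<integral>y. (?r y)\<^sup>2 \<partial>N))"
    unfolding power_mult_distrib using N.square_integral_le[OF ir(1)] ir by (intro mult_left_mono) auto
  finally have u: "(?e x - ?r x)\<^sup>2 \<le> (K / (1 - \<rho>))\<^sup>2 * measure N (space N) * (\<integral>y. (?r y)\<^sup>2 \<partial>N)" by (simp add: mult.assoc)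
  have "(?e x)\<^sup>2 \<le> 2 * (?r x)\<^sup>2 + 2 * (?e x - ?r x)\<^sup>2"
    using zero_le_power2[of "2 * ?r x - ?e x"] by (simp add: power2_eq_square algebra_simps)
  then show ?thesis using u by linarith
qed

theorem mean_square_error:
  assumes x: "x \<in> space N"
  shows "integrable M (\<lambda>\<xi>. (sampled \<xi> x - \<phi> x)\<^sup>2)"
    and "M.expectation (\<lambda>\<xi>. (sampled \<xi> x - \<phi> x)\<^sup>2)
      \<le> 8 * H\<^sup>2 * (1 + (K / (1 - \<rho>) * measure N (space N))\<^sup>2) * variance_proxy"
proof -
  note [measurable] = x
  let ?b = "2 * (\<rho> * B + G)" and ?c = "2 * (K / (1 - \<rho>))\<^sup>2 * measure N (space N)"
  have "\<bar>sampled \<xi> x - \<phi> x\<bar> \<le> 2 * B" if "\<xi> \<in> space M" for \<xi>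
    using sampled_bound[OF that x] \<phi>_bound[OF x] by linarith
  from power_mono[OF this, of _ 2] show ie: "integrable M (\<lambda>\<xi>. (sampled \<xi> x - \<phi> x)\<^sup>2)"
    by (intro M.integrable_const_bound[of _ "(2 * B)\<^sup>2"]) (auto intro!: AE_I2)
  have rb: "\<bar>(residual \<xi> y)\<^sup>2\<bar> \<le> ?b\<^sup>2" if "\<xi> \<in> space M" "y \<in> space N" for \<xi> y
    using power_mono[OF residual_bound[OF that], of 2] by simp
  have ir: "integrable M (\<lambda>\<xi>. (residual \<xi> x)\<^sup>2)"
    by (intro M.integrable_const_bound[of _ "?b\<^sup>2"]) (use rb x in \<open>auto intro!: AE_I2\<close>)
  have iP: "integrable (M \<Otimes>\<^sub>M N) (\<lambda>(\<xi>, y). (residual \<xi> y)\<^sup>2)"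
    by (rule bounded_integrable_MN[OF _ rb]) (simp add: split_beta')
  have iN: "integrable M (\<lambda>\<xi>. \<integral>y. (residual \<xi> y)\<^sup>2 \<partial>N)" and iM: "integrable N (\<lambda>y. \<integral>\<xi>. (residual \<xi> y)\<^sup>2 \<partial>M)"
    using MN.integrable_fst'[OF iP] MN.integrable_snd[OF iP] by simp_all
  have "M.expectation (\<lambda>\<xi>. \<integral>y. (residual \<xi> y)\<^sup>2 \<partial>N) = (\<integral>y. M.expectation (\<lambda>\<xi>. (residual \<xi> y)\<^sup>2) \<partial>N)"
    using MN.Fubini_integral[OF iP] by simp
  also have "\<dots> \<le> (\<integral>y. 4 * H\<^sup>2 * variance_proxy \<partial>N)"
    by (rule integral_mono) (use iM residual_second_moment in auto)
  finally have N: "M.expectation (\<lambda>\<xi>. \<integral>y. (residual \<xi> y)\<^sup>2 \<partial>N) \<le> measure N (space N) * (4 * H\<^sup>2 * variance_proxy)"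
    by simp
  have "M.expectation (\<lambda>\<xi>. (sampled \<xi> x - \<phi> x)\<^sup>2)
      \<le> M.expectation (\<lambda>\<xi>. 2 * (residual \<xi> x)\<^sup>2 + ?c * (\<integral>y. (residual \<xi> y)\<^sup>2 \<partial>N))"
    by (rule integral_mono) (use ie ir iN error_pathwise_bound[OF _ x] in auto)
  also have "\<dots> = 2 * M.expectation (\<lambda>\<xi>. (residual \<xi> x)\<^sup>2) + ?c * M.expectation (\<lambda>\<xi>. \<integral>y. (residual \<xi> y)\<^sup>2 \<partial>N)"
    using ir iN by simp
  also have "\<dots> \<le> 2 * (4 * H\<^sup>2 * variance_proxy) + ?c * (measure N (space N) * (4 * H\<^sup>2 * variance_proxy))"
    using residual_second_moment[OF x] N by (intro add_mono mult_left_mono) auto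
  also have "\<dots> = 8 * H\<^sup>2 * (1 + (K / (1 - \<rho>) * measure N (space N))\<^sup>2) * variance_proxy"
    by (simp add: power2_eq_square algebra_simps)
  finally show "M.expectation (\<lambda>\<xi>. (sampled \<xi> x - \<phi> x)\<^sup>2)
      \<le> 8 * H\<^sup>2 * (1 + (K / (1 - \<rho>) * measure N (space N))\<^sup>2) * variance_proxy" .
qed

text \<open>
  Freezing the ordinate of the cell \<open>l\<close> at \<open>c l\<close> yields a density \<open>z\<close> that is independent of \<open>X l\<close> and hence
  uncorrelated with the centred kernel of the cell. Only the difference \<open>sampled - z\<close> remains, and it is as small
  as the weight and the oscillation of one cell. This second small factor is what
  makes the bias quadratic.
\<close>

lemma leave_one_out_covariance:
  assumes l: "l \<in> I" and x: "x \<in> space N" and y: "y \<in> space N"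
  defines "m \<equiv> M.expectation (\<lambda>\<xi>. \<kappa> (X l \<xi>) x y)"
  shows "integrable M (\<lambda>\<xi>. (\<kappa> (X l \<xi>) x y - m) * sampled \<xi> y)"
    and "\<bar>M.expectation (\<lambda>\<xi>. (\<kappa> (X l \<xi>) x y - m) * sampled \<xi> y)\<bar> \<le> 2 * \<eta> l * (p l * \<eta> l * H / (1 - \<rho>))"
proof -
  note [measurable] = x y X_measurable[OF l]
  have \<kappa>m: "(\<lambda>t. \<kappa> t x y) \<in> borel_measurable borel" by measurable
  have \<kappa>K: "\<bar>\<kappa> t x y\<bar> \<le> K" if "t \<in> T" for t using \<kappa>[OF that x y] by auto
  have dev: "AE \<xi> in M. \<bar>\<kappa> (X l \<xi>) x y - \<kappa> (c l) x y\<bar> \<le> \<eta> l"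
    using osc[OF l] x y by (auto elim!: eventually_mono)
  note cb = centred_bound[OF l \<kappa>m \<kappa>K dev, folded m_def]
  have dev2: "AE \<xi> in M. \<bar>\<kappa> (X l \<xi>) x y - m\<bar> \<le> 2 * \<eta> l" using cb(3) by simp
  have m_bd: "\<bar>\<kappa> (X l \<xi>) x y - m\<bar> \<le> K + \<bar>m\<bar>" if "\<xi> \<in> space M" for \<xi>
    using \<kappa>K[OF X_T[OF l that]] by linarith
  \<comment> \<open>the density with the ordinate of this cell frozen\<close>
  define z where "z = (\<lambda>\<xi>. mix.solution ((ordinates \<xi>)(l := c l)) y)"
  have upd: "(ordinates \<xi>)(l := c l) \<in> I \<rightarrow>\<^sub>E T" if "\<xi> \<in> space M" for \<xi>
    using ordinates_in_T[OF that] c_T[OF l] l by (auto simp: PiE_iff extensional_def)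
  have zB: "\<bar>z \<xi>\<bar> \<le> B" if "\<xi> \<in> space M" for \<xi>
    unfolding z_def by (rule solution_le_B[OF upd[OF that] y])
  define h where "h = (\<lambda>f :: 'i \<Rightarrow> real. mix.solution (f(l := c l)) y)"
  have z_h: "z \<xi> = h (\<lambda>i\<in>I - {l}. X i \<xi>)" for \<xi>
  proof -
    have "(ordinates \<xi>)(l := c l) = (\<lambda>i\<in>I - {l}. X i \<xi>)(l := c l)"
      using l by (auto simp: ordinates_def fun_eq_iff)
    then show ?thesis by (simp add: z_def h_def)
  qed
  have [measurable]: "h \<in> borel_measurable (PiM (I - {l}) (\<lambda>_. borel))"
  proof -
    have [measurable]: "(\<lambda>f. f(l := c l)) \<in> measurable (PiM (I - {l}) (\<lambda>_. borel)) (PiM I (\<lambda>_. borel))"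
      by (rule measurable_fun_upd[where J="I - {l}"]) (use l in auto)
    show ?thesis unfolding h_def by measurable
  qed
  have rm: "(\<lambda>\<xi>. \<lambda>i\<in>I - {l}. X i \<xi>) \<in> measurable M (PiM (I - {l}) (\<lambda>_. borel))"
    by (rule measurable_restrict) auto
  have [measurable]: "z \<in> borel_measurable M"
    unfolding z_h by (rule measurable_compose[OF rm]) measurable
  have iz: "integrable M z" by (rule M.integrable_const_bound[of _ B]) (use zB in \<open>auto intro!: AE_I2\<close>)
  have "0 \<le> K + \<bar>m\<bar>"
    using M.not_empty m_bd by (metis abs_ge_zero ex_in_conv order_trans)
  have prod: "integrable M (\<lambda>\<xi>. (\<kappa> (X l \<xi>) x y - m) * w \<xi>)"
    if [measurable]: "w \<in> borel_measurable M" and w: "\<And>\<xi>. \<xi> \<in> space M \<Longrightarrow> \<bar>w \<xi>\<bar> \<le> B" for w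
  proof (rule M.integrable_const_bound[of _ "(K + \<bar>m\<bar>) * B"])
    show "AE \<xi> in M. norm ((\<kappa> (X l \<xi>) x y - m) * w \<xi>) \<le> (K + \<bar>m\<bar>) * B"
      unfolding real_norm_def abs_mult using m_bd w \<open>0 \<le> K + \<bar>m\<bar>\<close> by (intro AE_I2 mult_mono) auto
  qed simp
  show sampled_int: "integrable M (\<lambda>\<xi>. (\<kappa> (X l \<xi>) x y - m) * sampled \<xi> y)"
    by (rule prod) (use sampled_bound[OF _ y] in auto)
  have isz: "integrable M (\<lambda>\<xi>. (\<kappa> (X l \<xi>) x y - m) * z \<xi>)"
    by (rule prod) (use zB in auto)
  have z_eq: "z = (\<lambda>\<xi>. h (\<lambda>i\<in>I - {l}. X i \<xi>))" by (rule ext) (rule z_h)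
  have "M.expectation (\<lambda>\<xi>. (\<lambda>t. \<kappa> t x y - m) (X l \<xi>) * h (\<lambda>i\<in>I - {l}. X i \<xi>)) = 0"
  proof (rule M.expectation_centered_mult_independent[OF indep l])
    show "integrable M (\<lambda>\<xi>. h (\<lambda>i\<in>I - {l}. X i \<xi>))" using iz unfolding z_eq .
  qed (use cb in \<open>simp_all add: M.prob_space\<close>)
  then have zero: "M.expectation (\<lambda>\<xi>. (\<kappa> (X l \<xi>) x y - m) * z \<xi>) = 0" by (simp add: z_h)
  have "\<bar>M.expectation (\<lambda>\<xi>. (\<kappa> (X l \<xi>) x y - m) * (sampled \<xi> y - z \<xi>))\<bar>
      \<le> M.expectation (\<lambda>\<xi>. 2 * \<eta> l * (p l * \<eta> l * H / (1 - \<rho>)))"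
  proof (rule abs_integral_le_AE)
    show "integrable M (\<lambda>\<xi>. (\<kappa> (X l \<xi>) x y - m) * (sampled \<xi> y - z \<xi>))"
      using sampled_int isz by (simp add: right_diff_distrib)
    show "AE \<xi> in M. \<bar>(\<kappa> (X l \<xi>) x y - m) * (sampled \<xi> y - z \<xi>)\<bar> \<le> 2 * \<eta> l * (p l * \<eta> l * H / (1 - \<rho>))"
      using dev2 osc[OF l] AE_space
    proof eventually_elim
      case (elim \<xi>)
      have "ordinates \<xi> l = X l \<xi>" using l by (simp add: ordinates_def)
      then have "\<bar>sampled \<xi> y - z \<xi>\<bar> \<le> p l * \<eta> l * H / (1 - \<rho>)"
        unfolding sampled_def z_def using elim
        by (intro solution_replace_ordinate[OF ordinates_in_T l c_T[OF l] \<eta>[OF l] _ _ y]) auto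
      then show ?case unfolding abs_mult using elim \<eta>[OF l] by (intro mult_mono) auto
    qed
  qed simp
  moreover have "M.expectation (\<lambda>\<xi>. (\<kappa> (X l \<xi>) x y - m) * (sampled \<xi> y - z \<xi>)) = M.expectation (\<lambda>\<xi>. (\<kappa> (X l \<xi>) x y - m) * sampled \<xi> y)"
    using sampled_int isz zero by (simp add: right_diff_distrib[of "_ - m"])
  ultimately show "\<bar>M.expectation (\<lambda>\<xi>. (\<kappa> (X l \<xi>) x y - m) * sampled \<xi> y)\<bar> \<le> 2 * \<eta> l * (p l * \<eta> l * H / (1 - \<rho>))"
    by (simp add: M.prob_space)
qed

text \<open>
  The exact density is deterministic and drops out of the covariance. The kernel is a sum over cells, so
  the cells can be treated one at a time.
\<close>

lemma kernel_error_covariance: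
  assumes x: "x \<in> space N" and y: "y \<in> space N"
  defines "k \<equiv> \<lambda>\<xi>. mixed_kernel (ordinates \<xi>) x y"
  shows "\<bar>M.expectation (\<lambda>\<xi>. k \<xi> * (sampled \<xi> y - \<phi> y)) - M.expectation k * (M.expectation (\<lambda>\<xi>. sampled \<xi> y) - \<phi> y)\<bar>
    \<le> 2 * H / (1 - \<rho>) * variance_proxy"
proof -
  note [measurable] = x y
  define m where "m = (\<lambda>l. M.expectation (\<lambda>\<xi>. \<kappa> (X l \<xi>) x y))"
  have i\<kappa>: "integrable M (\<lambda>\<xi>. \<kappa> (X l \<xi>) x y)" if l: "l \<in> I" for l
    by (rule M.integrable_const_bound[of _ K]) (use l \<kappa>[OF X_T[OF l] x y] in \<open>auto intro!: AE_I2\<close>)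
  have sampled_int: "integrable M (\<lambda>\<xi>. sampled \<xi> y)"
    by (rule M.integrable_const_bound[of _ B]) (use sampled_bound[OF _ y] in \<open>auto intro!: AE_I2\<close>)
  have cov: "integrable M (\<lambda>\<xi>. (\<kappa> (X l \<xi>) x y - m l) * sampled \<xi> y)"
      "\<bar>M.expectation (\<lambda>\<xi>. (\<kappa> (X l \<xi>) x y - m l) * sampled \<xi> y)\<bar> \<le> 2 * \<eta> l * (p l * \<eta> l * H / (1 - \<rho>))"
    if "l \<in> I" for l
    unfolding m_def by (rule leave_one_out_covariance[OF that x y])+
  have k_eq: "k \<xi> = (\<Sum>l\<in>I. p l * \<kappa> (X l \<xi>) x y)" for \<xi>
    unfolding k_def mixed_kernel_def by (intro sum.cong) (auto simp: ordinates_def)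
  have ik: "integrable M k" and Ek: "M.expectation k = (\<Sum>l\<in>I. p l * m l)"
    unfolding k_eq[abs_def] m_def using i\<kappa> by auto
  have pt: "(k \<xi> - M.expectation k) * sampled \<xi> y = (\<Sum>l\<in>I. p l * ((\<kappa> (X l \<xi>) x y - m l) * sampled \<xi> y))" for \<xi>
    unfolding k_eq Ek sum_subtractf[symmetric] sum_distrib_right
    by (intro sum.cong refl) (simp add: algebra_simps)
  have ikm: "integrable M (\<lambda>\<xi>. (k \<xi> - M.expectation k) * sampled \<xi> y)"
    unfolding pt using cov(1) by auto
  have iks: "integrable M (\<lambda>\<xi>. k \<xi> * sampled \<xi> y)"
    using Bochner_Integration.integrable_add[OF ikm integrable_mult_right[OF sampled_int, of "M.expectation k"]] by (simp add: algebra_simps)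
  have "M.expectation (\<lambda>\<xi>. k \<xi> * (sampled \<xi> y - \<phi> y)) - M.expectation k * (M.expectation (\<lambda>\<xi>. sampled \<xi> y) - \<phi> y)
     = M.expectation (\<lambda>\<xi>. (k \<xi> - M.expectation k) * sampled \<xi> y)"
    using iks ik sampled_int by (simp add: left_diff_distrib right_diff_distrib)
  also have "\<dots> = (\<Sum>l\<in>I. p l * M.expectation (\<lambda>\<xi>. (\<kappa> (X l \<xi>) x y - m l) * sampled \<xi> y))"
    unfolding pt using cov(1) by simp
  also have "\<bar>\<dots>\<bar> \<le> (\<Sum>l\<in>I. p l * (2 * \<eta> l * (p l * \<eta> l * H / (1 - \<rho>))))"
  proof (rule order_trans[OF sum_abs sum_mono])
    fix l assume l: "l \<in> I"
    show "\<bar>p l * M.expectation (\<lambda>\<xi>. (\<kappa> (X l \<xi>) x y - m l) * sampled \<xi> y)\<bar>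
        \<le> p l * (2 * \<eta> l * (p l * \<eta> l * H / (1 - \<rho>)))"
      using mult_left_mono[OF cov(2)[OF l] p_nonneg[OF l]] p_nonneg[OF l] by (simp only: abs_mult abs_of_nonneg)
  qed
  also have "\<dots> = 2 * H / (1 - \<rho>) * variance_proxy"
    unfolding variance_proxy_def sum_distrib_left by (intro sum.cong refl) (simp add: power2_eq_square)
  finally show ?thesis .
qed

text \<open>
  The mean error solves the fixed point equation of the mean kernel up to the covariance of kernel and
  error, and the mean kernel has mass at most \<open>\<rho>\<close> as well.
\<close>

theorem bias_bound:
  assumes x: "x \<in> space N"
  shows "\<bar>M.expectation (\<lambda>\<xi>. sampled \<xi> x) - \<phi> x\<bar>
    \<le> measure N (space N) * (2 * H / (1 - \<rho>) * variance_proxy) / (1 - \<rho>)"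
proof (rule N.subunit_kernel_fixed_point_bound[where k="\<lambda>x y. M.expectation (\<lambda>\<xi>. mixed_kernel (ordinates \<xi>) x y)" and B="2 * B", OF _ _ _ \<rho> _ _ _ x])
  let ?k = "\<lambda>\<xi> x y. mixed_kernel (ordinates \<xi>) x y"
  have kK: "0 \<le> ?k \<xi> z y" "?k \<xi> z y \<le> K" if "\<xi> \<in> space M" "z \<in> space N" "y \<in> space N" for \<xi> z y
    using mixed_admissible[OF ordinates_in_T] that by (auto simp: mix.admissible_def)
  have sampled_int: "integrable M (\<lambda>\<xi>. sampled \<xi> y)" if [measurable]: "y \<in> space N" for y
    by (rule M.integrable_const_bound[of _ B]) (use sampled_bound[OF _ that] in \<open>auto intro!: AE_I2\<close>)
  show "(\<lambda>x. M.expectation (\<lambda>\<xi>. sampled \<xi> x) - \<phi> x) \<in> borel_measurable N" by measurable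
  fix z assume z[measurable]: "z \<in> space N"
  have iP: "integrable (M \<Otimes>\<^sub>M N) (\<lambda>(\<xi>, y). ?k \<xi> z y)"
    by (rule bounded_integrable_MN[of _ K]) (use kK[OF _ z] in \<open>auto simp: split_beta'\<close>)
  show ik: "integrable N (\<lambda>y. M.expectation (\<lambda>\<xi>. ?k \<xi> z y))"
    using MN.integrable_snd[OF iP] by simp
  show "0 \<le> M.expectation (\<lambda>\<xi>. ?k \<xi> z y)" if "y \<in> space N" for y
    using kK[OF _ z that] by (intro Bochner_Integration.integral_nonneg_AE AE_I2)
  have "(\<integral>y. M.expectation (\<lambda>\<xi>. ?k \<xi> z y) \<partial>N) = M.expectation (\<lambda>\<xi>. \<integral>y. ?k \<xi> z y \<partial>N)"
    using MN.Fubini_integral[OF iP] by simp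
  also have "\<dots> \<le> M.expectation (\<lambda>\<xi>. \<rho>)"
    by (rule integral_mono) (use MN.integrable_fst'[OF iP] mixed_admissible[OF ordinates_in_T] z in \<open>auto simp: mix.admissible_def\<close>)
  finally show "(\<integral>y. M.expectation (\<lambda>\<xi>. ?k \<xi> z y) \<partial>N) \<le> \<rho>" by (simp add: M.prob_space)
  have "\<bar>M.expectation (\<lambda>\<xi>. sampled \<xi> z)\<bar> \<le> M.expectation (\<lambda>\<xi>. B)"
    by (rule abs_integral_le_AE) (use sampled_int[OF z] sampled_bound[OF _ z] in auto)
  then show mb: "\<bar>M.expectation (\<lambda>\<xi>. sampled \<xi> z) - \<phi> z\<bar> \<le> 2 * B"
    using \<phi>_bound[OF z] by (simp add: M.prob_space)
  let ?e = "\<lambda>\<xi> y. sampled \<xi> y - \<phi> y"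
  have eb: "\<bar>?e \<xi> y\<bar> \<le> 2 * B" if "\<xi> \<in> space M" "y \<in> space N" for \<xi> y
    using sampled_bound[OF that] \<phi>_bound[OF that(2)] by linarith
  have ikeP: "integrable (M \<Otimes>\<^sub>M N) (\<lambda>(\<xi>, y). ?k \<xi> z y * ?e \<xi> y)"
  proof (rule bounded_integrable_MN[of _ "K * (2 * B)"])
    show "\<bar>?k \<xi> z y * ?e \<xi> y\<bar> \<le> K * (2 * B)" if "\<xi> \<in> space M" "y \<in> space N" for \<xi> y
      unfolding abs_mult using kK[OF that(1) z that(2)] eb[OF that] by (intro mult_mono) auto
  qed (simp add: split_beta')
  have ike: "integrable N (\<lambda>y. M.expectation (\<lambda>\<xi>. ?k \<xi> z y * ?e \<xi> y))"
    and ike': "integrable M (\<lambda>\<xi>. \<integral>y. ?k \<xi> z y * ?e \<xi> y \<partial>N)"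
    using MN.integrable_snd[OF ikeP] MN.integrable_fst'[OF ikeP] by simp_all
  have ir: "integrable M (\<lambda>\<xi>. residual \<xi> z)"
    by (rule M.integrable_const_bound[of _ "2 * (\<rho> * B + G)"]) (use residual_bound[OF _ z] in \<open>auto intro!: AE_I2\<close>)
  have Er: "M.expectation (\<lambda>\<xi>. residual \<xi> z) = 0"
    unfolding residual_def using centred_product_integrable(1)[OF _ _ z] centred_expectation[OF _ z] by simp
  have "M.expectation (\<lambda>\<xi>. sampled \<xi> z) - \<phi> z = M.expectation (\<lambda>\<xi>. ?e \<xi> z)"
    using sampled_int[OF z] by (simp add: M.prob_space)
  also have "\<dots> = M.expectation (\<lambda>\<xi>. (\<integral>y. ?k \<xi> z y * ?e \<xi> y \<partial>N) + residual \<xi> z)"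
    by (rule Bochner_Integration.integral_cong[OF refl]) (rule error_equation[OF _ z])
  also have "\<dots> = (\<integral>y. M.expectation (\<lambda>\<xi>. ?k \<xi> z y * ?e \<xi> y) \<partial>N)"
    using ike' ir Er MN.Fubini_integral[OF ikeP] by simp
  finally have E: "M.expectation (\<lambda>\<xi>. sampled \<xi> z) - \<phi> z = (\<integral>y. M.expectation (\<lambda>\<xi>. ?k \<xi> z y * ?e \<xi> y) \<partial>N)" .
  let ?b = "\<lambda>y. M.expectation (\<lambda>\<xi>. ?k \<xi> z y) * (M.expectation (\<lambda>\<xi>. sampled \<xi> y) - \<phi> y)"
  have ib: "integrable N ?b"
  proof (rule Bochner_Integration.integrable_bound[OF integrable_mult_left[OF ik, of "2 * B"]])
    have "\<bar>M.expectation (\<lambda>\<xi>. sampled \<xi> y) - \<phi> y\<bar> \<le> 2 * B" if y: "y \<in> space N" for y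
    proof -
      have "\<bar>M.expectation (\<lambda>\<xi>. sampled \<xi> y)\<bar> \<le> M.expectation (\<lambda>\<xi>. B)"
        by (rule abs_integral_le_AE) (use sampled_int[OF y] sampled_bound[OF _ y] in auto)
      then show ?thesis using \<phi>_bound[OF y] by (simp add: M.prob_space)
    qed
    then show "AE y in N. norm (?b y) \<le> norm (M.expectation (\<lambda>\<xi>. ?k \<xi> z y) * (2 * B))"
      using B_nonneg by (intro AE_I2) (auto simp: abs_mult intro!: mult_left_mono)
  qed measurable
  have "\<bar>\<integral>y. M.expectation (\<lambda>\<xi>. ?k \<xi> z y * ?e \<xi> y) - ?b y \<partial>N\<bar> \<le> (\<integral>y. 2 * H / (1 - \<rho>) * variance_proxy \<partial>N)"
    by (rule abs_integral_le_AE) (use ike ib kernel_error_covariance[OF z] in \<open>auto intro!: AE_I2\<close>)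
  then show "\<bar>M.expectation (\<lambda>\<xi>. sampled \<xi> z) - \<phi> z - (\<integral>y. ?b y \<partial>N)\<bar> \<le> measure N (space N) * (2 * H / (1 - \<rho>) * variance_proxy)"
    unfolding E using ike ib by simp
qed

end

section \<open>The kernel of the slab\<close>

lemma expectation_uniform:
  fixes f :: "real \<Rightarrow> real"
  assumes X: "X \<in> borel_measurable M" and d: "distr M borel X = uniform_measure lborel S"
    and S: "S \<in> sets borel" "emeasure lborel S \<noteq> 0" "emeasure lborel S \<noteq> \<infinity>" and f: "f \<in> borel_measurable borel"
  shows "(\<integral>\<xi>. f (X \<xi>) \<partial>M) = (LINT t:S|lborel. f t) / measure lborel S"
proof -
  have m: "0 < measure lborel S" using S by (simp add: measure_def enn2real_positive_iff less_top zero_less_iff_neq_zero)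
  have "(\<integral>\<xi>. f (X \<xi>) \<partial>M) = (\<integral>t. f t \<partial>distr M borel X)"
    by (rule integral_distr[symmetric, OF X f])
  also have "distr M borel X = density lborel (\<lambda>t. ennreal (indicator S t / measure lborel S))"
    unfolding d uniform_measure_def
  proof (intro arg_cong[where f="density lborel"] ext)
    fix t show "indicator S t / emeasure lborel S = ennreal (indicator S t / measure lborel S)"
      using S m by (simp add: emeasure_eq_ennreal_measure divide_ennreal split: split_indicator flip: ennreal_1)
  qed
  also have "(\<integral>t. f t \<partial>density lborel (\<lambda>t. ennreal (indicator S t / measure lborel S)))
     = (\<integral>t. (indicator S t / measure lborel S) *\<^sub>R f t \<partial>lborel)"
    by (rule integral_density) (use f S m in auto)
  also have "\<dots> = (LINT t:S|lborel. f t) / measure lborel S"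
    unfolding set_lebesgue_integral_def by (simp add: mult.commute flip: Bochner_Integration.integral_divide_zero) 
  finally show ?thesis .
qed

text \<open>
  Nothing is known about \<open>f\<close> outside \<open>{a<..<b}\<close> but the endpoint \<open>e\<close> is a possible direction. This
  version agrees with \<open>f\<close> at all directions that occur and is Borel measurable on the whole line.
\<close>

definition inflow_data :: "real \<Rightarrow> real \<Rightarrow> real \<Rightarrow> (real \<Rightarrow> real) \<Rightarrow> real \<Rightarrow> real" where
  "inflow_data a b e f t = indicator {a<..<b} t * f t + indicator {e} t * f e"

lemma inflow_data_measurable:
  assumes "L-lipschitz_on {a<..<b} f"
  shows "inflow_data a b e f \<in> borel_measurable borel"
proof -
  have "(\<lambda>t. indicator {a<..<b} t *\<^sub>R f t) \<in> borel_measurable borel"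
    by (intro borel_measurable_continuous_on_indicator lipschitz_on_continuous_on[OF assms]) auto
  then have [measurable]: "(\<lambda>t. indicator {a<..<b} t * f t) \<in> borel_measurable borel" by simp
  show ?thesis unfolding inflow_data_def[abs_def] by measurable
qed

lemma inflow_data_bound:
  assumes L: "L-lipschitz_on {a<..<b} f" and ab: "a < b"
  obtains D where "\<And>t. \<bar>inflow_data a b e f t\<bar> \<le> D"
proof -
  let ?m = "(a + b) / 2"
  have L0: "0 \<le> L" using L by (rule lipschitz_on_nonneg)
  have "\<bar>inflow_data a b e f t\<bar> \<le> (\<bar>f ?m\<bar> + L * (b - a)) + \<bar>f e\<bar>" for t
  proof -
    have "\<bar>indicator {a<..<b} t * f t\<bar> \<le> \<bar>f ?m\<bar> + L * (b - a)"
    proof (cases "t \<in> {a<..<b}")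
      case True
      have "\<bar>f t - f ?m\<bar> \<le> L * \<bar>t - ?m\<bar>"
        using lipschitz_onD[OF L True, of ?m] ab by (simp add: dist_real_def)
      also have "\<dots> \<le> L * (b - a)"
        using True L0 by (intro mult_left_mono) (auto simp: abs_le_iff field_simps)
      finally show ?thesis using True by simp
    qed (use L0 ab in simp)
    moreover have "\<bar>indicator {e} t * f e\<bar> \<le> \<bar>f e\<bar>" by (simp split: split_indicator)
    ultimately show ?thesis unfolding inflow_data_def by linarith
  qed
  then show thesis by (rule that)
qed

text \<open>
  In the variable \<open>1 / s\<close> both functions are Lipschitz, as \<open>exp\<close> has slope at most one on the negative half
  line; and \<open>1 / s\<close> has slope at most \<open>1 / \<delta>\<^sup>2\<close>.
\<close>

lemma attenuation_lipschitz:
  fixes u A \<delta> s s' :: real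
  assumes u: "0 \<le> u" "u \<le> A" and \<delta>: "0 < \<delta>" and s: "\<delta> \<le> s" "\<delta> \<le> s'"
  shows "\<bar>exp (- u / s) - exp (- u / s')\<bar> \<le> A / \<delta>\<^sup>2 * \<bar>s - s'\<bar>"
    and "\<bar>exp (- u / s) / s - exp (- u / s') / s'\<bar> \<le> (1 + A / \<delta>) / \<delta>\<^sup>2 * \<bar>s - s'\<bar>"
proof -
  have pos: "0 < s" "0 < s'" "0 \<le> A" using assms by auto
  have inv: "\<bar>1 / s - 1 / s'\<bar> \<le> \<bar>s - s'\<bar> / \<delta>\<^sup>2"
  proof -
    have "\<bar>1 / s - 1 / s'\<bar> = \<bar>s - s'\<bar> / (s * s')"
      using pos by (simp add: diff_frac_eq abs_minus_commute abs_mult)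
    also have "\<dots> \<le> \<bar>s - s'\<bar> / \<delta>\<^sup>2"
      using s \<delta> pos unfolding power2_eq_square by (intro divide_left_mono mult_mono mult_pos_pos) auto
    finally show ?thesis .
  qed
  have exp1: "exp (- a) - exp (- b) \<le> b - a" if "0 \<le> a" "a \<le> b" for a b :: real
  proof -
    have "exp (- a) * (1 + (a - b)) \<le> exp (- a) * exp (a - b)"
      by (intro mult_left_mono exp_ge_add_one_self) simp
    also have "\<dots> = exp (- b)" by (simp add: exp_add[symmetric])
    finally have "exp (- a) - exp (- b) \<le> exp (- a) * (b - a)" by (simp add: algebra_simps)
    also have "\<dots> \<le> 1 * (b - a)" using that by (intro mult_right_mono) auto
    finally show ?thesis by simp
  qed
  have expl: "\<bar>exp (- a) - exp (- b)\<bar> \<le> \<bar>a - b\<bar>" if "0 \<le> a" "0 \<le> b" for a b :: real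
    using exp1[of a b] exp1[of b a] that by (cases "a \<le> b") auto
  have "\<bar>exp (- (u / s)) - exp (- (u / s'))\<bar> \<le> \<bar>u / s - u / s'\<bar>"
    using u pos by (intro expl) auto
  also have "\<dots> = u * \<bar>1 / s - 1 / s'\<bar>"
  proof -
    have "u / s - u / s' = u * (1 / s - 1 / s')" by (simp add: right_diff_distrib)
    then show ?thesis using u by (simp only: abs_mult abs_of_nonneg)
  qed
  also have "\<dots> \<le> A * (\<bar>s - s'\<bar> / \<delta>\<^sup>2)" using u inv by (intro mult_mono) auto
  finally show 1: "\<bar>exp (- u / s) - exp (- u / s')\<bar> \<le> A / \<delta>\<^sup>2 * \<bar>s - s'\<bar>" by simp
  have "exp (- u / s) / s - exp (- u / s') / s' = exp (- u / s) * (1 / s - 1 / s') + (exp (- u / s) - exp (- u / s')) * (1 / s')"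
    by (simp add: algebra_simps)
  also have "\<bar>\<dots>\<bar> \<le> 1 * (\<bar>s - s'\<bar> / \<delta>\<^sup>2) + (A / \<delta>\<^sup>2 * \<bar>s - s'\<bar>) * (1 / \<delta>)"
  proof (intro order_trans[OF abs_triangle_ineq] add_mono)
    show "\<bar>exp (- u / s) * (1 / s - 1 / s')\<bar> \<le> 1 * (\<bar>s - s'\<bar> / \<delta>\<^sup>2)"
      unfolding abs_mult using inv u pos by (intro mult_mono) auto
    show "\<bar>(exp (- u / s) - exp (- u / s')) * (1 / s')\<bar> \<le> (A / \<delta>\<^sup>2 * \<bar>s - s'\<bar>) * (1 / \<delta>)"
      unfolding abs_mult using 1 s \<delta> pos by (intro mult_mono) (auto simp: frac_le)
  qed
  also have "\<dots> = (1 + A / \<delta>) / \<delta>\<^sup>2 * \<bar>s - s'\<bar>" using \<delta> by (simp add: field_simps)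
  finally show "\<bar>exp (- u / s) / s - exp (- u / s') / s'\<bar> \<le> (1 + A / \<delta>) / \<delta>\<^sup>2 * \<bar>s - s'\<bar>" .
qed

text \<open>
  The data of the slab with explicit bounds. The inequality between the cross sections holds only almost
  everywhere, \<open>lam\<close> being an essential supremum.
\<close>

locale slab =
  fixes xL xR \<delta> lam cS BS BT Bq L :: real and \<sigma>S \<sigma>T q \<psi>L \<psi>R :: "real \<Rightarrow> real"
  assumes xLR: "xL < xR" and \<delta>: "0 < \<delta>" "\<delta> < 1" and lam: "0 < lam" "lam < 1"
    and \<sigma>S_measurable: "\<sigma>S \<in> borel_measurable (lebesgue_on {xL..xR})"
    and \<sigma>S: "0 < cS" "\<And>x. x \<in> {xL..xR} \<Longrightarrow> cS \<le> \<sigma>S x \<and> \<sigma>S x \<le> BS"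
    and \<sigma>T_measurable: "\<sigma>T \<in> borel_measurable (lebesgue_on {xL..xR})"
    and \<sigma>T: "\<And>x. x \<in> {xL..xR} \<Longrightarrow> 0 \<le> \<sigma>T x \<and> \<sigma>T x \<le> BT"
    and ratio: "AE x in lebesgue_on {xL..xR}. \<sigma>S x \<le> lam * \<sigma>T x"
    and q_measurable: "q \<in> borel_measurable (lebesgue_on {xL..xR})"
    and q: "\<And>x. x \<in> {xL..xR} \<Longrightarrow> 0 \<le> q x \<and> q x \<le> Bq"
    and \<psi>L: "L-lipschitz_on {0<..<1} \<psi>L" and \<psi>R: "L-lipschitz_on {-1<..<0} \<psi>R"
begin

abbreviation N :: "real measure" where "N \<equiv> lebesgue_on {xL..xR}"

sublocale N: finite_measure N by (intro finite_measure_lebesgue_on) simp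

definition \<tau> :: "real \<Rightarrow> real" where "\<tau> = optical_depth xL \<sigma>T"

lemma \<tau>_mono: "xL \<le> x \<Longrightarrow> x \<le> y \<Longrightarrow> y \<le> xR \<Longrightarrow> \<tau> x \<le> \<tau> y"
  unfolding \<tau>_def by (rule optical_depth_mono[OF \<sigma>T_measurable \<sigma>T])

lemma \<tau>_xL: "\<tau> xL = 0" by (simp add: \<tau>_def optical_depth_def)

lemma \<tau>_bounds: "x \<in> {xL..xR} \<Longrightarrow> 0 \<le> \<tau> x \<and> \<tau> x \<le> \<tau> xR"
  using \<tau>_mono[of xL x] \<tau>_mono[of x xR] \<tau>_xL by auto

lemma \<tau>_measurable[measurable]: "\<tau> \<in> borel_measurable N"
  unfolding \<tau>_def by (intro continuous_imp_measurable_on_sets_lebesgue optical_depth_continuous[OF \<sigma>T_measurable \<sigma>T]) auto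

declare \<sigma>S_measurable[measurable] \<sigma>T_measurable[measurable] q_measurable[measurable]

text \<open>
  The parameter is the negative direction \<open>t = - s\<close> of a pair, since the negative cells are the ones that
  are sampled. The kernel accounts for both directions of the pair.
\<close>

definition green :: "real \<Rightarrow> real \<Rightarrow> real \<Rightarrow> real" where
  "green t x y = exp (- \<bar>\<tau> x - \<tau> y\<bar> / (- t)) / (- t)"

definition \<psi>L' :: "real \<Rightarrow> real" where "\<psi>L' = inflow_data 0 1 1 \<psi>L"
definition \<psi>R' :: "real \<Rightarrow> real" where "\<psi>R' = inflow_data (-1) 0 (-1) \<psi>R"

text \<open>
  The weights of the cells are later taken relative to the negative directions, so they are twice the
  angular weights \<open>\<omega>\<^sub>l\<close>; the factor \<open>1 / 2\<close> here and in \<open>g\<close> makes up for it.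
\<close>

definition \<kappa> :: "real \<Rightarrow> real \<Rightarrow> real \<Rightarrow> real" where
  "\<kappa> t x y = green t x y * \<sigma>S y / 2"

definition g :: "real \<Rightarrow> real \<Rightarrow> real" where
  "g t x = ((\<integral>y. green t x y * q y \<partial>N) + \<psi>L' (- t) * exp (- \<tau> x / (- t))
      + \<psi>R' t * exp (- (\<tau> xR - \<tau> x) / (- t))) / 2"

lemma \<psi>_measurable[measurable]: "\<psi>L' \<in> borel_measurable borel" "\<psi>R' \<in> borel_measurable borel"
  unfolding \<psi>L'_def \<psi>R'_def by (rule inflow_data_measurable[OF \<psi>L] inflow_data_measurable[OF \<psi>R])+

lemma green_measurable[measurable (raw)]:
  assumes [measurable]: "f \<in> measurable A borel" "h \<in> measurable A N" "j \<in> measurable A N"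
  shows "(\<lambda>z. green (f z) (h z) (j z)) \<in> borel_measurable A"
  unfolding green_def by measurable

lemma \<kappa>_measurable: "(\<lambda>(t, x, y). \<kappa> t x y) \<in> borel_measurable (borel \<Otimes>\<^sub>M N \<Otimes>\<^sub>M N)"
  unfolding \<kappa>_def by measurable

lemma g_measurable: "(\<lambda>(t, x). g t x) \<in> borel_measurable (borel \<Otimes>\<^sub>M N)"
  unfolding g_def by measurable

lemma green_bounds: "t \<in> {-1..<-\<delta>} \<Longrightarrow> 0 \<le> green t x y \<and> green t x y \<le> 1 / \<delta>"
proof -
  assume t: "t \<in> {-1..<-\<delta>}"
  have "0 \<le> exp (- a / s) / s \<and> exp (- a / s) / s \<le> 1 / \<delta>" if "\<delta> < s" "0 \<le> a" for a s :: real
    using that \<delta> by (auto intro!: frac_le)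
  from this[of "- t" "\<bar>\<tau> x - \<tau> y\<bar>"] show ?thesis unfolding green_def using t by simp
qed

lemma green_lipschitz:
  assumes t: "t \<in> {-1..<-\<delta>}" "t' \<in> {-1..<-\<delta>}" and xy: "x \<in> {xL..xR}" "y \<in> {xL..xR}"
  shows "\<bar>green t x y - green t' x y\<bar> \<le> (1 + \<tau> xR / \<delta>) / \<delta>\<^sup>2 * \<bar>t - t'\<bar>"
proof -
  have "\<bar>\<tau> x - \<tau> y\<bar> \<le> \<tau> xR" using \<tau>_bounds[OF xy(1)] \<tau>_bounds[OF xy(2)] by linarith
  then show ?thesis
    using attenuation_lipschitz(2)[of "\<bar>\<tau> x - \<tau> y\<bar>" "\<tau> xR" \<delta> "-t" "-t'"] t \<delta>
    unfolding green_def by (simp add: abs_minus_commute)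
qed

lemma green_mult_integrable:
  assumes t: "t \<in> {-1..<-\<delta>}" and x: "x \<in> {xL..xR}" and v: "integrable N v"
  shows "integrable N (\<lambda>y. green t x y * v y)"
proof (rule Bochner_Integration.integrable_bound[OF integrable_mult_right[OF integrable_norm[OF v], of "1 / \<delta>"]])
  have [measurable]: "x \<in> space N" using x by simp
  show "(\<lambda>y. green t x y * v y) \<in> borel_measurable N" using v by measurable
  show "AE y in N. norm (green t x y * v y) \<le> norm (1 / \<delta> * norm (v y))"
    using green_bounds[OF t] \<delta> by (intro AE_I2) (auto simp: abs_mult intro!: mult_right_mono simp del: times_divide_eq_left)
qed

lemma bounded_integrable_N:
  fixes v :: "real \<Rightarrow> real"
  shows "v \<in> borel_measurable N \<Longrightarrow> (\<And>x. x \<in> {xL..xR} \<Longrightarrow> \<bar>v x\<bar> \<le> b) \<Longrightarrow> integrable N v"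
  by (rule N.integrable_const_bound[of _ b]) (auto intro!: AE_I2)

text \<open>
  The constant one solves the transport equation with source \<open>\<sigma>T\<close> and unit inflow in every direction.
  The solution formula for this solution expresses the mass as two minus the nonnegative inflow
  terms.
\<close>

lemma green_mass:
  assumes t: "t \<in> {-1..<-\<delta>}" and x: "x \<in> {xL..xR}"
  shows "(\<integral>y. green t x y * \<sigma>T y \<partial>N) \<le> 2"
proof -
  have sol: "transport_solution xL xR \<sigma>T (\<lambda>_. 1) (\<lambda>_. 1) \<mu> \<sigma>T (\<lambda>_. 1)" for \<mu>
    unfolding transport_solution_def absolutely_continuous_on_interval_def
    by (auto intro!: exI[of _ "1::real"] AE_I2 exI[of _ "0::real"])
  have "1 + 1 = (\<integral>y. exp (- \<bar>\<tau> x - \<tau> y\<bar> / (- t)) / (- t) * \<sigma>T y \<partial>N)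
      + 1 * exp (- \<tau> x / (- t)) + 1 * exp (- (\<tau> xR - \<tau> x) / (- t))"
    using transport_solution_pair[OF sol sol _ _ \<sigma>T_measurable \<sigma>T x, of "-t"] t \<delta> xLR unfolding \<tau>_def by simp
  moreover have "0 \<le> exp (- \<tau> x / (- t))" "0 \<le> exp (- (\<tau> xR - \<tau> x) / (- t))" by simp_all
  ultimately show ?thesis unfolding green_def by linarith
qed

lemma \<kappa>_bounds:
  assumes t: "t \<in> {-1..<-\<delta>}" and xy: "x \<in> space N" "y \<in> space N"
  shows "0 \<le> \<kappa> t x y \<and> \<kappa> t x y \<le> 1 / \<delta> * BS / 2"
proof -
  have "0 \<le> \<sigma>S y" "\<sigma>S y \<le> BS" using \<sigma>S(1) \<sigma>S(2)[of y] xy by auto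
  moreover have "0 \<le> green t x y" "green t x y \<le> 1 / \<delta>" using green_bounds[OF t, of x y] by auto
  ultimately have "0 \<le> green t x y * \<sigma>S y" "green t x y * \<sigma>S y \<le> 1 / \<delta> * BS"
    using \<delta> by (auto intro!: mult_mono simp del: times_divide_eq_left)
  then show ?thesis unfolding \<kappa>_def by simp
qed

text \<open>
  \<open>\<sigma>S \<le> lam * \<sigma>T\<close> almost everywhere reduces this to the mass, at most two, of \<open>green\<close> against \<open>\<sigma>T\<close>.
\<close>

lemma \<kappa>_mass:
  assumes t: "t \<in> {-1..<-\<delta>}" and x: "x \<in> space N"
  shows "(\<integral>y. \<kappa> t x y \<partial>N) \<le> lam"
proof -
  have i: "integrable N \<sigma>S" "integrable N \<sigma>T"
  proof -
    have "\<bar>\<sigma>S y\<bar> \<le> BS" "\<bar>\<sigma>T y\<bar> \<le> BT" if "y \<in> {xL..xR}" for y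
      using \<sigma>S(1) \<sigma>S(2)[OF that] \<sigma>T[OF that] by auto
    note b = this
    show "integrable N \<sigma>S" by (rule bounded_integrable_N[OF \<sigma>S_measurable b(1)])
    show "integrable N \<sigma>T" by (rule bounded_integrable_N[OF \<sigma>T_measurable b(2)])
  qed
  have x': "x \<in> {xL..xR}" using x by simp
  have "(\<integral>y. green t x y * \<sigma>S y / 2 \<partial>N) \<le> (\<integral>y. lam / 2 * (green t x y * \<sigma>T y) \<partial>N)"
  proof (rule integral_mono_AE)
    show "AE y in N. green t x y * \<sigma>S y / 2 \<le> lam / 2 * (green t x y * \<sigma>T y)"
      using ratio
    proof eventually_elim
      case (elim y)
      have "green t x y * \<sigma>S y \<le> green t x y * (lam * \<sigma>T y)"
        using elim green_bounds[OF t, of x y] by (intro mult_left_mono) auto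
      then show ?case by (simp add: mult_ac)
    qed
  qed (use green_mult_integrable[OF t x' i(1)] green_mult_integrable[OF t x' i(2)] in auto)
  also have "\<dots> = lam / 2 * (\<integral>y. green t x y * \<sigma>T y \<partial>N)" by simp
  also have "\<dots> \<le> lam / 2 * 2" using green_mass[OF t x'] lam by (intro mult_left_mono) auto
  finally show ?thesis unfolding \<kappa>_def by simp
qed

lemma inflow_lipschitz:
  assumes t: "t \<in> {-1<..<-\<delta>}" "t' \<in> {-1<..<-\<delta>}"
  shows "\<bar>\<psi>L' (- t) - \<psi>L' (- t')\<bar> \<le> L * \<bar>t - t'\<bar>" "\<bar>\<psi>R' t - \<psi>R' t'\<bar> \<le> L * \<bar>t - t'\<bar>"
  using lipschitz_onD[OF \<psi>L, of "-t" "-t'"] lipschitz_onD[OF \<psi>R, of t t'] t \<delta>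
  by (auto simp: \<psi>L'_def \<psi>R'_def inflow_data_def dist_real_def abs_minus_commute)

text \<open>
  The source consists of the attenuated interior source \<open>q\<close> and of the two attenuated inflow terms; the
  latter are products of bounded Lipschitz functions of the direction. The Lipschitz bound
  excludes the direction \<open>-1\<close>, where the inflow data are arbitrary.
\<close>

lemma source_regularity:
  obtains G Lg where "0 \<le> G" "0 \<le> Lg"
    "\<And>t x. t \<in> {-1..<-\<delta>} \<Longrightarrow> x \<in> space N \<Longrightarrow> \<bar>g t x\<bar> \<le> G"
    "\<And>t t' x. t \<in> {-1<..<-\<delta>} \<Longrightarrow> t' \<in> {-1<..<-\<delta>} \<Longrightarrow> x \<in> space N \<Longrightarrow> \<bar>g t x - g t' x\<bar> \<le> Lg * \<bar>t - t'\<bar>"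
proof -
  obtain DL where DL: "\<And>t. \<bar>\<psi>L' t\<bar> \<le> DL" unfolding \<psi>L'_def using inflow_data_bound[OF \<psi>L] by auto
  obtain DR where DR: "\<And>t. \<bar>\<psi>R' t\<bar> \<le> DR" unfolding \<psi>R'_def using inflow_data_bound[OF \<psi>R] by auto
  have D0: "0 \<le> DL" "0 \<le> DR" using DL[of 0] DR[of 0] by linarith+
  have L0: "0 \<le> L" using \<psi>L by (rule lipschitz_on_nonneg)
  have A0: "0 \<le> \<tau> xR" using \<tau>_bounds[of xR] xLR by auto
  have Bq0: "0 \<le> Bq" using q[of xL] xLR by auto
  let ?vN = "measure N (space N)" and ?Lk = "(1 + \<tau> xR / \<delta>) / \<delta>\<^sup>2" and ?Le = "\<tau> xR / \<delta>\<^sup>2"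
  have qi: "integrable N q" using q by (intro bounded_integrable_N[of _ Bq]) auto
  have Lk0: "0 \<le> ?Lk" using A0 \<delta> by simp
  have e1: "exp (- u / s) \<le> 1" if "0 \<le> u" "0 < s" for u s :: real using that by simp
  have half: "\<bar>(a + b + c) / 2\<bar> \<le> (a' + b' + c') / 2" if "\<bar>a\<bar> \<le> a'" "\<bar>b\<bar> \<le> b'" "\<bar>c\<bar> \<le> c'" for a b c a' b' c' :: real
    using that unfolding abs_divide by simp
  define G where "G = (?vN * (1 / \<delta> * Bq) + DL + DR) / 2"
  define Lg where "Lg = (?vN * (?Lk * Bq) + (L + DL * ?Le) + (L + DR * ?Le)) / 2"
  show thesis
  proof (rule that[of G Lg])
    show "0 \<le> G" "0 \<le> Lg" using D0 L0 A0 Bq0 Lk0 \<delta> unfolding G_def Lg_def by (auto intro!: add_nonneg_nonneg mult_nonneg_nonneg)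
  next
    fix t x assume t: "t \<in> {-1..<-\<delta>}" and x: "x \<in> space N"
    then have x': "x \<in> {xL..xR}" by simp
    have "\<bar>\<integral>y. green t x y * q y \<partial>N\<bar> \<le> (\<integral>y. 1 / \<delta> * Bq \<partial>N)"
    proof (rule abs_integral_le_AE[OF green_mult_integrable[OF t x' qi]])
      show "AE y in N. \<bar>green t x y * q y\<bar> \<le> 1 / \<delta> * Bq"
        unfolding abs_mult using green_bounds[OF t] q \<delta> by (intro AE_I2 mult_mono) auto
    qed simp
    then have 1: "\<bar>\<integral>y. green t x y * q y \<partial>N\<bar> \<le> ?vN * (1 / \<delta> * Bq)" by (simp only: lebesgue_integral_const real_scaleR_def)
    have 2: "\<bar>\<psi>L' (- t) * exp (- \<tau> x / (- t))\<bar> \<le> DL * 1"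
      unfolding abs_mult using DL D0 t \<delta> \<tau>_bounds[OF x'] e1[of "\<tau> x" "-t"] by (intro mult_mono) auto
    have 3: "\<bar>\<psi>R' t * exp (- (\<tau> xR - \<tau> x) / (- t))\<bar> \<le> DR * 1"
      unfolding abs_mult using DR D0 t \<delta> \<tau>_bounds[OF x'] e1[of "\<tau> xR - \<tau> x" "-t"] by (intro mult_mono) auto
    show "\<bar>g t x\<bar> \<le> G" using half[OF 1 2 3] unfolding g_def G_def mult_1_right .
  next
    fix t t' x assume t: "t \<in> {-1<..<-\<delta>}" "t' \<in> {-1<..<-\<delta>}" and x: "x \<in> space N"
    then have x': "x \<in> {xL..xR}" and tc: "t \<in> {-1..<-\<delta>}" "t' \<in> {-1..<-\<delta>}" by auto
    have i: "integrable N (\<lambda>y. green t x y * q y)" "integrable N (\<lambda>y. green t' x y * q y)"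
      using green_mult_integrable[OF tc(1) x' qi] green_mult_integrable[OF tc(2) x' qi] .
    have "\<bar>\<integral>y. green t x y * q y - green t' x y * q y \<partial>N\<bar> \<le> (\<integral>y. ?Lk * \<bar>t - t'\<bar> * Bq \<partial>N)"
    proof (rule abs_integral_le_AE)
      show "AE y in N. \<bar>green t x y * q y - green t' x y * q y\<bar> \<le> ?Lk * \<bar>t - t'\<bar> * Bq"
      proof (rule AE_I2)
        fix y assume "y \<in> space N" then have y: "y \<in> {xL..xR}" by simp
        have "\<bar>(green t x y - green t' x y) * q y\<bar> \<le> ?Lk * \<bar>t - t'\<bar> * Bq"
          unfolding abs_mult using green_lipschitz[OF tc x' y] q[OF y] Lk0 by (intro mult_mono) auto
        then show "\<bar>green t x y * q y - green t' x y * q y\<bar> \<le> ?Lk * \<bar>t - t'\<bar> * Bq"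
          by (simp add: left_diff_distrib)
      qed
    qed (use i in auto)
    then have 1: "\<bar>(\<integral>y. green t x y * q y \<partial>N) - (\<integral>y. green t' x y * q y \<partial>N)\<bar> \<le> ?vN * (?Lk * Bq) * \<bar>t - t'\<bar>"
      using i by (simp only: Bochner_Integration.integral_diff lebesgue_integral_const real_scaleR_def) (simp add: mult_ac)
    have prod: "\<bar>f t * exp (- u / (- t)) - f t' * exp (- u / (- t'))\<bar> \<le> (L + D * ?Le) * \<bar>t - t'\<bar>"
      if f: "\<bar>f t - f t'\<bar> \<le> L * \<bar>t - t'\<bar>" "\<bar>f t'\<bar> \<le> D" and u: "0 \<le> u" "u \<le> \<tau> xR" for f :: "real \<Rightarrow> real" and u D
    proof -
      have "f t * exp (- u / (- t)) - f t' * exp (- u / (- t'))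
         = (f t - f t') * exp (- u / (- t)) + f t' * (exp (- u / (- t)) - exp (- u / (- t')))"
        by (simp add: algebra_simps)
      also have "\<bar>\<dots>\<bar> \<le> (L * \<bar>t - t'\<bar>) * 1 + D * (?Le * \<bar>t - t'\<bar>)"
      proof (intro order_trans[OF abs_triangle_ineq] add_mono)
        show "\<bar>(f t - f t') * exp (- u / (- t))\<bar> \<le> (L * \<bar>t - t'\<bar>) * 1"
          unfolding abs_mult using f u t \<delta> L0 e1[of u "-t"] by (intro mult_mono) auto
        have "\<bar>exp (- u / (- t)) - exp (- u / (- t'))\<bar> \<le> ?Le * \<bar>t - t'\<bar>"
          using attenuation_lipschitz(1)[OF u \<delta>(1), of "-t" "-t'"] t by (simp add: abs_minus_commute)
        then show "\<bar>f t' * (exp (- u / (- t)) - exp (- u / (- t')))\<bar> \<le> D * (?Le * \<bar>t - t'\<bar>)"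
          unfolding abs_mult using f by (intro mult_mono) auto
      qed
      also have "\<dots> = (L + D * ?Le) * \<bar>t - t'\<bar>" by (simp add: algebra_simps)
      finally show ?thesis .
    qed
    have 2: "\<bar>\<psi>L' (- t) * exp (- \<tau> x / (- t)) - \<psi>L' (- t') * exp (- \<tau> x / (- t'))\<bar> \<le> (L + DL * ?Le) * \<bar>t - t'\<bar>"
      using inflow_lipschitz(1)[OF t] DL \<tau>_bounds[OF x'] by (intro prod[of "\<lambda>t. \<psi>L' (- t)"]) auto
    have 3: "\<bar>\<psi>R' t * exp (- (\<tau> xR - \<tau> x) / (- t)) - \<psi>R' t' * exp (- (\<tau> xR - \<tau> x) / (- t'))\<bar> \<le> (L + DR * ?Le) * \<bar>t - t'\<bar>"
      using inflow_lipschitz(2)[OF t] DR \<tau>_bounds[OF x'] by (intro prod[of \<psi>R']) auto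
    have "Lg * \<bar>t - t'\<bar> = (?vN * (?Lk * Bq) * \<bar>t - t'\<bar> + (L + DL * ?Le) * \<bar>t - t'\<bar> + (L + DR * ?Le) * \<bar>t - t'\<bar>) / 2"
      unfolding Lg_def by (simp only: distrib_right times_divide_eq_left)
    moreover have "g t x - g t' x = (((\<integral>y. green t x y * q y \<partial>N) - (\<integral>y. green t' x y * q y \<partial>N))
        + (\<psi>L' (- t) * exp (- \<tau> x / (- t)) - \<psi>L' (- t') * exp (- \<tau> x / (- t')))
        + (\<psi>R' t * exp (- (\<tau> xR - \<tau> x) / (- t)) - \<psi>R' t' * exp (- (\<tau> xR - \<tau> x) / (- t')))) / 2"
      unfolding g_def by (simp only: diff_divide_distrib add_divide_distrib)
    ultimately show "\<bar>g t x - g t' x\<bar> \<le> Lg * \<bar>t - t'\<bar>" using half[OF 1 2 3] by (simp only:)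
  qed
qed

lemma \<kappa>_lipschitz:
  assumes t: "t \<in> {-1..<-\<delta>}" "t' \<in> {-1..<-\<delta>}" and xy: "x \<in> space N" "y \<in> space N"
  shows "\<bar>\<kappa> t x y - \<kappa> t' x y\<bar> \<le> ((1 + \<tau> xR / \<delta>) / \<delta>\<^sup>2 * BS / 2) * \<bar>t - t'\<bar>"
proof -
  have xy': "x \<in> {xL..xR}" "y \<in> {xL..xR}" using xy by auto
  have s: "0 \<le> \<sigma>S y" "\<sigma>S y \<le> BS" using \<sigma>S(1) \<sigma>S(2)[OF xy'(2)] by auto
  have "\<bar>(green t x y - green t' x y) * \<sigma>S y\<bar> \<le> ((1 + \<tau> xR / \<delta>) / \<delta>\<^sup>2 * \<bar>t - t'\<bar>) * BS"
    unfolding abs_mult using green_lipschitz[OF t xy'] s \<tau>_bounds[of xR] xLR \<delta> by (intro mult_mono) auto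
  moreover have "\<kappa> t x y - \<kappa> t' x y = (green t x y - green t' x y) * \<sigma>S y / 2"
    unfolding \<kappa>_def by (simp add: left_diff_distrib diff_divide_distrib)
  ultimately show ?thesis by (simp only: abs_divide) (simp add: mult_ac)
qed

end

section \<open>Integral equations for the two densities\<close>

lemma measure_lborel_uminus:
  fixes A :: "real set"
  assumes "A \<in> sets borel"
  shows "measure lborel (uminus ` A) = measure lborel A"
proof -
  have "uminus ` A = uminus -` A \<inter> space lborel" by (auto simp: image_iff) (metis minus_minus)
  then have "emeasure lborel (uminus ` A) = emeasure (distr lborel borel uminus) A"
    using assms by (simp add: emeasure_distr)
  then show ?thesis by (simp add: lborel_distr_uminus measure_def)
qed

lemma sum_fold_symmetric:
  fixes a :: "nat \<Rightarrow> 'a::comm_monoid_add"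
  assumes "even n"
  shows "(\<Sum>l=1..n. a l) = (\<Sum>l=1..n div 2. a l + a (n + 1 - l))"
proof -
  have "{1..n} = {1..n div 2} \<union> {n div 2 + 1..n}" by auto
  then have "(\<Sum>l=1..n. a l) = (\<Sum>l=1..n div 2. a l) + (\<Sum>l=n div 2 + 1..n. a l)"
    by (simp only:) (rule sum.union_disjoint, auto)
  also have "(\<Sum>l=n div 2 + 1..n. a l) = (\<Sum>l=1..n div 2. a (n + 1 - l))"
    by (rule sum.reindex_bij_witness[of _ "\<lambda>l. n + 1 - l" "\<lambda>l. n + 1 - l"]) (use assms in auto)
  finally show ?thesis by (simp add: sum.distrib)
qed

lemma measure_angles:
  assumes "0 < \<delta>" "\<delta> < 1"
  shows "measure lborel (angles \<delta>) = 2 * (1 - \<delta>)"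
proof -
  have "measure lborel (angles \<delta>) = measure lborel {-1..<-\<delta>} + measure lborel {\<delta><..1}"
    unfolding angles_def using assms by (intro measure_Union) auto
  then show ?thesis using assms by simp
qed

text \<open>
  The integrand is only Lebesgue measurable, so the reflection is carried out for the gauge integral on
  closed intervals, from which the half-open ones differ by null sets.
\<close>

lemma set_integral_angles_fold:
  fixes f :: "real \<Rightarrow> real"
  assumes f: "set_integrable lebesgue (angles \<delta>) f" and \<delta>: "0 < \<delta>" "\<delta> < 1"
  shows "(LINT \<mu>:angles \<delta>|lebesgue. f \<mu>) = integral {-1..<-\<delta>} (\<lambda>t. f t + f (- t))"
proof -
  have sp: "negligible ({a..b} - {a..<b})" "negligible ({a..b} - {a<..b})" for a b :: real
    by (rule negligible_subset[OF negligible_sing[of b]], auto)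
       (rule negligible_subset[OF negligible_sing[of a]], auto)
  have neg: "set_integrable lebesgue {-1..<-\<delta>} f" and pos: "set_integrable lebesgue {\<delta><..1} f"
    by (rule set_integrable_subset[OF f]; auto simp: angles_def)+
  have negI: "f integrable_on {-1..<-\<delta>}" and posI: "f integrable_on {\<delta><..1}"
    using neg pos by (auto simp: absolutely_integrable_on_def)
  have posI': "f integrable_on {\<delta>..1}"
    using posI by (rule integrable_spike_set) (auto intro: negligible_subset[of "{\<delta>}"])
  have negI': "f integrable_on {-1..-\<delta>}"
    using negI by (rule integrable_spike_set) (auto intro: negligible_subset[of "{-\<delta>}"])
  have "(LINT \<mu>:angles \<delta>|lebesgue. f \<mu>) = integral (angles \<delta>) f"
    by (rule set_lebesgue_integral_eq_integral(2)[OF f])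
  also have "\<dots> = integral {-1..<-\<delta>} f + integral {\<delta><..1} f"
    unfolding angles_def using \<delta> negI posI
    by (intro integral_Un) (auto intro: negligible_subset[of "{}"])
  also have "integral {\<delta><..1} f = integral {\<delta>..1} f"
    using sp by (intro integral_subset_negligible) auto
  also have "\<dots> = integral {-1..-\<delta>} (\<lambda>t. f (- t))" by simp
  also have "integral {-1..<-\<delta>} f = integral {-1..-\<delta>} f"
    using sp by (intro integral_subset_negligible) auto
  also have "integral {-1..-\<delta>} f + integral {-1..-\<delta>} (\<lambda>t. f (- t)) = integral {-1..-\<delta>} (\<lambda>t. f t + f (- t))"
    using negI' posI' by (intro Henstock_Kurzweil_Integration.integral_add[symmetric]) auto
  also have "\<dots> = integral {-1..<-\<delta>} (\<lambda>t. f t + f (- t))"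
    using sp by (intro integral_subset_negligible[symmetric]) auto
  finally show ?thesis .
qed

context slab begin

lemma inflow_values:
  assumes "t \<in> {-1..<-\<delta>}"
  shows "\<psi>L' (- t) = \<psi>L (- t)" "\<psi>R' t = \<psi>R t"
  using assms \<delta> by (auto simp: \<psi>L'_def \<psi>R'_def inflow_data_def split: split_indicator)

lemma transport_pair_sum:
  assumes t: "t \<in> {-1..<-\<delta>}"
    and f: "transport_solution xL xR \<sigma>T \<psi>L \<psi>R t (\<lambda>x. \<sigma>S x * \<phi> x + q x) f"
    and h: "transport_solution xL xR \<sigma>T \<psi>L \<psi>R (- t) (\<lambda>x. \<sigma>S x * \<phi> x + q x) h"
  shows "integrable N (\<lambda>x. \<sigma>S x * \<phi> x + q x)"
    and "x \<in> {xL..xR} \<Longrightarrow> f x + h x = (\<integral>y. green t x y * (\<sigma>S y * \<phi> y + q y) \<partial>N)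
        + \<psi>L' (- t) * exp (- \<tau> x / (- t)) + \<psi>R' t * exp (- (\<tau> xR - \<tau> x) / (- t))"
    and "x \<in> {xL..xR} \<Longrightarrow> f x + h x = 2 * ((\<integral>y. \<kappa> t x y * \<phi> y \<partial>N) + g t x)"
proof -
  have s: "0 < - t" using t \<delta> by auto
  show Q: "integrable N (\<lambda>x. \<sigma>S x * \<phi> x + q x)"
    unfolding integrable_lebesgue_on_Icc_iff
    by (rule transport_solution_integrating_factor(1)[OF f _ _ \<sigma>T_measurable \<sigma>T]) (use s xLR in auto)
  have qi: "integrable N q" using q by (intro bounded_integrable_N[of _ Bq]) auto
  have \<sigma>\<phi>: "integrable N (\<lambda>x. \<sigma>S x * \<phi> x)"
    using Bochner_Integration.integrable_diff[OF Q qi] by simp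
  assume x: "x \<in> {xL..xR}"
  have "h x + f x = (\<integral>y. green t x y * (\<sigma>S y * \<phi> y + q y) \<partial>N)
      + \<psi>L (- t) * exp (- \<tau> x / (- t)) + \<psi>R t * exp (- (\<tau> xR - \<tau> x) / (- t))"
    using transport_solution_pair[OF h _ s _ \<sigma>T_measurable \<sigma>T x, of f] f xLR
    unfolding \<tau>_def[symmetric] green_def by simp
  then show *: "f x + h x = (\<integral>y. green t x y * (\<sigma>S y * \<phi> y + q y) \<partial>N)
      + \<psi>L' (- t) * exp (- \<tau> x / (- t)) + \<psi>R' t * exp (- (\<tau> xR - \<tau> x) / (- t))"
    unfolding inflow_values[OF t] by linarith
  have "(\<integral>y. green t x y * (\<sigma>S y * \<phi> y + q y) \<partial>N)
     = (\<integral>y. green t x y * (\<sigma>S y * \<phi> y) \<partial>N) + (\<integral>y. green t x y * q y \<partial>N)"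
    using green_mult_integrable[OF t x \<sigma>\<phi>] green_mult_integrable[OF t x qi] by (simp add: distrib_left)
  moreover have "(\<integral>y. \<kappa> t x y * \<phi> y \<partial>N) = (\<integral>y. green t x y * (\<sigma>S y * \<phi> y) \<partial>N) / 2"
    unfolding \<kappa>_def by (simp add: mult.assoc)
  ultimately show "f x + h x = 2 * ((\<integral>y. \<kappa> t x y * \<phi> y \<partial>N) + g t x)"
    unfolding * g_def by (simp only: distrib_left) (simp only: field_simps, simp)
qed

lemma source_eq:
  assumes "\<sigma>r = (\<lambda>x. \<sigma>S x / lam)"
  shows "(\<lambda>x. lam * \<sigma>r x * \<phi> x + q x) = (\<lambda>x. \<sigma>S x * \<phi> x + q x)"
  using lam by (simp add: assms)

text \<open>
  Measurability of the density is inherited from the source of the equation in one fixed direction, from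
  which \<open>\<sigma>S\<close> and \<open>q\<close> can be removed. Its boundedness follows from the integrability of the source,
  because the kernel is bounded by \<open>1 / \<delta>\<close>.
\<close>

lemma regularized_density:
  assumes reg: "regularized_solution xL xR \<sigma>T \<sigma>r q lam \<delta> \<psi>L \<psi>R \<psi>" and \<sigma>r: "\<sigma>r = (\<lambda>x. \<sigma>S x / lam)"
  defines "\<phi> \<equiv> density_of \<delta> \<psi>"
  shows regularized_density_measurable: "\<phi> \<in> borel_measurable N"
    and regularized_density_bounded: "\<exists>b. \<forall>x\<in>{xL..xR}. \<bar>\<phi> x\<bar> \<le> b"
    and regularized_density_equation: "x \<in> {xL..xR} \<Longrightarrow>
      set_integrable lborel {-1..<-\<delta>} (\<lambda>t. (\<integral>y. \<kappa> t x y * \<phi> y \<partial>N) + g t x) \<and>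
      \<phi> x = (LINT t:{-1..<-\<delta>}|lborel. (\<integral>y. \<kappa> t x y * \<phi> y \<partial>N) + g t x) / (1 - \<delta>)"
proof -
  have sol: "transport_solution xL xR \<sigma>T \<psi>L \<psi>R \<mu> (\<lambda>x. \<sigma>S x * \<phi> x + q x) (\<lambda>x. \<psi> x \<mu>)" if "\<mu> \<in> angles \<delta>" for \<mu>
    using reg that unfolding regularized_solution_def \<phi>_def by (simp add: source_eq[OF \<sigma>r])
  have int: "set_integrable lebesgue (angles \<delta>) (\<psi> x)" if "x \<in> {xL..xR}" for x
    using reg that unfolding regularized_solution_def by simp
  have J: "t \<in> angles \<delta>" "- t \<in> angles \<delta>" if "t \<in> {-1..<-\<delta>}" for t using that by (auto simp: angles_def)
  note pair = transport_pair_sum[OF _ sol sol, OF _ J]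
  define Q where "Q = (\<lambda>x. \<sigma>S x * \<phi> x + q x)"
  \<comment> \<open>the equation in a single direction already shows that the source is integrable\<close>
  have m1: "(-1) \<in> {-1..<-\<delta>}" using \<delta> by auto
  have Qi: "integrable N Q" unfolding Q_def by (rule pair(1)[OF m1 m1 m1])
  have "(\<lambda>x. (Q x - q x) / \<sigma>S x) \<in> borel_measurable N"
    using Qi by (intro borel_measurable_divide borel_measurable_diff) auto
  moreover have "(Q x - q x) / \<sigma>S x = \<phi> x" if "x \<in> space N" for x
    using \<sigma>S(1) \<sigma>S(2)[of x] that by (auto simp: Q_def)
  ultimately show \<phi>m[measurable]: "\<phi> \<in> borel_measurable N"
    using measurable_cong[of N "\<lambda>x. (Q x - q x) / \<sigma>S x" \<phi> borel] by blast
  obtain DL where DL: "\<And>t. \<bar>\<psi>L' t\<bar> \<le> DL" unfolding \<psi>L'_def using inflow_data_bound[OF \<psi>L] by auto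
  obtain DR where DR: "\<And>t. \<bar>\<psi>R' t\<bar> \<le> DR" unfolding \<psi>R'_def using inflow_data_bound[OF \<psi>R] by auto
  have D0: "0 \<le> DL" "0 \<le> DR" using DL[of 0] DR[of 0] by linarith+
  define b where "b = (\<integral>y. 1 / \<delta> * \<bar>Q y\<bar> \<partial>N) + DL + DR"
  define F where "F = (\<lambda>x t. (\<integral>y. \<kappa> t x y * \<phi> y \<partial>N) + g t x)"
  have F: "\<psi> x t + \<psi> x (- t) = 2 * F x t" if "t \<in> {-1..<-\<delta>}" "x \<in> {xL..xR}" for x t
    unfolding F_def by (rule pair(3)[OF that(1,1,1,2)])
  have Fb: "\<bar>F x t\<bar> \<le> b" if t: "t \<in> {-1..<-\<delta>}" and x: "x \<in> {xL..xR}" for x t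
  proof -
    have e1: "exp (- u / s) \<le> 1" if "0 \<le> u" "0 < s" for u s :: real using that by simp
    have 1: "\<bar>\<integral>y. green t x y * Q y \<partial>N\<bar> \<le> (\<integral>y. 1 / \<delta> * \<bar>Q y\<bar> \<partial>N)"
    proof (rule abs_integral_le_AE[OF green_mult_integrable[OF t x Qi]])
      show "AE y in N. \<bar>green t x y * Q y\<bar> \<le> 1 / \<delta> * \<bar>Q y\<bar>"
        unfolding abs_mult using green_bounds[OF t] by (intro AE_I2 mult_right_mono) auto
    qed (use Qi in simp)
    have 2: "\<bar>\<psi>L' (- t) * exp (- \<tau> x / (- t))\<bar> \<le> DL * 1"
      unfolding abs_mult using DL D0 t \<delta> \<tau>_bounds[OF x] e1[of "\<tau> x" "-t"] by (intro mult_mono) auto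
    have 3: "\<bar>\<psi>R' t * exp (- (\<tau> xR - \<tau> x) / (- t))\<bar> \<le> DR * 1"
      unfolding abs_mult using DR D0 t \<delta> \<tau>_bounds[OF x] e1[of "\<tau> xR - \<tau> x" "-t"] by (intro mult_mono) auto
    have "2 * F x t = (\<integral>y. green t x y * Q y \<partial>N) + \<psi>L' (- t) * exp (- \<tau> x / (- t)) + \<psi>R' t * exp (- (\<tau> xR - \<tau> x) / (- t))"
      unfolding F[OF t x, symmetric] Q_def by (rule pair(2)[OF t t t x])
    also have "\<bar>\<dots>\<bar> \<le> b"
      unfolding b_def using 1 2 3 by (intro order_trans[OF abs_triangle_ineq] add_mono) auto
    finally show ?thesis by (simp add: abs_mult)
  qed
  have b0: "0 \<le> b" using Fb[OF m1, of xL] xLR by (auto intro: order_trans[OF abs_ge_zero])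
  have Fm: "F x \<in> borel_measurable borel" if x: "x \<in> {xL..xR}" for x
  proof -
    have [measurable]: "x \<in> space N" using x by simp
    have [measurable]: "(\<lambda>(t, y). \<kappa> t x y) \<in> borel_measurable (borel \<Otimes>\<^sub>M N)"
      unfolding \<kappa>_def by measurable
    have [measurable]: "(\<lambda>t. g t x) \<in> borel_measurable borel"
      unfolding g_def by measurable
    show ?thesis unfolding F_def by measurable
  qed
  have Fi: "set_integrable lborel {-1..<-\<delta>} (F x)" if x: "x \<in> {xL..xR}" for x
    unfolding set_integrable_def
  proof (rule integrableI_bounded_set_indicator)
    show "AE t in lborel. t \<in> {-1..<-\<delta>} \<longrightarrow> norm (F x t) \<le> b" using Fb[OF _ x] by auto
  qed (use Fm[OF x] \<delta> in auto)
  have eq: "\<phi> x = (LINT t:{-1..<-\<delta>}|lborel. F x t) / (1 - \<delta>)" if x: "x \<in> {xL..xR}" for x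
  proof -
    have "(LINT \<mu>:angles \<delta>|lebesgue. \<psi> x \<mu>) = integral {-1..<-\<delta>} (\<lambda>t. \<psi> x t + \<psi> x (- t))"
      by (rule set_integral_angles_fold[OF int[OF x] \<delta>])
    also have "\<dots> = integral {-1..<-\<delta>} (\<lambda>t. 2 * F x t)"
      by (rule Henstock_Kurzweil_Integration.integral_cong) (rule F[OF _ x])
    also have "\<dots> = 2 * integral {-1..<-\<delta>} (F x)" by simp
    also have "integral {-1..<-\<delta>} (F x) = (LINT t:{-1..<-\<delta>}|lborel. F x t)"
      by (rule set_borel_integral_eq_integral(2)[OF Fi[OF x], symmetric])
    finally have "\<phi> x = 2 * (LINT t:{-1..<-\<delta>}|lborel. F x t) / (2 * (1 - \<delta>))"
      unfolding \<phi>_def density_of_def measure_angles[OF \<delta>] by simp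
    then show ?thesis by (simp only: mult_divide_mult_cancel_left_if) simp
  qed
  show "x \<in> {xL..xR} \<Longrightarrow>
      set_integrable lborel {-1..<-\<delta>} (\<lambda>t. (\<integral>y. \<kappa> t x y * \<phi> y \<partial>N) + g t x) \<and>
      \<phi> x = (LINT t:{-1..<-\<delta>}|lborel. (\<integral>y. \<kappa> t x y * \<phi> y \<partial>N) + g t x) / (1 - \<delta>)"
    using Fi[of x] eq[of x] unfolding F_def by simp
  have "\<bar>\<phi> x\<bar> \<le> b" if x: "x \<in> {xL..xR}" for x
  proof -
    have "\<bar>\<integral>t. indicator {-1..<-\<delta>} t *\<^sub>R F x t \<partial>lborel\<bar> \<le> (\<integral>t. b * indicator {-1..<-\<delta>} t \<partial>lborel)"
    proof (rule abs_integral_le_AE[OF Fi[OF x, unfolded set_integrable_def]])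
      show "integrable lborel (\<lambda>t. b * indicator {-1..<-\<delta>} t)" using \<delta> by simp
      show "AE t in lborel. \<bar>indicator {-1..<-\<delta>} t *\<^sub>R F x t\<bar> \<le> b * indicator {-1..<-\<delta>} t"
        using Fb[OF _ x] by (intro AE_I2) (simp split: split_indicator)
    qed
    also have "(\<integral>t. b * indicator {-1..<-\<delta>} t \<partial>lborel) = b * (1 - \<delta>)" using \<delta> by simp
    finally show ?thesis
      using eq[OF x] \<delta> unfolding set_lebesgue_integral_def by (simp add: abs_divide pos_divide_le_eq)
  qed
  then show "\<exists>b. \<forall>x\<in>{xL..xR}. \<bar>\<phi> x\<bar> \<le> b" by blast
qed

lemma partition_cell:
  assumes part: "angular_partition \<delta> n S" and l: "l \<in> {1..n div 2}"
  shows "S l \<in> sets borel" "S l \<subseteq> {-1..<-\<delta>}" "is_interval (S l)" "S (n + 1 - l) = uminus ` S l"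
proof -
  show "is_interval (S l)" "S (n + 1 - l) = uminus ` S l" "S l \<subseteq> {-1..<-\<delta>}"
    using part l unfolding angular_partition_def by auto
  then show "S l \<in> sets borel" by (simp add: is_interval_convex real_interval_borel_measurable)
qed

text \<open>
  Cells \<open>l\<close> and \<open>n + 1 - l\<close> have equal weights and opposite ordinates, so their contributions combine to
  the two-sided kernel. The weight of the pair is \<open>2 \<omega>\<^sub>l = \<bar>S\<^sub>l\<bar> / (1 - \<delta>)\<close>.
\<close>

lemma rom_density_equation:
  assumes part: "angular_partition \<delta> n S" and n: "even n"
    and \<nu>: "\<And>l. l \<in> {1..n div 2} \<Longrightarrow> \<nu> l \<in> S l \<and> \<nu> (n + 1 - l) = - \<nu> l"
    and rom: "rom_solution xL xR \<sigma>T \<sigma>r q lam \<delta> \<psi>L \<psi>R n S \<nu> \<Psi>" and \<sigma>r: "\<sigma>r = (\<lambda>x. \<sigma>S x / lam)"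
  defines "\<phi> \<equiv> rom_density \<delta> n S \<Psi>"
  shows "\<phi> \<in> borel_measurable N" "\<exists>b. \<forall>x\<in>{xL..xR}. \<bar>\<phi> x\<bar> \<le> b"
    and "x \<in> {xL..xR} \<Longrightarrow>
      \<phi> x = (\<Sum>l\<in>{1..n div 2}. measure lborel (S l) / (1 - \<delta>) * ((\<integral>y. \<kappa> (\<nu> l) x y * \<phi> y \<partial>N) + g (\<nu> l) x))"
proof -
  have sol: "transport_solution xL xR \<sigma>T \<psi>L \<psi>R (\<nu> l) (\<lambda>x. \<sigma>S x * \<phi> x + q x) (\<Psi> l)" if "l \<in> {1..n}" for l
    using rom that unfolding rom_solution_def \<phi>_def by (simp add: source_eq[OF \<sigma>r])
  have "continuous_on {xL..xR} (\<Psi> l)" if "l \<in> {1..n}" for l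
    using sol[OF that] unfolding transport_solution_def by (auto intro: AC_continuous_on)
  then have cont: "continuous_on {xL..xR} \<phi>"
    unfolding \<phi>_def rom_density_def[abs_def] by (intro continuous_intros) auto
  show "\<phi> \<in> borel_measurable N" by (rule continuous_imp_measurable_on_sets_lebesgue[OF cont]) simp
  show "\<exists>b. \<forall>x\<in>{xL..xR}. \<bar>\<phi> x\<bar> \<le> b"
    using compact_imp_bounded[OF compact_continuous_image[OF cont compact_Icc]]
    by (auto simp: bounded_iff)
  assume x: "x \<in> {xL..xR}"
  have w: "angular_weight \<delta> (S (n + 1 - l)) = angular_weight \<delta> (S l)" if l: "l \<in> {1..n div 2}" for l
    using partition_cell[OF part l] by (simp add: angular_weight_def measure_lborel_uminus)
  have "\<phi> x = (\<Sum>l\<in>{1..n div 2}. angular_weight \<delta> (S l) * (\<Psi> l x + \<Psi> (n + 1 - l) x))"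
    unfolding \<phi>_def rom_density_def sum_fold_symmetric[OF n]
    by (intro sum.cong refl) (simp only: w distrib_left)
  also have "\<dots> = (\<Sum>l\<in>{1..n div 2}. measure lborel (S l) / (1 - \<delta>) * ((\<integral>y. \<kappa> (\<nu> l) x y * \<phi> y \<partial>N) + g (\<nu> l) x))"
  proof (intro sum.cong refl)
    fix l assume l: "l \<in> {1..n div 2}"
    have t: "\<nu> l \<in> {-1..<-\<delta>}" using \<nu>[OF l] partition_cell(2)[OF part l] by auto
    have "l \<in> {1..n}" "n + 1 - l \<in> {1..n}" using l by auto
    note s = sol[OF this(1)] sol[OF this(2)]
    have "transport_solution xL xR \<sigma>T \<psi>L \<psi>R (- \<nu> l) (\<lambda>x. \<sigma>S x * \<phi> x + q x) (\<Psi> (n + 1 - l))"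
      using s(2) \<nu>[OF l] by simp
    note pair = transport_pair_sum(3)[OF t s(1) this x]
    have cancel: "w / (2 * d) * (2 * z) = w / d * z" for w d z :: real by simp
    show "angular_weight \<delta> (S l) * (\<Psi> l x + \<Psi> (n + 1 - l) x)
        = measure lborel (S l) / (1 - \<delta>) * ((\<integral>y. \<kappa> (\<nu> l) x y * \<phi> y \<partial>N) + g (\<nu> l) x)"
      unfolding angular_weight_def measure_angles[OF \<delta>] pair by (rule cancel)
  qed
  finally show "\<phi> x = (\<Sum>l\<in>{1..n div 2}. measure lborel (S l) / (1 - \<delta>) * ((\<integral>y. \<kappa> (\<nu> l) x y * \<phi> y \<partial>N) + g (\<nu> l) x))" .
qed

end

section \<open>Norm bounds and rates\<close>

text \<open>
  Jensen's inequality for the square root, followed by Fubini to reach the pointwise second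
  moments.
\<close>

lemma expected_weighted_L2:
  fixes e :: "'w \<Rightarrow> real \<Rightarrow> real" and w :: "real \<Rightarrow> real"
  assumes M: "prob_space M"
    and e: "(\<lambda>(\<xi>, x). e \<xi> x) \<in> borel_measurable (M \<Otimes>\<^sub>M lebesgue_on {a..c})"
    and eb: "\<And>\<xi> x. \<xi> \<in> space M \<Longrightarrow> x \<in> {a..c} \<Longrightarrow> \<bar>e \<xi> x\<bar> \<le> b"
    and w: "w \<in> borel_measurable (lebesgue_on {a..c})" "\<And>x. x \<in> {a..c} \<Longrightarrow> 0 \<le> w x \<and> w x \<le> W"
    and D: "\<And>x. x \<in> {a..c} \<Longrightarrow> (\<integral>\<xi>. (e \<xi> x)\<^sup>2 \<partial>M) \<le> D" and D0: "0 \<le> D" and ac: "a \<le> c"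
  shows "\<xi> \<in> space M \<Longrightarrow> L2_function a c w (e \<xi>)"
    and "integrable M (\<lambda>\<xi>. L2_norm a c w (e \<xi>))"
    and "(\<integral>\<xi>. L2_norm a c w (e \<xi>) \<partial>M) \<le> sqrt (D * W * (c - a))"
proof -
  let ?N = "lebesgue_on {a..c}"
  interpret M: prob_space M by fact
  interpret N: finite_measure ?N by (intro finite_measure_lebesgue_on) simp
  interpret MN: pair_sigma_finite M ?N ..
  interpret F: finite_measure "M \<Otimes>\<^sub>M ?N" by (rule finite_measure_pair_measure) unfold_locales
  note [measurable] = e w(1)
  have W0: "0 \<le> W" using w(2)[of a] ac by auto
  have vol: "measure ?N (space ?N) = c - a" using ac by (simp add: measure_restrict_space)
  define f where "f = (\<lambda>\<xi> x. e \<xi> x * e \<xi> x * w x)"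
  have fm[measurable]: "(\<lambda>(\<xi>, x). f \<xi> x) \<in> borel_measurable (M \<Otimes>\<^sub>M ?N)"
    unfolding f_def by measurable
  have fb: "0 \<le> f \<xi> x" "f \<xi> x \<le> b\<^sup>2 * W" if "\<xi> \<in> space M" "x \<in> {a..c}" for \<xi> x
  proof -
    show "0 \<le> f \<xi> x" using w(2)[OF that(2)] by (simp add: f_def)
    have "(e \<xi> x)\<^sup>2 \<le> b\<^sup>2" using power_mono[OF eb[OF that], of 2] by simp
    then show "f \<xi> x \<le> b\<^sup>2 * W"
      unfolding f_def power2_eq_square[symmetric] using w(2)[OF that(2)] by (intro mult_mono) auto
  qed
  have fi: "integrable (M \<Otimes>\<^sub>M ?N) (\<lambda>(\<xi>, x). f \<xi> x)"
    by (rule F.integrable_const_bound[of _ "b\<^sup>2 * W"]) (use fb in \<open>auto simp: space_pair_measure intro!: AE_I2\<close>)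
  show "L2_function a c w (e \<xi>)" if \<xi>: "\<xi> \<in> space M"
    unfolding L2_function_def
  proof
    note [measurable] = \<xi>
    show "e \<xi> \<in> borel_measurable ?N" by measurable
    have "f \<xi> \<in> borel_measurable ?N" by measurable
    then have "integrable ?N (f \<xi>)"
      by (intro N.integrable_const_bound[of _ "b\<^sup>2 * W"]) (use fb[OF \<xi>] in \<open>auto intro!: AE_I2\<close>)
    then show "integrable ?N (\<lambda>x. e \<xi> x * e \<xi> x * w x)" by (simp add: f_def)
  qed
  let ?Y = "\<lambda>\<xi>. L2_norm a c w (e \<xi>)" and ?E = "\<lambda>\<xi>. \<integral>x. f \<xi> x \<partial>?N"
  have Y: "?Y \<xi> = sqrt (?E \<xi>)" for \<xi> by (simp add: L2_norm_def f_def)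
  have E0: "0 \<le> ?E \<xi>" if "\<xi> \<in> space M" for \<xi>
    using fb[OF that] by (intro Bochner_Integration.integral_nonneg_AE AE_I2) auto
  have Ei: "integrable M ?E" using MN.integrable_fst'[OF fi] by simp
  have Y2: "(?Y \<xi>)\<^sup>2 = ?E \<xi>" if "\<xi> \<in> space M" for \<xi> using E0[OF that] by (simp add: Y)
  have Ym: "?Y \<in> borel_measurable M" unfolding Y by measurable
  have Y2i: "integrable M (\<lambda>\<xi>. (?Y \<xi>)\<^sup>2)"
    using Ei by (subst Bochner_Integration.integrable_cong[OF refl Y2]) auto
  show Yi: "integrable M ?Y"
  proof (rule Bochner_Integration.integrable_bound[OF _ Ym])
    show "integrable M (\<lambda>\<xi>. 1 + (?Y \<xi>)\<^sup>2)" using Y2i by simp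
    show "AE \<xi> in M. norm (?Y \<xi>) \<le> norm (1 + (?Y \<xi>)\<^sup>2)"
    proof (rule AE_I2)
      fix \<xi>
      have "0 \<le> (\<bar>?Y \<xi>\<bar> - 1)\<^sup>2" by simp
      then have "2 * \<bar>?Y \<xi>\<bar> \<le> 1 + (?Y \<xi>)\<^sup>2" by (simp add: power2_diff)
      then show "norm (?Y \<xi>) \<le> norm (1 + (?Y \<xi>)\<^sup>2)" by simp
    qed
  qed
  have "M.expectation ?Y ^ 2 \<le> M.expectation (\<lambda>\<xi>. (?Y \<xi>)\<^sup>2)"
    using M.square_integral_le[OF Yi Y2i] by (simp add: M.prob_space)
  also have "\<dots> = M.expectation ?E"
    by (rule Bochner_Integration.integral_cong[OF refl Y2])
  also have "\<dots> = (\<integral>x. M.expectation (\<lambda>\<xi>. f \<xi> x) \<partial>?N)"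
    using MN.Fubini_integral[OF fi] by simp
  also have "\<dots> \<le> (\<integral>x. D * W \<partial>?N)"
  proof (rule integral_mono)
    show "integrable ?N (\<lambda>x. M.expectation (\<lambda>\<xi>. f \<xi> x))" using MN.integrable_snd[OF fi] by simp
    fix x assume "x \<in> space ?N"
    then have x: "x \<in> {a..c}" by simp
    have "M.expectation (\<lambda>\<xi>. f \<xi> x) = M.expectation (\<lambda>\<xi>. (e \<xi> x)\<^sup>2) * w x"
      by (simp add: f_def power2_eq_square)
    also have "\<dots> \<le> D * W" using D[OF x] w(2)[OF x] D0 by (intro mult_mono) auto
    finally show "M.expectation (\<lambda>\<xi>. f \<xi> x) \<le> D * W" .
  qed simp
  also have "\<dots> = D * W * (c - a)" using vol by simp
  finally show "M.expectation ?Y \<le> sqrt (D * W * (c - a))" by (rule real_le_rsqrt)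
qed

lemma weighted_L2_norm_le:
  fixes f w :: "real \<Rightarrow> real"
  assumes f: "f \<in> borel_measurable (lebesgue_on {a..c})" "\<And>x. x \<in> {a..c} \<Longrightarrow> \<bar>f x\<bar> \<le> b"
    and w: "w \<in> borel_measurable (lebesgue_on {a..c})" "\<And>x. x \<in> {a..c} \<Longrightarrow> 0 \<le> w x \<and> w x \<le> W" and ac: "a \<le> c"
  shows "L2_function a c w f" "L2_norm a c w f \<le> b * sqrt (W * (c - a))"
proof -
  let ?N = "lebesgue_on {a..c}"
  interpret N: finite_measure ?N by (intro finite_measure_lebesgue_on) simp
  note [measurable] = f(1) w(1)
  have vol: "measure ?N (space ?N) = c - a" using ac by (simp add: measure_restrict_space)
  have b0: "0 \<le> b" using f(2)[of a] ac by (auto intro: order_trans[OF abs_ge_zero])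
  have ff: "0 \<le> f x * f x * w x" "f x * f x * w x \<le> b\<^sup>2 * W" if "x \<in> {a..c}" for x
  proof -
    show "0 \<le> f x * f x * w x" using w(2)[OF that] by simp
    have "(f x)\<^sup>2 \<le> b\<^sup>2" using power_mono[OF f(2)[OF that], of 2] by simp
    then show "f x * f x * w x \<le> b\<^sup>2 * W"
      unfolding power2_eq_square[symmetric] using w(2)[OF that] by (intro mult_mono) auto
  qed
  have i: "integrable ?N (\<lambda>x. f x * f x * w x)"
    by (rule N.integrable_const_bound[of _ "b\<^sup>2 * W"]) (use ff in \<open>auto intro!: AE_I2\<close>)
  then show "L2_function a c w f" using f by (simp add: L2_function_def)
  have "(\<integral>x. f x * f x * w x \<partial>?N) \<le> (\<integral>x. b\<^sup>2 * W \<partial>?N)"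
    by (rule integral_mono) (use i ff in auto)
  then have "L2_norm a c w f \<le> sqrt (b\<^sup>2 * (W * (c - a)))"
    unfolding L2_norm_def using vol by (simp add: mult_ac)
  then show "L2_norm a c w f \<le> b * sqrt (W * (c - a))"
    using b0 by (simp add: real_sqrt_mult)
qed

context slab begin

text \<open>
  The reference point is chosen different from \<open>-1\<close>, where the inflow data may jump; this is possible
  since a cell has positive length. A uniform ordinate avoids \<open>-1\<close> almost surely, and two points of an
  interval are at most its length apart.
\<close>

lemma cell_sampling:
  assumes part: "angular_partition \<delta> n S" and ro: "random_ordinates n S M \<mu>" and l: "l \<in> {1..n div 2}"
  obtains c where "c \<in> S l" "c \<in> {-1<..<-\<delta>}" "emeasure lborel (S l) \<noteq> 0" "emeasure lborel (S l) \<noteq> \<infinity>"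
    "AE \<xi> in M. \<mu> l \<xi> \<in> {-1<..<-\<delta>} \<and> \<bar>\<mu> l \<xi> - c\<bar> \<le> measure lborel (S l)"
proof -
  interpret M: prob_space M using ro by (simp add: random_ordinates_def)
  note cell = partition_cell[OF part l]
  have X: "\<mu> l \<in> borel_measurable M"
    using ro l by (auto simp: random_ordinates_def M.indep_vars_def)
  have d: "distr M borel (\<mu> l) = uniform_measure lborel (S l)" and S: "\<And>\<xi>. \<xi> \<in> space M \<Longrightarrow> \<mu> l \<xi> \<in> S l"
    using ro l by (auto simp: random_ordinates_def)
  interpret D: prob_space "uniform_measure lborel (S l)"
    unfolding d[symmetric] by (rule M.prob_space_distr[OF X])
  have e0: "emeasure lborel (S l) \<noteq> 0"
  proof
    assume "emeasure lborel (S l) = 0"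
    moreover have "emeasure lborel (S l \<inter> UNIV) / emeasure lborel (S l) = 1"
      using D.emeasure_space_1 cell(1) by simp
    ultimately show False by simp
  qed
  have "emeasure lborel (S l) \<le> emeasure lborel {-1..<-\<delta>}" using cell by (intro emeasure_mono) auto
  then have eI: "emeasure lborel (S l) \<noteq> \<infinity>" using \<delta> by (auto simp: top_unique)
  have "\<not> S l \<subseteq> {-1}"
  proof
    assume "S l \<subseteq> {-1}"
    then have "emeasure lborel (S l) \<le> emeasure lborel {-1::real}" by (intro emeasure_mono) auto
    then show False using e0 by simp
  qed
  then obtain c where c: "c \<in> S l" "c \<noteq> -1" by auto
  then have cJ: "c \<in> {-1<..<-\<delta>}" using cell(2) by force
  have "AE t in lborel. t \<noteq> (-1::real)" by (rule AE_lborel_singleton)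
  then have "AE t in uniform_measure lborel (S l). t \<noteq> -1"
    using cell(1) by (intro AE_uniform_measureI) auto
  then have ne: "AE \<xi> in M. \<mu> l \<xi> \<noteq> -1"
    unfolding d[symmetric] using X by (subst (asm) AE_distr_iff) auto
  have "AE \<xi> in M. \<mu> l \<xi> \<in> {-1<..<-\<delta>} \<and> \<bar>\<mu> l \<xi> - c\<bar> \<le> measure lborel (S l)"
    using ne AE_space
  proof eventually_elim
    case (elim \<xi>)
    let ?a = "min (\<mu> l \<xi>) c" and ?b = "max (\<mu> l \<xi>) c"
    have "\<mu> l \<xi> \<in> S l" using S elim by simp
    then have ab: "?a \<in> S l" "?b \<in> S l" using c(1) by (simp_all add: min_def max_def)
    have "{?a..?b} \<subseteq> S l"
    proof
      fix t assume "t \<in> {?a..?b}"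
      then show "t \<in> S l"
        using cell(3)[unfolded is_interval_1, rule_format, OF ab, of t] by simp
    qed
    then have "measure lborel {?a..?b} \<le> measure lborel (S l)"
      using cell(1) eI by (intro measure_mono_fmeasurable) (auto simp: fmeasurable_def less_top)
    moreover have "measure lborel {?a..?b} = \<bar>\<mu> l \<xi> - c\<bar>" by (auto simp: min_def max_def)
    moreover have "\<mu> l \<xi> \<in> {-1<..<-\<delta>}" using \<open>\<mu> l \<xi> \<in> S l\<close> cell(2) elim by force
    ultimately show ?case by simp
  qed
  then show thesis using that c cJ e0 eI by blast
qed

text \<open>
  The sum of the constants of \<open>mean_square_error\<close> and \<open>bias_bound\<close>, times the constant by which \<open>K ^ 4 / n ^ 3\<close>
  bounds the variance proxy. Its independence of \<open>n\<close> and of the partition is the point of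
  naming it.
\<close>

definition error_constant :: "real \<Rightarrow> real \<Rightarrow> real" where
  "error_constant b Lg =
     (let V = measure N (space N); H = V * b + 1; K0 = 1 / \<delta> * BS / 2; L\<kappa> = (1 + \<tau> xR / \<delta>) / \<delta>\<^sup>2 * BS / 2
      in (8 * H\<^sup>2 * (1 + (K0 / (1 - lam) * V)\<^sup>2) + \<bar>V * (2 * H / (1 - lam)) / (1 - lam)\<bar>) * (16 * (L\<kappa> + Lg)\<^sup>2))"

text \<open>
  Identifies the random ordinate density with the sampled fixed point for \<open>p l = \<bar>S l\<bar> / (1 - \<delta>)\<close> and
  \<open>\<eta> l = Lc \<bar>S l\<bar>\<close>. As the angular weights are at most \<open>K / n\<close>, every product \<open>p l * \<eta> l\<close> is at most
  \<open>4 Lc K\<^sup>2 / n\<^sup>2\<close>, and there are at most \<open>n\<close> cells.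
\<close>

lemma rom_pointwise_estimates:
  fixes M :: "'w measure" and S :: "nat \<Rightarrow> real set"
  assumes reg: "regularized_solution xL xR \<sigma>T \<sigma>r q lam \<delta> \<psi>L \<psi>R \<psi>" and \<sigma>r: "\<sigma>r = (\<lambda>x. \<sigma>S x / lam)"
    and \<phi>_def: "\<phi> = density_of \<delta> \<psi>"
    and G: "0 \<le> G" "0 \<le> Lg" "\<And>t x. t \<in> {-1..<-\<delta>} \<Longrightarrow> x \<in> space N \<Longrightarrow> \<bar>g t x\<bar> \<le> G"
      "\<And>t t' x. t \<in> {-1<..<-\<delta>} \<Longrightarrow> t' \<in> {-1<..<-\<delta>} \<Longrightarrow> x \<in> space N \<Longrightarrow> \<bar>g t x - g t' x\<bar> \<le> Lg * \<bar>t - t'\<bar>"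
    and b: "G / (1 - lam) \<le> b" "\<And>x. x \<in> {xL..xR} \<Longrightarrow> \<bar>\<phi> x\<bar> \<le> b"
    and n: "even n" "0 < n" and part: "angular_partition \<delta> n S" and ro: "random_ordinates n S M \<mu>"
    and K: "\<And>l. l \<in> {1..n} \<Longrightarrow> real n * angular_weight \<delta> (S l) \<le> K"
    and rom: "\<And>\<xi>. \<xi> \<in> space M \<Longrightarrow> rom_solution xL xR \<sigma>T \<sigma>r q lam \<delta> \<psi>L \<psi>R n S (\<lambda>l. \<mu> l \<xi>) (\<Psi> \<xi>)"
  shows "(\<lambda>(\<xi>, x). rom_density \<delta> n S (\<Psi> \<xi>) x) \<in> borel_measurable (M \<Otimes>\<^sub>M N)"
    and "\<And>\<xi> x. \<xi> \<in> space M \<Longrightarrow> x \<in> {xL..xR} \<Longrightarrow> \<bar>rom_density \<delta> n S (\<Psi> \<xi>) x\<bar> \<le> b"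
    and "\<And>x. x \<in> {xL..xR} \<Longrightarrow>
      (\<integral>\<xi>. (rom_density \<delta> n S (\<Psi> \<xi>) x - \<phi> x)\<^sup>2 \<partial>M) \<le> error_constant b Lg * K ^ 4 / real n ^ 3"
    and "\<And>x. x \<in> {xL..xR} \<Longrightarrow>
      \<bar>(\<integral>\<xi>. rom_density \<delta> n S (\<Psi> \<xi>) x \<partial>M) - \<phi> x\<bar> \<le> error_constant b Lg * K ^ 4 / real n ^ 3"
proof -
  define K0 where "K0 = 1 / \<delta> * BS / 2"
  define L\<kappa> where "L\<kappa> = (1 + \<tau> xR / \<delta>) / \<delta>\<^sup>2 * BS / 2"
  have BS0: "0 \<le> BS" using \<sigma>S(1) \<sigma>S(2)[of xL] xLR by auto
  have L\<kappa>: "0 \<le> L\<kappa>" using BS0 \<tau>_bounds[of xR] xLR \<delta> unfolding L\<kappa>_def by auto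
  define Lc where "Lc = L\<kappa> + Lg"
  have Lc: "0 \<le> Lc" using L\<kappa> G(2) by (simp add: Lc_def)
  define H where "H = measure N (space N) * b + 1"
  define C1 where "C1 = 8 * H\<^sup>2 * (1 + (K0 / (1 - lam) * measure N (space N))\<^sup>2)"
  define C2 where "C2 = measure N (space N) * (2 * H / (1 - lam)) / (1 - lam)"
  define C where C_eq: "C = error_constant b Lg"
  have C_def: "C = (C1 + \<bar>C2\<bar>) * (16 * Lc\<^sup>2)"
    unfolding C_eq error_constant_def Let_def C1_def C2_def Lc_def L\<kappa>_def K0_def H_def ..
  have C1: "0 \<le> C1" by (simp add: C1_def)
  define I where "I = {1..n div 2}"
  let ?J = "{-1..<-\<delta>}"
  interpret M: prob_space M using ro by (simp add: random_ordinates_def)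
  note cell = partition_cell[OF part, folded I_def]
  have X: "\<And>l. l \<in> I \<Longrightarrow> \<mu> l \<in> borel_measurable M"
    using ro by (auto simp: random_ordinates_def M.indep_vars_def I_def)
  have ord: "\<mu> l \<xi> \<in> S l \<and> \<mu> (n + 1 - l) \<xi> = - \<mu> l \<xi>" if "\<xi> \<in> space M" "l \<in> I" for \<xi> l
    using ro that by (auto simp: random_ordinates_def I_def)
  define p where "p = (\<lambda>l. measure lborel (S l) / (1 - \<delta>))"
  define \<eta> where "\<eta> = (\<lambda>l. Lc * measure lborel (S l))"
  have "\<forall>l\<in>I. \<exists>c. c \<in> S l \<and> c \<in> {-1<..<-\<delta>} \<and> emeasure lborel (S l) \<noteq> 0 \<and> emeasure lborel (S l) \<noteq> \<infinity> \<and>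
      (AE \<xi> in M. \<mu> l \<xi> \<in> {-1<..<-\<delta>} \<and> \<bar>\<mu> l \<xi> - c\<bar> \<le> measure lborel (S l))"
  proof
    fix l assume l: "l \<in> I"
    obtain c where "c \<in> S l" "c \<in> {-1<..<-\<delta>}" "emeasure lborel (S l) \<noteq> 0" "emeasure lborel (S l) \<noteq> \<infinity>"
      "AE \<xi> in M. \<mu> l \<xi> \<in> {-1<..<-\<delta>} \<and> \<bar>\<mu> l \<xi> - c\<bar> \<le> measure lborel (S l)"
      by (rule cell_sampling[OF part ro l[unfolded I_def]])
    then show "\<exists>c. c \<in> S l \<and> c \<in> {-1<..<-\<delta>} \<and> emeasure lborel (S l) \<noteq> 0 \<and> emeasure lborel (S l) \<noteq> \<infinity> \<and>
      (AE \<xi> in M. \<mu> l \<xi> \<in> {-1<..<-\<delta>} \<and> \<bar>\<mu> l \<xi> - c\<bar> \<le> measure lborel (S l))"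
      by (intro exI[of _ c] conjI)
  qed
  from bchoice[OF this] obtain c where c: "\<And>l. l \<in> I \<Longrightarrow> c l \<in> S l \<and> c l \<in> {-1<..<-\<delta>} \<and> emeasure lborel (S l) \<noteq> 0 \<and> emeasure lborel (S l) \<noteq> \<infinity> \<and>
      (AE \<xi> in M. \<mu> l \<xi> \<in> {-1<..<-\<delta>} \<and> \<bar>\<mu> l \<xi> - c l\<bar> \<le> measure lborel (S l))"
    by fast
  have disj: "disjoint_family_on S I" and un: "(\<Union>l\<in>I. S l) = ?J"
    using part unfolding angular_partition_def I_def by blast+
  have p_sum: "sum p I = 1"
  proof -
    have "(\<Sum>l\<in>I. measure lborel (S l)) = measure lborel (\<Union>l\<in>I. S l)"
      using cell(1) c disj by (intro measure_finite_Union[symmetric]) (auto simp: I_def)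
    then show ?thesis using \<delta> unfolding p_def un sum_divide_distrib[symmetric] by simp
  qed
  have \<phi>_eq: "\<phi> x = (\<Sum>l\<in>I. p l * (\<integral>\<xi>. (\<integral>y. \<kappa> (\<mu> l \<xi>) x y * \<phi> y \<partial>N) + g (\<mu> l \<xi>) x \<partial>M))" if "x \<in> space N" for x
  proof -
    have x: "x \<in> {xL..xR}" using that by simp
    let ?F = "\<lambda>t. (\<integral>y. \<kappa> t x y * \<phi> y \<partial>N) + g t x"
    note E = regularized_density_equation[OF reg \<sigma>r x, folded \<phi>_def]
    have [measurable]: "x \<in> space N" "\<phi> \<in> borel_measurable N"
      using that regularized_density_measurable[OF reg \<sigma>r] by (simp_all add: \<phi>_def)
    have [measurable]: "(\<lambda>(t, y). \<kappa> t x y) \<in> borel_measurable (borel \<Otimes>\<^sub>M N)"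
      unfolding \<kappa>_def by measurable
    have [measurable]: "(\<lambda>t. g t x) \<in> borel_measurable borel"
      unfolding g_def by measurable
    have Fm: "?F \<in> borel_measurable borel" by measurable
    have pE: "p l * (\<integral>\<xi>. ?F (\<mu> l \<xi>) \<partial>M) = (LINT t:S l|lborel. ?F t) / (1 - \<delta>)" if l: "l \<in> I" for l
    proof -
      have d: "distr M borel (\<mu> l) = uniform_measure lborel (S l)" using ro l by (auto simp: random_ordinates_def I_def)
      have "(\<integral>\<xi>. ?F (\<mu> l \<xi>) \<partial>M) = (LINT t:S l|lborel. ?F t) / measure lborel (S l)"
        using c[OF l] by (intro expectation_uniform[OF X[OF l] d cell(1)[OF l] _ _ Fm]) auto
      moreover have "measure lborel (S l) \<noteq> 0"
        using c[OF l] by (simp add: measure_def enn2real_eq_0_iff)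
      ultimately show ?thesis by (simp add: p_def)
    qed
    have "\<phi> x = (LINT t:(\<Union>l\<in>I. S l)|lborel. ?F t) / (1 - \<delta>)" using E unfolding un by simp
    also have "(LINT t:(\<Union>l\<in>I. S l)|lborel. ?F t) = (\<Sum>l\<in>I. LINT t:S l|lborel. ?F t)"
    proof (rule set_integral_finite_Union[OF _ disj])
      fix l assume l: "l \<in> I"
      show "S l \<in> sets lborel" using cell(1)[OF l] by simp
      then show "set_integrable lborel (S l) ?F"
        using cell(2)[OF l] by (rule set_integrable_subset[OF E[THEN conjunct1]])
    qed (simp add: I_def)
    finally show ?thesis using pE by (simp add: sum_divide_distrib)
  qed
  interpret st: stratified_sampling N M I \<mu> p \<kappa> g ?J lam K0 G b c \<eta> \<phi>
  proof
    show "finite I" unfolding I_def by simp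
    show "sum p I = 1" "0 \<le> lam" "lam < 1" "0 \<le> G" "G / (1 - lam) \<le> b"
      using p_sum lam G(1) b(1) by auto
    show "(\<lambda>(t, x, y). \<kappa> t x y) \<in> borel_measurable (borel \<Otimes>\<^sub>M N \<Otimes>\<^sub>M N)" by (rule \<kappa>_measurable)
    show "(\<lambda>(t, x). g t x) \<in> borel_measurable (borel \<Otimes>\<^sub>M N)" by (rule g_measurable)
    show "M.indep_vars (\<lambda>_. borel) \<mu> I" using ro by (simp add: random_ordinates_def I_def)
    show "\<phi> \<in> borel_measurable N" unfolding \<phi>_def by (rule regularized_density_measurable[OF reg \<sigma>r])
    show "\<bar>\<phi> x\<bar> \<le> b" if "x \<in> space N" for x using b(2)[of x] that by simp
  next
    fix l assume l: "l \<in> I"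
    show "0 \<le> p l" using \<delta> by (simp add: p_def)
    show "0 \<le> \<eta> l" using Lc by (simp add: \<eta>_def)
    show "c l \<in> ?J" using c[OF l] by auto
    show "\<mu> l \<xi> \<in> ?J" if "\<xi> \<in> space M" for \<xi> using ord[OF that l] cell(2)[OF l] by auto
    have "AE \<xi> in M. \<mu> l \<xi> \<in> {-1<..<-\<delta>} \<and> \<bar>\<mu> l \<xi> - c l\<bar> \<le> measure lborel (S l)" using c[OF l] by blast
    then show "AE \<xi> in M. \<forall>x\<in>space N. \<bar>g (\<mu> l \<xi>) x - g (c l) x\<bar> \<le> \<eta> l \<and> (\<forall>y\<in>space N. \<bar>\<kappa> (\<mu> l \<xi>) x y - \<kappa> (c l) x y\<bar> \<le> \<eta> l)"
    proof eventually_elim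
      case (elim \<xi>)
      have cl: "c l \<in> {-1<..<-\<delta>}" using c[OF l] by blast
      have le: "u * \<bar>\<mu> l \<xi> - c l\<bar> \<le> \<eta> l" if "0 \<le> u" "u \<le> Lc" for u
        unfolding \<eta>_def using elim that by (intro mult_mono) auto
      show ?case
      proof (intro ballI conjI)
        fix x assume x: "x \<in> space N"
        show "\<bar>g (\<mu> l \<xi>) x - g (c l) x\<bar> \<le> \<eta> l"
          using G(4)[OF _ cl x, of "\<mu> l \<xi>"] elim le[of Lg] G(2) L\<kappa> by (auto simp: Lc_def)
        fix y assume y: "y \<in> space N"
        have "\<mu> l \<xi> \<in> ?J" "c l \<in> ?J" using elim cl by auto
        from \<kappa>_lipschitz[OF this x y, folded L\<kappa>_def]
        show "\<bar>\<kappa> (\<mu> l \<xi>) x y - \<kappa> (c l) x y\<bar> \<le> \<eta> l"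
          using le[of L\<kappa>] G(2) L\<kappa> by (auto simp: Lc_def)
      qed
    qed
  next
    fix t x assume tx: "t \<in> ?J" "x \<in> space N"
    then show "(\<integral>y. \<kappa> t x y \<partial>N) \<le> lam" "\<bar>g t x\<bar> \<le> G" using \<kappa>_mass G(3) by auto
    fix y assume "y \<in> space N"
    with tx show "0 \<le> \<kappa> t x y \<and> \<kappa> t x y \<le> K0" unfolding K0_def by (rule \<kappa>_bounds)
  next
    show "\<And>x. x \<in> space N \<Longrightarrow> \<phi> x = (\<Sum>l\<in>I. p l * (\<integral>\<xi>. (\<integral>y. \<kappa> (\<mu> l \<xi>) x y * \<phi> y \<partial>N) + g (\<mu> l \<xi>) x \<partial>M))"
      by (rule \<phi>_eq)
  qed
  have rom_eq: "rom_density \<delta> n S (\<Psi> \<xi>) x = st.sampled \<xi> x" if \<xi>: "\<xi> \<in> space M" and x: "x \<in> space N" for \<xi> x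
  proof -
    let ?r = "rom_density \<delta> n S (\<Psi> \<xi>)"
    note ad = st.mixed_admissible[OF st.ordinates_in_T[OF \<xi>]]
    note R = rom_density_equation[OF part n(1) ord[OF \<xi>, unfolded I_def] rom[OF \<xi>] \<sigma>r, folded I_def]
    obtain b' where "\<forall>x\<in>{xL..xR}. \<bar>?r x\<bar> \<le> b'" using R(2) by blast
    then have b': "\<And>x. x \<in> space N \<Longrightarrow> \<bar>?r x\<bar> \<le> b'" by simp
    show ?thesis
      unfolding st.sampled_def
    proof (rule st.mix.solution_unique[OF ad R(1) b' _ x])
      fix z assume z: "z \<in> space N"
      have o: "st.ordinates \<xi> l = \<mu> l \<xi>" if "l \<in> I" for l unfolding st.ordinates_def using that by simp
      have "(\<integral>y. st.mixed_kernel (st.ordinates \<xi>) z y * ?r y \<partial>N) = (\<integral>y. (\<Sum>l\<in>I. p l * (\<kappa> (\<mu> l \<xi>) z y * ?r y)) \<partial>N)"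
        unfolding st.mixed_kernel_def by (simp add: o sum_distrib_right mult.assoc)
      also have "\<dots> = (\<Sum>l\<in>I. p l * (\<integral>y. \<kappa> (\<mu> l \<xi>) z y * ?r y \<partial>N))"
        using st.\<kappa>_integrable[OF st.X_T[OF _ \<xi>] z R(1) b'] by simp
      finally show "?r z = (\<integral>y. st.mixed_kernel (st.ordinates \<xi>) z y * ?r y \<partial>N) + st.mixed_source (st.ordinates \<xi>) z"
        using R(3)[of z] z unfolding st.mixed_source_def by (simp add: o p_def distrib_left sum.distrib)
    qed
  qed
  have V: "st.variance_proxy \<le> 16 * Lc\<^sup>2 * K ^ 4 / real n ^ 3"
  proof -
    have K0: "0 \<le> K"
    proof -
      have "0 \<le> real n * angular_weight \<delta> (S 1)" by (simp add: angular_weight_def)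
      also have "\<dots> \<le> K" using n by (intro K) auto
      finally show ?thesis .
    qed
    have "(p l * \<eta> l)\<^sup>2 \<le> 16 * Lc\<^sup>2 * K ^ 4 / real n ^ 4" if l: "l \<in> I" for l
    proof -
      have "real n * (measure lborel (S l) / (2 * (1 - \<delta>))) \<le> K"
      proof -
        have "l \<in> {1..n}" using l unfolding I_def by auto
        from K[OF this] show ?thesis by (simp add: angular_weight_def measure_angles[OF \<delta>])
      qed
      then have m: "measure lborel (S l) \<le> 2 * (1 - \<delta>) * K / real n" using n \<delta> by (simp add: field_simps)
      have p: "p l \<le> 2 * K / real n"
      proof -
        have eq: "2 * (1 - \<delta>) * K / real n = 2 * K / real n * (1 - \<delta>)" and pos: "0 < 1 - \<delta>"
          using \<delta> by simp_all
        show ?thesis using m unfolding p_def eq pos_divide_le_eq[OF pos] .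
      qed
      have "2 * (1 - \<delta>) * K / real n \<le> 2 * K / real n"
        using \<delta> K0 by (intro divide_right_mono mult_right_mono) auto
      then have "\<eta> l \<le> Lc * (2 * K / real n)"
        unfolding \<eta>_def using m Lc by (intro mult_left_mono) auto
      then have "p l * \<eta> l \<le> (2 * K / real n) * (Lc * (2 * K / real n))"
        using p Lc K0 by (intro mult_mono) (auto simp: \<eta>_def)
      then have "(p l * \<eta> l)\<^sup>2 \<le> ((2 * K / real n) * (Lc * (2 * K / real n)))\<^sup>2"
        using \<delta> Lc by (intro power_mono) (auto simp: p_def \<eta>_def)
      also have "\<dots> = 16 * Lc\<^sup>2 * K ^ 4 / real n ^ 4"
        by (simp add: power2_eq_square power4_eq_xxxx mult_ac)
      finally show ?thesis .
    qed
    then have "st.variance_proxy \<le> (\<Sum>l\<in>I. 16 * Lc\<^sup>2 * K ^ 4 / real n ^ 4)"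
      unfolding st.variance_proxy_def by (rule sum_mono)
    also have "\<dots> = real (n div 2) * (16 * Lc\<^sup>2 * K ^ 4 / real n ^ 4)" by (simp add: I_def)
    also have "\<dots> \<le> real n * (16 * Lc\<^sup>2 * K ^ 4 / real n ^ 4)"
      by (intro mult_right_mono) auto
    also have "\<dots> = 16 * Lc\<^sup>2 * K ^ 4 / real n ^ 3"
      using n by (simp add: power4_eq_xxxx power3_eq_cube)
    finally show ?thesis .
  qed
  have V0: "0 \<le> st.variance_proxy" unfolding st.variance_proxy_def by (simp add: sum_nonneg)
  have scale: "a * st.variance_proxy \<le> C * K ^ 4 / real n ^ 3" if "a \<le> C1 + \<bar>C2\<bar>" for a
  proof -
    have "a * st.variance_proxy \<le> (C1 + \<bar>C2\<bar>) * (16 * Lc\<^sup>2 * K ^ 4 / real n ^ 3)"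
      using that V V0 C1 by (intro mult_mono) auto
    then show ?thesis by (simp add: C_def mult_ac)
  qed
  have Heq: "st.H = H" by (simp add: st.H_def H_def)
  show "(\<lambda>(\<xi>, x). rom_density \<delta> n S (\<Psi> \<xi>) x) \<in> borel_measurable (M \<Otimes>\<^sub>M N)"
  proof -
    have "(\<lambda>(\<xi>, x). st.sampled \<xi> x) \<in> borel_measurable (M \<Otimes>\<^sub>M N)" by measurable
    then show ?thesis
      by (rule iffD2[OF measurable_cong, rotated]) (auto simp: space_pair_measure rom_eq)
  qed
  show "\<bar>rom_density \<delta> n S (\<Psi> \<xi>) x\<bar> \<le> b" if \<xi>: "\<xi> \<in> space M" and "x \<in> {xL..xR}" for \<xi> x
  proof -
    have x: "x \<in> space N" using that by simp
    show ?thesis unfolding rom_eq[OF \<xi> x] by (rule st.sampled_bound[OF \<xi> x])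
  qed
  fix x assume "x \<in> {xL..xR}"
  then have x: "x \<in> space N" by simp
  have "(\<integral>\<xi>. (rom_density \<delta> n S (\<Psi> \<xi>) x - \<phi> x)\<^sup>2 \<partial>M) = (\<integral>\<xi>. (st.sampled \<xi> x - \<phi> x)\<^sup>2 \<partial>M)"
    by (rule Bochner_Integration.integral_cong[OF refl]) (simp add: rom_eq[OF _ x])
  also have "\<dots> \<le> C1 * st.variance_proxy"
    using st.mean_square_error(2)[OF x] unfolding C1_def Heq .
  also have "\<dots> \<le> C * K ^ 4 / real n ^ 3" by (rule scale) simp
  finally show "(\<integral>\<xi>. (rom_density \<delta> n S (\<Psi> \<xi>) x - \<phi> x)\<^sup>2 \<partial>M) \<le> error_constant b Lg * K ^ 4 / real n ^ 3"
    unfolding C_eq[symmetric] .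
  have "(\<integral>\<xi>. rom_density \<delta> n S (\<Psi> \<xi>) x \<partial>M) = (\<integral>\<xi>. st.sampled \<xi> x \<partial>M)"
    by (rule Bochner_Integration.integral_cong[OF refl]) (simp add: rom_eq[OF _ x])
  then have "\<bar>(\<integral>\<xi>. rom_density \<delta> n S (\<Psi> \<xi>) x \<partial>M) - \<phi> x\<bar> \<le> C2 * st.variance_proxy"
    using st.bias_bound[OF x] unfolding C2_def Heq by (simp add: mult_ac)
  also have "\<dots> \<le> C * K ^ 4 / real n ^ 3" by (rule scale) (use C1 in linarith)
  finally show "\<bar>(\<integral>\<xi>. rom_density \<delta> n S (\<Psi> \<xi>) x \<partial>M) - \<phi> x\<bar> \<le> error_constant b Lg * K ^ 4 / real n ^ 3"
    unfolding C_eq[symmetric] .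
qed

lemma error_constant_nonneg: "0 \<le> error_constant b Lg"
  unfolding error_constant_def Let_def by (intro mult_nonneg_nonneg add_nonneg_nonneg) auto

end

lemma le_mult_of_one_le: "0 \<le> a \<Longrightarrow> 1 \<le> b \<Longrightarrow> a \<le> a * (b::real)"
  using mult_left_mono[of 1 b a] by simp

text \<open>
  An infinite essential supremum is turned into zero by the conversion to the reals, so a positive value is
  the genuine one.
\<close>

lemma Linf_norm_AE_le:
  assumes "lam = Linf_norm a b f" "0 < lam"
  shows "AE x in lebesgue_on {a..b}. \<bar>f x\<bar> \<le> lam"
proof -
  let ?e = "esssup (lebesgue_on {a..b}) (\<lambda>x. ereal \<bar>f x\<bar>)"
  have "?e = ereal lam"
    using assms by (cases ?e) (auto simp: Linf_norm_def)
  with esssup_AE[of "\<lambda>x. ereal \<bar>f x\<bar>" "lebesgue_on {a..b}"] show ?thesis by simp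
qed

theorem theorem3p1:
  fixes xL xR \<delta> lam :: real
    and \<sigma>S \<sigma>T \<sigma>r q \<psi>L \<psi>R :: "real \<Rightarrow> real"
    and \<psi> :: "real \<Rightarrow> real \<Rightarrow> real"
    and S :: "nat \<Rightarrow> nat \<Rightarrow> real set"
    and M :: "nat \<Rightarrow> 'w measure"
    and \<mu> :: "nat \<Rightarrow> nat \<Rightarrow> 'w \<Rightarrow> real"
    and \<Psi> :: "nat \<Rightarrow> 'w \<Rightarrow> nat \<Rightarrow> real \<Rightarrow> real"
    and \<phi> :: "real \<Rightarrow> real"
    and \<phi>\<^sub>\<xi> :: "nat \<Rightarrow> 'w \<Rightarrow> real \<Rightarrow> real"
  assumes "xL < xR"
    and "cross_section xL xR \<sigma>S" and "cross_section xL xR \<sigma>T"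
    and "\<forall>x\<in>{xL..xR}. \<sigma>S x \<le> \<sigma>T x"
    and "q \<in> borel_measurable (lebesgue_on {xL..xR})"
    and "\<exists>B. \<forall>x\<in>{xL..xR}. 0 \<le> q x \<and> q x \<le> B"
    and "lam = Linf_norm xL xR (\<lambda>x. \<sigma>S x / \<sigma>T x)" and "0 < lam" and "lam < 1"
    and "\<sigma>r = (\<lambda>x. \<sigma>S x / lam)"
    and "0 < \<delta>" and "\<delta> < 1"
    and "\<exists>L. L-lipschitz_on {0<..<1} \<psi>L"
    and "\<exists>L. L-lipschitz_on {-1<..<0} \<psi>R"
    and "regularized_solution xL xR \<sigma>T \<sigma>r q lam \<delta> \<psi>L \<psi>R \<psi>"
    and "\<phi> = density_of \<delta> \<psi>"
    and "\<And>n. even n \<Longrightarrow> 0 < n \<Longrightarrow> angular_partition \<delta> n (S n)"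
    and "\<And>n. even n \<Longrightarrow> 0 < n \<Longrightarrow> random_ordinates n (S n) (M n) (\<mu> n)"
    and "\<exists>K. \<forall>n>0. even n \<longrightarrow> (\<forall>l\<in>{1..n}. real n * angular_weight \<delta> (S n l) \<le> K)"
    and "\<And>n \<xi>. even n \<Longrightarrow> 0 < n \<Longrightarrow> \<xi> \<in> space (M n) \<Longrightarrow>
           rom_solution xL xR \<sigma>T \<sigma>r q lam \<delta> \<psi>L \<psi>R n (S n) (\<lambda>l. \<mu> n l \<xi>) (\<Psi> n \<xi>)"
    and "\<And>n \<xi>. \<phi>\<^sub>\<xi> n \<xi> = rom_density \<delta> n (S n) (\<Psi> n \<xi>)"
  shows "\<exists>n0>0. \<exists>C>0. \<forall>n>n0. even n \<longrightarrow>
           (\<forall>\<xi>\<in>space (M n). L2_function xL xR \<sigma>T (\<lambda>x. \<phi>\<^sub>\<xi> n \<xi> x - \<phi> x)) \<and>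
           integrable (M n) (\<lambda>\<xi>. L2_norm xL xR \<sigma>T (\<lambda>x. \<phi>\<^sub>\<xi> n \<xi> x - \<phi> x)) \<and>
           (LINT \<xi>|M n. L2_norm xL xR \<sigma>T (\<lambda>x. \<phi>\<^sub>\<xi> n \<xi> x - \<phi> x))
             \<le> C * real n powr (-3/2) * ln (real n) powr (1/2) \<and>
           (\<forall>x\<in>{xL..xR}. integrable (M n) (\<lambda>\<xi>. \<phi>\<^sub>\<xi> n \<xi> x)) \<and>
           L2_function xL xR \<sigma>T (\<lambda>x. (LINT \<xi>|M n. \<phi>\<^sub>\<xi> n \<xi> x) - \<phi> x) \<and>
           L2_norm xL xR \<sigma>T (\<lambda>x. (LINT \<xi>|M n. \<phi>\<^sub>\<xi> n \<xi> x) - \<phi> x)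
             \<le> C * lam * real n powr (-3) * ln (real n)"
proof -
  let ?N = "lebesgue_on {xL..xR}"
  obtain cS BS where S: "0 < cS" "\<And>x. x \<in> {xL..xR} \<Longrightarrow> cS \<le> \<sigma>S x \<and> \<sigma>S x \<le> BS"
    and Sm: "\<sigma>S \<in> borel_measurable ?N"
    using assms(2) unfolding cross_section_def by blast
  obtain cT BT where T: "0 < cT" "\<And>x. x \<in> {xL..xR} \<Longrightarrow> cT \<le> \<sigma>T x \<and> \<sigma>T x \<le> BT"
    and Tm: "\<sigma>T \<in> borel_measurable ?N"
    using assms(3) unfolding cross_section_def by blast
  have T0: "0 \<le> \<sigma>T x \<and> \<sigma>T x \<le> BT" if "x \<in> {xL..xR}" for x using T(1) T(2)[OF that] by linarith
  have BT0: "0 \<le> BT" using T0[of xL] \<open>xL < xR\<close> by auto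
  obtain Bq where q: "\<And>x. x \<in> {xL..xR} \<Longrightarrow> 0 \<le> q x \<and> q x \<le> Bq" using assms(6) by blast
  obtain L1 L2 where L1: "L1-lipschitz_on {0<..<1} \<psi>L" and L2: "L2-lipschitz_on {-1<..<0} \<psi>R"
    using assms(13,14) by blast
  obtain K where K: "\<And>n l. 0 < n \<Longrightarrow> even n \<Longrightarrow> l \<in> {1..n} \<Longrightarrow> real n * angular_weight \<delta> (S n l) \<le> K"
    using assms(19) by blast
  have ratio: "AE x in ?N. \<sigma>S x \<le> lam * \<sigma>T x"
    using Linf_norm_AE_le[OF assms(7) \<open>0 < lam\<close>] AE_space
  proof eventually_elim
    case (elim x)
    then have "0 < \<sigma>T x" using T(1) T(2)[of x] by auto
    then show ?case using elim by (simp add: abs_divide pos_divide_le_eq abs_le_iff)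
  qed
  have lipL: "(max L1 L2)-lipschitz_on {0<..<1} \<psi>L" by (rule lipschitz_on_mono[OF L1]) auto
  have lipR: "(max L1 L2)-lipschitz_on {-1<..<0} \<psi>R" by (rule lipschitz_on_mono[OF L2]) auto
  interpret slab xL xR \<delta> lam cS BS BT Bq "max L1 L2" \<sigma>S \<sigma>T q \<psi>L \<psi>R
  proof (rule slab.intro)
    show "xL < xR" "0 < \<delta>" "\<delta> < 1" "0 < lam" "lam < 1" "q \<in> borel_measurable ?N" by (rule assms)+
    show "\<sigma>S \<in> borel_measurable ?N" "\<sigma>T \<in> borel_measurable ?N" "0 < cS" by (rule Sm Tm S(1))+
    show "AE x in ?N. \<sigma>S x \<le> lam * \<sigma>T x" by (rule ratio)
    show "(max L1 L2)-lipschitz_on {0<..<1} \<psi>L" "(max L1 L2)-lipschitz_on {-1<..<0} \<psi>R" by (rule lipL lipR)+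
  next
    fix x assume x: "x \<in> {xL..xR}"
    show "cS \<le> \<sigma>S x \<and> \<sigma>S x \<le> BS" "0 \<le> \<sigma>T x \<and> \<sigma>T x \<le> BT" "0 \<le> q x \<and> q x \<le> Bq"
      by (rule S(2)[OF x] T0[OF x] q[OF x])+
  qed
  note reg = assms(15) and \<sigma>r = assms(10)
  obtain G Lg where G: "0 \<le> G" "0 \<le> Lg"
    "\<And>t x. t \<in> {-1..<-\<delta>} \<Longrightarrow> x \<in> space ?N \<Longrightarrow> \<bar>g t x\<bar> \<le> G"
    "\<And>t t' x. t \<in> {-1<..<-\<delta>} \<Longrightarrow> t' \<in> {-1<..<-\<delta>} \<Longrightarrow> x \<in> space ?N \<Longrightarrow> \<bar>g t x - g t' x\<bar> \<le> Lg * \<bar>t - t'\<bar>"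
    using source_regularity by blast
  obtain b0 where b0: "\<forall>x\<in>{xL..xR}. \<bar>\<phi> x\<bar> \<le> b0"
    using regularized_density_bounded[OF reg \<sigma>r] unfolding assms(16) by blast
  define b where "b = max b0 (G / (1 - lam))"
  have b: "G / (1 - lam) \<le> b" "\<And>x. x \<in> {xL..xR} \<Longrightarrow> \<bar>\<phi> x\<bar> \<le> b"
    using b0 by (auto simp: b_def intro: max.coboundedI1)
  define C where "C = error_constant b Lg"
  have C: "0 \<le> C" unfolding C_def by (rule error_constant_nonneg)
  have \<phi>m[measurable]: "\<phi> \<in> borel_measurable ?N"
    unfolding assms(16) by (rule regularized_density_measurable[OF reg \<sigma>r])
  define A where "A = C * K ^ 4"
  define w where "w = BT * (xR - xL)"
  have A0: "0 \<le> A" and w0: "0 \<le> w" using C BT0 \<open>xL < xR\<close> by (auto simp: A_def w_def)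
  \<comment> \<open>the bound on the bias carries a factor lam, so its constant is divided by lam\<close>
  define c where "c = sqrt (A * w) + A * sqrt w / lam + 1"
  have c1: "sqrt (A * w) \<le> c" "A * sqrt w \<le> c * lam" and c0: "0 < c"
  proof -
    have nn: "0 \<le> sqrt (A * w)" "0 \<le> A * sqrt w / lam" using A0 w0 \<open>0 < lam\<close> by auto
    then show "sqrt (A * w) \<le> c" "0 < c" unfolding c_def by linarith+
    have "A * sqrt w / lam \<le> c" using nn unfolding c_def by linarith
    then show "A * sqrt w \<le> c * lam" using \<open>0 < lam\<close> by (simp add: pos_divide_le_eq)
  qed
  show ?thesis
  proof (intro exI[of _ "2 :: nat"] exI[of _ c] conjI c0 allI impI ballI)
    fix n :: nat assume n: "2 < n" "even n"
    then have n0: "0 < n" by simp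
    interpret M: prob_space "M n" using assms(18)[OF n(2) n0] by (simp add: random_ordinates_def)
    note E = rom_pointwise_estimates[OF reg \<sigma>r assms(16) G b n(2) n0 assms(17)[OF n(2) n0] assms(18)[OF n(2) n0]
      K[OF n0 n(2)] assms(20)[OF n(2) n0], folded assms(21) C_def A_def]
    have m[measurable]: "(\<lambda>(\<xi>, x). \<phi>\<^sub>\<xi> n \<xi> x) \<in> borel_measurable (M n \<Otimes>\<^sub>M ?N)" by (rule E(1))
    have bd: "\<bar>\<phi>\<^sub>\<xi> n \<xi> x\<bar> \<le> b" if "\<xi> \<in> space (M n)" "x \<in> {xL..xR}" for \<xi> x
      by (rule E(2)) (assumption | rule that)+
    have ms: "(\<integral>\<xi>. (\<phi>\<^sub>\<xi> n \<xi> x - \<phi> x)\<^sup>2 \<partial>M n) \<le> A / real n ^ 3" if "x \<in> {xL..xR}" for x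
      by (rule E(3)) (assumption | rule that)+
    have bias: "\<bar>(\<integral>\<xi>. \<phi>\<^sub>\<xi> n \<xi> x \<partial>M n) - \<phi> x\<bar> \<le> A / real n ^ 3" if "x \<in> {xL..xR}" for x
      by (rule E(4)) (assumption | rule that)+
    have n3: "real n powr (-3) = 1 / real n ^ 3"
      using n0 by (simp add: powr_minus powr_numeral divide_inverse)
    have n32: "sqrt (1 / real n ^ 3) = real n powr (-3/2)"
    proof -
      have "sqrt (1 / real n ^ 3) = (real n powr (-3)) powr (1/2)"
        unfolding n3 by (rule powr_half_sqrt[symmetric]) simp
      then show ?thesis by (simp add: powr_powr)
    qed
    have ln1: "1 \<le> ln (real n)"
    proof -
      have "exp 1 \<le> real n" using exp_le n by linarith
      then show ?thesis using n0 by (simp add: ln_ge_iff)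
    qed
    have D0: "0 \<le> A / real n ^ 3" using A0 by simp
    have em: "(\<lambda>(\<xi>, x). \<phi>\<^sub>\<xi> n \<xi> x - \<phi> x) \<in> borel_measurable (M n \<Otimes>\<^sub>M ?N)" by measurable
    have eb: "\<bar>\<phi>\<^sub>\<xi> n \<xi> x - \<phi> x\<bar> \<le> 2 * b" if "\<xi> \<in> space (M n)" "x \<in> {xL..xR}" for \<xi> x
      using bd[OF that] b(2)[OF that(2)] by linarith
    note W = expected_weighted_L2[OF M.prob_space_axioms em eb Tm T0 ms D0 less_imp_le[OF \<open>xL < xR\<close>]]
    show "L2_function xL xR \<sigma>T (\<lambda>x. \<phi>\<^sub>\<xi> n \<xi> x - \<phi> x)" if "\<xi> \<in> space (M n)" for \<xi>
      using W(1) that by blast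
    show "integrable (M n) (\<lambda>\<xi>. L2_norm xL xR \<sigma>T (\<lambda>x. \<phi>\<^sub>\<xi> n \<xi> x - \<phi> x))" using W(2) by simp
    have "(LINT \<xi>|M n. L2_norm xL xR \<sigma>T (\<lambda>x. \<phi>\<^sub>\<xi> n \<xi> x - \<phi> x)) \<le> sqrt (A / real n ^ 3 * BT * (xR - xL))"
      using W(3) by simp
    also have "A / real n ^ 3 * BT * (xR - xL) = (A * w) * (1 / real n ^ 3)" by (simp add: w_def)
    also have "sqrt \<dots> = sqrt (A * w) * real n powr (-3/2)" by (simp only: real_sqrt_mult n32)
    also have "\<dots> \<le> c * real n powr (-3/2)" using c1 by (intro mult_right_mono) auto
    also have "\<dots> \<le> c * real n powr (-3/2) * ln (real n) powr (1/2)"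
      using ln1 c0 by (intro le_mult_of_one_le) (auto simp: ge_one_powr_ge_zero)
    finally show "(LINT \<xi>|M n. L2_norm xL xR \<sigma>T (\<lambda>x. \<phi>\<^sub>\<xi> n \<xi> x - \<phi> x)) \<le> c * real n powr (-3/2) * ln (real n) powr (1/2)" .
    show "integrable (M n) (\<lambda>\<xi>. \<phi>\<^sub>\<xi> n \<xi> x)" if x: "x \<in> {xL..xR}" for x
    proof (rule M.integrable_const_bound[of _ b])
      have [measurable]: "x \<in> space ?N" using x by simp
      show "(\<lambda>\<xi>. \<phi>\<^sub>\<xi> n \<xi> x) \<in> borel_measurable (M n)" by measurable
    qed (use bd[OF _ x] in \<open>auto intro!: AE_I2\<close>)
    have bm: "(\<lambda>x. (LINT \<xi>|M n. \<phi>\<^sub>\<xi> n \<xi> x) - \<phi> x) \<in> borel_measurable ?N"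
    proof -
      have [measurable]: "(\<lambda>(x, \<xi>). \<phi>\<^sub>\<xi> n \<xi> x) \<in> borel_measurable (?N \<Otimes>\<^sub>M M n)"
        using measurable_pair_swap[OF m] by (simp add: split_beta')
      show ?thesis by measurable
    qed
    note B = weighted_L2_norm_le[OF bm bias Tm T0 less_imp_le[OF \<open>xL < xR\<close>], folded w_def]
    show "L2_function xL xR \<sigma>T (\<lambda>x. (LINT \<xi>|M n. \<phi>\<^sub>\<xi> n \<xi> x) - \<phi> x)" using B(1) by simp
    have "L2_norm xL xR \<sigma>T (\<lambda>x. (LINT \<xi>|M n. \<phi>\<^sub>\<xi> n \<xi> x) - \<phi> x) \<le> A / real n ^ 3 * sqrt w" using B(2) by simp
    also have "\<dots> = (A * sqrt w) * real n powr (-3)" unfolding n3 by simp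
    also have "\<dots> \<le> c * lam * real n powr (-3)" using c1 by (intro mult_right_mono) auto
    also have "\<dots> \<le> c * lam * real n powr (-3) * ln (real n)"
      using ln1 c0 \<open>0 < lam\<close> by (intro le_mult_of_one_le) auto
    finally show "L2_norm xL xR \<sigma>T (\<lambda>x. (LINT \<xi>|M n. \<phi>\<^sub>\<xi> n \<xi> x) - \<phi> x) \<le> c * lam * real n powr (-3) * ln (real n)" .
  qed simp
qed

end
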